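(* Let $k$ be an arbitrary field and let $G$ be a locally finite group such that $\mathrm{soc}(G)$ is essential in $G$. Then $G$ has a faithful irreducible representation over $k$ if and only if $\mathrm{char}(k)\notin\Pi'(G)$ and there is a subgroup $C$ of $\mathrm{A}(G)$ such that $\mathrm{A}(G)/C$ is locally cyclic and $\mathrm{core}_G(C)=1$.
   Context: Groups may be infinite and representations may be infinite dimensional; a representation of $G$ over $k$ corresponds to a left $kG$-module, where $kG$ is the group algebra. It is faithful if only the identity of $G$ acts trivially, and irreducible if the module is nonzero and has no submodules other than $0$ and itself. $\mathrm{soc}(G)$ is the subgroup of $G$ generated by all minimal normal subgroups of $G$ (minimal among the nontrivial normal subgroups). $\mathrm{A}(G)$ is the subgroup of $G$ generated by all minimal normal subgroups of $G$ that are torsion abelian. A normal subgroup $N$ of $G$ is essential if every nontrivial normal subgroup of $G$ intersects $N$ nontrivially. A group is locally cyclic (resp. locally finite) if every finitely generated subgroup of it is cyclic (resp. finite). For a subgroup $C$ of $G$, $\mathrm{core}_G(C)$ is the largest normal subgroup of $G$ contained in $C$, i.e. $\bigcap_{g\in G} gCg^{-1}$. $\Pi'(G)$ is the set of all primes $p$ such that $G$ has a nontrivial normal $p$-subgroup (a $p$-group being a group, possibly infinite, in which every element has order a power of $p$). *)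

theory Defs
  imports "HOL-Algebra.Algebra"
begin

section \<open>Groups\<close>

definition locally_finite :: "('a, 'm) monoid_scheme \<Rightarrow> bool" where
  "locally_finite G \<longleftrightarrow>
     (\<forall>S. finite S \<and> S \<subseteq> carrier G \<longrightarrow> finite (carrier (subgroup_generated G S)))"

definition locally_cyclic :: "('a, 'm) monoid_scheme \<Rightarrow> bool" where
  "locally_cyclic G \<longleftrightarrow>
     (\<forall>S. finite S \<and> S \<subseteq> carrier G \<longrightarrow> cyclic_group (subgroup_generated G S))"

definition minimal_normal :: "'a set \<Rightarrow> ('a, 'm) monoid_scheme \<Rightarrow> bool" where
  "minimal_normal N G \<longleftrightarrow>
     N \<lhd> G \<and> N \<noteq> {\<one>\<^bsub>G\<^esub>} \<and>
     (\<forall>M. M \<lhd> G \<and> M \<noteq> {\<one>\<^bsub>G\<^esub>} \<and> M \<subseteq> N \<longrightarrow> M = N)"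

definition torsion_group :: "('a, 'm) monoid_scheme \<Rightarrow> bool" where
  "torsion_group G \<longleftrightarrow> group G \<and> (\<forall>x\<in>carrier G. \<exists>n::nat. n > 0 \<and> x [^]\<^bsub>G\<^esub> n = \<one>\<^bsub>G\<^esub>)"

definition soc :: "('a, 'm) monoid_scheme \<Rightarrow> 'a set" where
  "soc G = generate G (\<Union>{N. minimal_normal N G})"

definition abelian_soc :: "('a, 'm) monoid_scheme \<Rightarrow> 'a set" where
  "abelian_soc G = generate G (\<Union>{N. minimal_normal N G \<and>
     comm_group (G\<lparr>carrier := N\<rparr>) \<and> torsion_group (G\<lparr>carrier := N\<rparr>)})"

text \<open>
  Distinct minimal normal subgroups commute elementwise, so \<open>abelian_soc G\<close> is an abelian group
  and all of its subgroups are normal in it; its quotients by \<open>Mod\<close> are therefore genuine.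
\<close>

definition essential_normal :: "'a set \<Rightarrow> ('a, 'm) monoid_scheme \<Rightarrow> bool" where
  "essential_normal N G \<longleftrightarrow>
     N \<lhd> G \<and> (\<forall>M. M \<lhd> G \<and> M \<noteq> {\<one>\<^bsub>G\<^esub>} \<longrightarrow> M \<inter> N \<noteq> {\<one>\<^bsub>G\<^esub>})"

definition core :: "('a, 'm) monoid_scheme \<Rightarrow> 'a set \<Rightarrow> 'a set" where
  "core G C = (\<Inter>g\<in>carrier G. g <#\<^bsub>G\<^esub> C #>\<^bsub>G\<^esub> (inv\<^bsub>G\<^esub> g))"

definition p_group :: "nat \<Rightarrow> ('a, 'm) monoid_scheme \<Rightarrow> bool" where
  "p_group p G \<longleftrightarrow> group G \<and> (\<forall>x\<in>carrier G. \<exists>n::nat. group.ord G x = p ^ n)"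

definition normal_primes :: "('a, 'm) monoid_scheme \<Rightarrow> nat set" where
  "normal_primes G =
     {p. Factorial_Ring.prime p \<and>
         (\<exists>N. N \<lhd> G \<and> N \<noteq> {\<one>\<^bsub>G\<^esub>} \<and> p_group p (G\<lparr>carrier := N\<rparr>))}"


section \<open>Representations\<close>

definition ring_char :: "('k, 'n) ring_scheme \<Rightarrow> nat" where
  "ring_char K =
     (if \<exists>n::nat. n > 0 \<and> [n] \<cdot>\<^bsub>K\<^esub> \<one>\<^bsub>K\<^esub> = \<zero>\<^bsub>K\<^esub>
      then LEAST n::nat. n > 0 \<and> [n] \<cdot>\<^bsub>K\<^esub> \<one>\<^bsub>K\<^esub> = \<zero>\<^bsub>K\<^esub>
      else 0)"

locale representation =
  group_action G "carrier V" \<rho> + module K V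
  for G :: "('g, 'm) monoid_scheme" and K :: "('k, 'n) ring_scheme"
    and V :: "('k, 'v) module" and \<rho> :: "'g \<Rightarrow> 'v \<Rightarrow> 'v" +
  assumes linear_add: "\<lbrakk>g \<in> carrier G; x \<in> carrier V; y \<in> carrier V\<rbrakk>
      \<Longrightarrow> \<rho> g (x \<oplus>\<^bsub>V\<^esub> y) = \<rho> g x \<oplus>\<^bsub>V\<^esub> \<rho> g y"
    and linear_smult: "\<lbrakk>g \<in> carrier G; a \<in> carrier K; x \<in> carrier V\<rbrakk>
      \<Longrightarrow> \<rho> g (a \<odot>\<^bsub>V\<^esub> x) = a \<odot>\<^bsub>V\<^esub> \<rho> g x"

definition subrepresentation ::
    "'v set \<Rightarrow> ('g, 'm) monoid_scheme \<Rightarrow> ('k, 'n) ring_scheme \<Rightarrow> ('k, 'v) module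
     \<Rightarrow> ('g \<Rightarrow> 'v \<Rightarrow> 'v) \<Rightarrow> bool" where
  "subrepresentation W G K V \<rho> \<longleftrightarrow>
     submodule W K V \<and> (\<forall>g\<in>carrier G. \<forall>w\<in>W. \<rho> g w \<in> W)"

definition irreducible_rep ::
    "('g, 'm) monoid_scheme \<Rightarrow> ('k, 'n) ring_scheme \<Rightarrow> ('k, 'v) module
     \<Rightarrow> ('g \<Rightarrow> 'v \<Rightarrow> 'v) \<Rightarrow> bool" where
  "irreducible_rep G K V \<rho> \<longleftrightarrow>
     representation G K V \<rho> \<and> carrier V \<noteq> {\<zero>\<^bsub>V\<^esub>} \<and>
     (\<forall>W. subrepresentation W G K V \<rho> \<longrightarrow> W = {\<zero>\<^bsub>V\<^esub>} \<or> W = carrier V)"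

definition faithful_rep ::
    "('g, 'm) monoid_scheme \<Rightarrow> ('k, 'n) ring_scheme \<Rightarrow> ('k, 'v) module
     \<Rightarrow> ('g \<Rightarrow> 'v \<Rightarrow> 'v) \<Rightarrow> bool" where
  "faithful_rep G K V \<rho> \<longleftrightarrow>
     representation G K V \<rho> \<and>
     (\<forall>g\<in>carrier G. (\<forall>v\<in>carrier V. \<rho> g v = v) \<longrightarrow> g = \<one>\<^bsub>G\<^esub>)"

text \<open>
  Types cannot be quantified existentially, so the underlying vector space is sought on the
  type of functions from the group to the field. This is no restriction: an irreducible
  representation is a quotient of the group algebra, hence can be transported to that type.
  See \<open>has_faithful_irreducible_repI\<close> below.
\<close>

definition has_faithful_irreducible_rep ::
    "('g, 'm) monoid_scheme \<Rightarrow> ('k, 'n) ring_scheme \<Rightarrow> bool" where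
  "has_faithful_irreducible_rep G K \<longleftrightarrow>
     (\<exists>(V :: ('k, 'g \<Rightarrow> 'k) module) \<rho>. irreducible_rep G K V \<rho> \<and> faithful_rep G K V \<rho>)"


subsection \<open>The action of the group algebra\<close>

text \<open>
  Elements of the group algebra are the finitely supported functions from \<open>G\<close> to \<open>K\<close>;
  the subrepresentations are exactly the submodules for its action on \<open>V\<close>.
\<close>

definition group_algebra_carrier ::
    "('g, 'm) monoid_scheme \<Rightarrow> ('k, 'n) ring_scheme \<Rightarrow> ('g \<Rightarrow> 'k) set" where
  "group_algebra_carrier G K =
     {f \<in> carrier G \<rightarrow>\<^sub>E carrier K. finite {g \<in> carrier G. f g \<noteq> \<zero>\<^bsub>K\<^esub>}}"

definition group_algebra_act ::
    "('g, 'm) monoid_scheme \<Rightarrow> ('k, 'n) ring_scheme \<Rightarrow> ('k, 'v) module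
     \<Rightarrow> ('g \<Rightarrow> 'v \<Rightarrow> 'v) \<Rightarrow> ('g \<Rightarrow> 'k) \<Rightarrow> 'v \<Rightarrow> 'v" where
  "group_algebra_act G K V \<rho> f v =
     (\<Oplus>\<^bsub>V\<^esub>g\<in>{g \<in> carrier G. f g \<noteq> \<zero>\<^bsub>K\<^esub>}. f g \<odot>\<^bsub>V\<^esub> \<rho> g v)"

context representation
begin

lemma grp: "group G"
  using group_hom group_hom.axioms(1) by blast

lemma act_closed [simp, intro]:
  "g \<in> carrier G \<Longrightarrow> x \<in> carrier V \<Longrightarrow> \<rho> g x \<in> carrier V"
  using element_image by blast

lemma act_mult:
  assumes "g \<in> carrier G" "h \<in> carrier G" "x \<in> carrier V"
  shows "\<rho> (g \<otimes>\<^bsub>G\<^esub> h) x = \<rho> g (\<rho> h x)"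
  using composition_rule assms by blast

lemma act_one: "x \<in> carrier V \<Longrightarrow> \<rho> \<one>\<^bsub>G\<^esub> x = x"
  by (metis id_eq_one restrict_apply')

lemma act_zero: "g \<in> carrier G \<Longrightarrow> \<rho> g \<zero>\<^bsub>V\<^esub> = \<zero>\<^bsub>V\<^esub>"
  using linear_smult[of g "\<zero>\<^bsub>K\<^esub>" "\<zero>\<^bsub>V\<^esub>"] by simp

lemma act_finsum:
  assumes "finite A" "g \<in> carrier G" "F \<in> A \<rightarrow> carrier V"
  shows "\<rho> g (\<Oplus>\<^bsub>V\<^esub>h\<in>A. F h) = (\<Oplus>\<^bsub>V\<^esub>h\<in>A. \<rho> g (F h))"
  using assms
proof (induction A)
  case empty
  then show ?case by (simp add: act_zero)
next
  case (insert h A)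
  then have "F \<in> A \<rightarrow> carrier V" "F h \<in> carrier V" by auto
  moreover from this have "(\<lambda>h. \<rho> g (F h)) \<in> A \<rightarrow> carrier V" using insert by auto
  ultimately show ?case using insert by (simp add: linear_add)
qed

lemma kG_act_eq:
  assumes "finite A" "A \<subseteq> carrier G" "{g \<in> carrier G. f g \<noteq> \<zero>\<^bsub>K\<^esub>} \<subseteq> A"
    "\<And>g. g \<in> carrier G \<Longrightarrow> f g \<in> carrier K" "v \<in> carrier V"
  shows "group_algebra_act G K V \<rho> f v = (\<Oplus>\<^bsub>V\<^esub>g\<in>A. f g \<odot>\<^bsub>V\<^esub> \<rho> g v)"
  unfolding group_algebra_act_def
  apply (rule add.finprod_mono_neutral_cong_left)
  using assms by auto

lemma kG_act_mem:
  assumes W: "subrepresentation W G K V \<rho>" and f: "f \<in> group_algebra_carrier G K" and w: "w \<in> W"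
  shows "group_algebra_act G K V \<rho> f w \<in> W"
proof -
  have sm: "submodule W K V" and st: "\<And>g w. g \<in> carrier G \<Longrightarrow> w \<in> W \<Longrightarrow> \<rho> g w \<in> W"
    using W by (auto simp: subrepresentation_def)
  note sE = submoduleE[OF sm]
  have z: "\<zero>\<^bsub>V\<^esub> \<in> W" using sm subgroup.one_closed submodule.axioms(1) by force
  have "(\<Oplus>\<^bsub>V\<^esub>g\<in>A. F g) \<in> W" if "finite A" "F \<in> A \<rightarrow> W" for A and F :: "'g \<Rightarrow> 'v"
    using that
  proof (induction A)
    case empty
    then show ?case using z by simp
  next
    case (insert h A)
    then have "F \<in> A \<rightarrow> carrier V" "F h \<in> carrier V" "F \<in> A \<rightarrow> W" "F h \<in> W" using sE(1) by auto
    then show ?case using insert sE(5) by simp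
  qed
  moreover have "(\<lambda>g. f g \<odot>\<^bsub>V\<^esub> \<rho> g w) \<in> {g \<in> carrier G. f g \<noteq> \<zero>\<^bsub>K\<^esub>} \<rightarrow> W"
    using sE(4) st w f by (auto simp: group_algebra_carrier_def PiE_iff)
  ultimately show ?thesis
    using f by (simp add: group_algebra_act_def group_algebra_carrier_def)
qed

lemma kG_single:
  assumes "g \<in> carrier G" "a \<in> carrier K" "v \<in> carrier V"
  shows "(\<lambda>x\<in>carrier G. if x = g then a else \<zero>\<^bsub>K\<^esub>) \<in> group_algebra_carrier G K"
    and "group_algebra_act G K V \<rho> (\<lambda>x\<in>carrier G. if x = g then a else \<zero>\<^bsub>K\<^esub>) v = a \<odot>\<^bsub>V\<^esub> \<rho> g v"
proof -
  have fin: "finite {x \<in> carrier G. (\<lambda>x\<in>carrier G. if x = g then a else \<zero>\<^bsub>K\<^esub>) x \<noteq> \<zero>\<^bsub>K\<^esub>}"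
    by (rule finite_subset[of _ "{g}"]) auto
  then show "(\<lambda>x\<in>carrier G. if x = g then a else \<zero>\<^bsub>K\<^esub>) \<in> group_algebra_carrier G K"
    using assms by (auto simp: group_algebra_carrier_def)
  show "group_algebra_act G K V \<rho> (\<lambda>x\<in>carrier G. if x = g then a else \<zero>\<^bsub>K\<^esub>) v = a \<odot>\<^bsub>V\<^esub> \<rho> g v"
    by (subst kG_act_eq[of "{g}"]) (use assms in auto)
qed

theorem subrepresentation_iff_group_algebra_submodule:
  "subrepresentation W G K V \<rho> \<longleftrightarrow>
     subgroup W (add_monoid V) \<and>
     (\<forall>f\<in>group_algebra_carrier G K. \<forall>w\<in>W. group_algebra_act G K V \<rho> f w \<in> W)"
    (is "?L \<longleftrightarrow> ?R")
proof
  assume ?L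
  then show ?R using kG_act_mem submodule.axioms(1) by (auto simp: subrepresentation_def)
next
  assume R: ?R
  then have sub: "W \<subseteq> carrier V" using subgroup.subset by force
  have closed: "a \<odot>\<^bsub>V\<^esub> \<rho> g w \<in> W" if "g \<in> carrier G" "a \<in> carrier K" "w \<in> W" for g a w
    using kG_single[OF that(1,2), of w] R that sub by force
  have "a \<odot>\<^bsub>V\<^esub> w \<in> W" if "a \<in> carrier K" "w \<in> W" for a w
    using closed[of "\<one>\<^bsub>G\<^esub>" a w] that act_one[OF subsetD[OF sub that(2)]]
    by (simp add: group.is_monoid[OF grp] monoid.one_closed)
  moreover have "\<rho> g w \<in> W" if "g \<in> carrier G" "w \<in> W" for g w
    using closed[of g "\<one>\<^bsub>K\<^esub>" w] that subsetD[OF sub that(2)] by simp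
  ultimately show ?L
    using R by (auto simp: subrepresentation_def intro!: submodule.intro submodule_axioms.intro)
qed

lemma kG_orbit_subrep:
  assumes v: "v \<in> carrier V"
  shows "subrepresentation ((\<lambda>f. group_algebra_act G K V \<rho> f v) ` group_algebra_carrier G K) G K V \<rho>"
    (is "subrepresentation ?W G K V \<rho>")
proof -
  let ?S = "\<lambda>f. {g \<in> carrier G. f g \<noteq> \<zero>\<^bsub>K\<^esub>}"
  have memI: "(\<Oplus>\<^bsub>V\<^esub>g\<in>A. f g \<odot>\<^bsub>V\<^esub> \<rho> g v) \<in> ?W"
    if A: "finite A" "A \<subseteq> carrier G" and f: "f \<in> A \<rightarrow> carrier K" for A f
  proof -
    let ?f = "\<lambda>g\<in>carrier G. if g \<in> A then f g else \<zero>\<^bsub>K\<^esub>"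
    have s: "?S ?f \<subseteq> A" by auto
    have "?f \<in> group_algebra_carrier G K"
      using f finite_subset[OF s A(1)] by (auto simp: group_algebra_carrier_def)
    moreover have "group_algebra_act G K V \<rho> ?f v = (\<Oplus>\<^bsub>V\<^esub>g\<in>A. ?f g \<odot>\<^bsub>V\<^esub> \<rho> g v)"
      by (rule kG_act_eq) (use A s f v in auto)
    moreover have "\<dots> = (\<Oplus>\<^bsub>V\<^esub>g\<in>A. f g \<odot>\<^bsub>V\<^esub> \<rho> g v)"
      by (rule M.finsum_cong') (use A f v in \<open>auto simp: Pi_iff subset_iff\<close>)
    ultimately show ?thesis by (metis (no_types, lifting) image_eqI)
  qed
  have memE: "\<exists>A f. finite A \<and> A \<subseteq> carrier G \<and> f \<in> carrier G \<rightarrow> carrier K \<and>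
      (\<forall>g\<in>carrier G - A. f g = \<zero>\<^bsub>K\<^esub>) \<and> w = (\<Oplus>\<^bsub>V\<^esub>g\<in>A. f g \<odot>\<^bsub>V\<^esub> \<rho> g v)"
    if w: "w \<in> ?W" for w
  proof -
    obtain f where f: "f \<in> group_algebra_carrier G K" "w = group_algebra_act G K V \<rho> f v"
      using w by blast
    show ?thesis
      by (rule exI[of _ "?S f"], rule exI[of _ f])
        (use f in \<open>auto simp: group_algebra_carrier_def group_algebra_act_def PiE_iff\<close>)
  qed
  have sub: "?W \<subseteq> carrier V"
  proof
    fix w assume "w \<in> ?W"
    from memE[OF this] obtain A f where "A \<subseteq> carrier G" "f \<in> carrier G \<rightarrow> carrier K"
      "w = (\<Oplus>\<^bsub>V\<^esub>g\<in>A. f g \<odot>\<^bsub>V\<^esub> \<rho> g v)" by blast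
    then show "w \<in> carrier V" using v by (auto intro!: M.finsum_closed)
  qed
  have smul: "a \<odot>\<^bsub>V\<^esub> w \<in> ?W" if a: "a \<in> carrier K" and w: "w \<in> ?W" for a w
  proof -
    obtain A f where A: "finite A" "A \<subseteq> carrier G" "f \<in> carrier G \<rightarrow> carrier K"
      "w = (\<Oplus>\<^bsub>V\<^esub>g\<in>A. f g \<odot>\<^bsub>V\<^esub> \<rho> g v)" using memE[OF w] by blast
    have "a \<odot>\<^bsub>V\<^esub> w = (\<Oplus>\<^bsub>V\<^esub>g\<in>A. a \<odot>\<^bsub>V\<^esub> (f g \<odot>\<^bsub>V\<^esub> \<rho> g v))"
      unfolding A(4) by (rule finsum_smult_ldistr) (use A a v in auto)
    also have "\<dots> = (\<Oplus>\<^bsub>V\<^esub>g\<in>A. (a \<otimes>\<^bsub>K\<^esub> f g) \<odot>\<^bsub>V\<^esub> \<rho> g v)"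
      by (rule M.finsum_cong') (use A a v in \<open>auto simp: Pi_iff subset_iff smult_assoc1\<close>)
    also have "\<dots> \<in> ?W" by (rule memI) (use A a in auto)
    finally show ?thesis .
  qed
  have add: "x \<oplus>\<^bsub>V\<^esub> y \<in> ?W" if x: "x \<in> ?W" and y: "y \<in> ?W" for x y
  proof -
    obtain A f where A: "finite A" "A \<subseteq> carrier G" "f \<in> carrier G \<rightarrow> carrier K"
      "\<forall>g\<in>carrier G - A. f g = \<zero>\<^bsub>K\<^esub>" "x = (\<Oplus>\<^bsub>V\<^esub>g\<in>A. f g \<odot>\<^bsub>V\<^esub> \<rho> g v)" using memE[OF x] by blast
    obtain B h where B: "finite B" "B \<subseteq> carrier G" "h \<in> carrier G \<rightarrow> carrier K"
      "\<forall>g\<in>carrier G - B. h g = \<zero>\<^bsub>K\<^esub>" "y = (\<Oplus>\<^bsub>V\<^esub>g\<in>B. h g \<odot>\<^bsub>V\<^esub> \<rho> g v)" using memE[OF y] by blast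
    have AB: "f g \<in> carrier K" "h g \<in> carrier K" "g \<in> carrier G" if "g \<in> A \<union> B" for g
      using that A(2,3) B(2,3) by auto
    have "x = (\<Oplus>\<^bsub>V\<^esub>g\<in>A \<union> B. f g \<odot>\<^bsub>V\<^esub> \<rho> g v)"
      unfolding A(5) by (rule add.finprod_mono_neutral_cong_left) (use A B AB v in auto)
    moreover have "y = (\<Oplus>\<^bsub>V\<^esub>g\<in>A \<union> B. h g \<odot>\<^bsub>V\<^esub> \<rho> g v)"
      unfolding B(5) by (rule add.finprod_mono_neutral_cong_left) (use A B AB v in auto)
    ultimately have "x \<oplus>\<^bsub>V\<^esub> y = (\<Oplus>\<^bsub>V\<^esub>g\<in>A \<union> B. f g \<odot>\<^bsub>V\<^esub> \<rho> g v \<oplus>\<^bsub>V\<^esub> h g \<odot>\<^bsub>V\<^esub> \<rho> g v)"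
      using AB v by (subst M.finsum_addf) auto
    also have "\<dots> = (\<Oplus>\<^bsub>V\<^esub>g\<in>A \<union> B. (f g \<oplus>\<^bsub>K\<^esub> h g) \<odot>\<^bsub>V\<^esub> \<rho> g v)"
      by (rule M.finsum_cong') (use AB v in \<open>auto simp: smult_l_distr\<close>)
    also have "\<dots> \<in> ?W" by (rule memI) (use A B AB in auto)
    finally show ?thesis .
  qed
  have stable: "\<rho> k w \<in> ?W" if k: "k \<in> carrier G" and w: "w \<in> ?W" for k w
  proof -
    interpret Gg: group G by (rule grp)
    obtain A f where A: "finite A" "A \<subseteq> carrier G" "f \<in> carrier G \<rightarrow> carrier K"
      "w = (\<Oplus>\<^bsub>V\<^esub>g\<in>A. f g \<odot>\<^bsub>V\<^esub> \<rho> g v)" using memE[OF w] by blast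
    have "\<rho> k w = (\<Oplus>\<^bsub>V\<^esub>g\<in>A. \<rho> k (f g \<odot>\<^bsub>V\<^esub> \<rho> g v))"
      unfolding A(4) by (rule act_finsum) (use A k v in auto)
    also have "\<dots> = (\<Oplus>\<^bsub>V\<^esub>g\<in>A. f (inv\<^bsub>G\<^esub> k \<otimes>\<^bsub>G\<^esub> (k \<otimes>\<^bsub>G\<^esub> g)) \<odot>\<^bsub>V\<^esub> \<rho> (k \<otimes>\<^bsub>G\<^esub> g) v)"
      by (rule M.finsum_cong')
        (use A k v in \<open>auto simp: Pi_iff subset_iff linear_smult act_mult Gg.m_assoc[symmetric]\<close>)
    also have "\<dots> = (\<Oplus>\<^bsub>V\<^esub>g\<in>(\<lambda>g. k \<otimes>\<^bsub>G\<^esub> g) ` A. f (inv\<^bsub>G\<^esub> k \<otimes>\<^bsub>G\<^esub> g) \<odot>\<^bsub>V\<^esub> \<rho> g v)"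
      by (rule M.finsum_reindex[symmetric])
        (use A k v in \<open>auto simp: Pi_iff subset_iff inj_on_def\<close>)
    also have "\<dots> \<in> ?W" by (rule memI) (use A k in auto)
    finally show ?thesis .
  qed
  have z: "\<zero>\<^bsub>V\<^esub> \<in> ?W" using memI[of "{}"] by simp
  have "submodule ?W K V"
  proof (rule submoduleI[OF sub z])
    fix w assume w: "w \<in> ?W"
    have "(\<ominus>\<^bsub>K\<^esub> \<one>\<^bsub>K\<^esub>) \<odot>\<^bsub>V\<^esub> w \<in> ?W" by (rule smul) (use w in auto)
    moreover have "w \<in> carrier V" using w sub by blast
    then have "(\<ominus>\<^bsub>K\<^esub> \<one>\<^bsub>K\<^esub>) \<odot>\<^bsub>V\<^esub> w = \<ominus>\<^bsub>V\<^esub> w" by (simp add: smult_l_minus)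
    ultimately show "\<ominus>\<^bsub>V\<^esub> w \<in> ?W" by simp
  qed (use add smul in auto)
  then show ?thesis using stable by (simp add: subrepresentation_def)
qed

lemma transport_rep:
  fixes i :: "'v \<Rightarrow> 'w"
  assumes inj: "inj_on i (carrier V)"
  defines "j \<equiv> inv_into (carrier V) i"
  defines "V' \<equiv> \<lparr>carrier = i ` carrier V, monoid.mult = undefined, one = undefined,
      ring.zero = i \<zero>\<^bsub>V\<^esub>, add = (\<lambda>x y. i (j x \<oplus>\<^bsub>V\<^esub> j y)), smult = (\<lambda>a x. i (a \<odot>\<^bsub>V\<^esub> j x))\<rparr>"
  defines "\<rho>' \<equiv> (\<lambda>g. \<lambda>x\<in>i ` carrier V. i (\<rho> g (j x)))"
  shows "representation G K V' \<rho>'"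
    and "irreducible_rep G K V \<rho> \<Longrightarrow> irreducible_rep G K V' \<rho>'"
    and "faithful_rep G K V \<rho> \<Longrightarrow> faithful_rep G K V' \<rho>'"
proof -
  have ji [simp]: "j (i x) = x" if "x \<in> carrier V" for x
    using that inj by (simp add: j_def)
  have V' [simp]: "carrier V' = i ` carrier V" "\<zero>\<^bsub>V'\<^esub> = i \<zero>\<^bsub>V\<^esub>"
     "\<And>x y. x \<oplus>\<^bsub>V'\<^esub> y = i (j x \<oplus>\<^bsub>V\<^esub> j y)" "\<And>a x. a \<odot>\<^bsub>V'\<^esub> x = i (a \<odot>\<^bsub>V\<^esub> j x)"
    by (simp_all add: V'_def)
  have \<rho>' [simp]: "\<rho>' g (i x) = i (\<rho> g x)" if "x \<in> carrier V" for g x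
    using that by (simp add: \<rho>'_def)
  interpret Gg: group G by (rule grp)
  have ab: "abelian_group V'"
  proof (rule abelian_groupI)
    fix x assume "x \<in> carrier V'"
    then obtain x0 where x0: "x0 \<in> carrier V" "x = i x0" by auto
    show "\<exists>y\<in>carrier V'. y \<oplus>\<^bsub>V'\<^esub> x = \<zero>\<^bsub>V'\<^esub>"
      by (rule bexI[of _ "i (\<ominus>\<^bsub>V\<^esub> x0)"]) (use x0 in \<open>auto simp: M.l_neg\<close>)
  qed (auto simp: M.a_ac)
  have mod: "module K V'"
    by (rule moduleI[OF R.is_cring ab])
      (auto simp: smult_l_distr smult_r_distr smult_assoc1)
  have bij: "\<rho>' g \<in> Bij (carrier V')" if g: "g \<in> carrier G" for g
  proof -
    have "bij_betw (\<rho>' g) (i ` carrier V) (i ` carrier V)"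
      by (rule bij_betw_byWitness[where f' = "\<rho>' (inv\<^bsub>G\<^esub> g)"])
        (use g in \<open>auto simp: act_mult[symmetric] act_one\<close>)
    then show ?thesis by (auto simp: Bij_def \<rho>'_def)
  qed
  have "group_hom G (BijGroup (carrier V')) \<rho>'"
  proof (unfold group_hom_def group_hom_axioms_def, intro conjI homI)
    fix g h assume gh: "g \<in> carrier G" "h \<in> carrier G"
    show "\<rho>' (g \<otimes>\<^bsub>G\<^esub> h) = \<rho>' g \<otimes>\<^bsub>BijGroup (carrier V')\<^esub> \<rho>' h"
    proof
      fix x
      show "\<rho>' (g \<otimes>\<^bsub>G\<^esub> h) x = (\<rho>' g \<otimes>\<^bsub>BijGroup (carrier V')\<^esub> \<rho>' h) x"
        using gh bij by (auto simp: BijGroup_def compose_def act_mult \<rho>'_def inj_on_eq_iff[OF inj])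
    qed
  qed (use bij group_BijGroup in \<open>auto simp: BijGroup_def\<close>)
  then have ga: "group_action G (carrier V') \<rho>'" by (rule group_action.intro)
  show rep: "representation G K V' \<rho>'"
    by (intro representation.intro ga mod representation_axioms.intro)
       (auto simp: linear_add linear_smult)
  interpret R': module K V' by (rule mod)
  show "irreducible_rep G K V' \<rho>'" if irr: "irreducible_rep G K V \<rho>"
  proof -
    have "W = {\<zero>\<^bsub>V'\<^esub>} \<or> W = carrier V'" if W: "subrepresentation W G K V' \<rho>'" for W
    proof -
      have sm: "submodule W K V'" and st: "\<And>g w. g \<in> carrier G \<Longrightarrow> w \<in> W \<Longrightarrow> \<rho>' g w \<in> W"
        using W by (auto simp: subrepresentation_def)
      note sE = R'.submoduleE[OF sm]
      define W0 where "W0 = {x \<in> carrier V. i x \<in> W}"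
      have WW: "W = i ` W0" using sE(1) by (auto simp: W0_def)
      have z: "\<zero>\<^bsub>V'\<^esub> \<in> W" using sm subgroup.one_closed submodule.axioms(1) by force
      have smul: "a \<odot>\<^bsub>V\<^esub> x \<in> W0" if "a \<in> carrier K" "x \<in> W0" for a x
        using sE(4)[of a "i x"] that by (auto simp: W0_def)
      have "submodule W0 K V"
      proof (rule submoduleI)
        fix x assume x: "x \<in> W0"
        then show "\<ominus>\<^bsub>V\<^esub> x \<in> W0"
          using smul[of "\<ominus>\<^bsub>K\<^esub> \<one>\<^bsub>K\<^esub>" x] smult_l_minus[of "\<one>\<^bsub>K\<^esub>" x] by (auto simp: W0_def)
      next
        fix x y assume "x \<in> W0" "y \<in> W0"
        then show "x \<oplus>\<^bsub>V\<^esub> y \<in> W0" using sE(5)[of "i x" "i y"] by (auto simp: W0_def)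
      qed (use z smul in \<open>auto simp: W0_def\<close>)
      moreover have "\<rho> g x \<in> W0" if "g \<in> carrier G" "x \<in> W0" for g x
        using st[of g "i x"] that by (auto simp: W0_def)
      ultimately have "subrepresentation W0 G K V \<rho>" by (simp add: subrepresentation_def)
      then have "W0 = {\<zero>\<^bsub>V\<^esub>} \<or> W0 = carrier V" using irr by (simp add: irreducible_rep_def)
      then show ?thesis using WW by auto
    qed
    moreover have "carrier V' \<noteq> {\<zero>\<^bsub>V'\<^esub>}"
    proof
      assume "carrier V' = {\<zero>\<^bsub>V'\<^esub>}"
      then have "x = \<zero>\<^bsub>V\<^esub>" if "x \<in> carrier V" for x
        using that inj by (metis V'(1,2) M.zero_closed image_eqI inj_onD singletonD)
      then show False using irr by (auto simp: irreducible_rep_def)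
    qed
    ultimately show ?thesis using rep by (simp add: irreducible_rep_def)
  qed
  show "faithful_rep G K V' \<rho>'" if "faithful_rep G K V \<rho>"
  proof -
    have "g = \<one>\<^bsub>G\<^esub>" if g: "g \<in> carrier G" "\<forall>v\<in>carrier V'. \<rho>' g v = v" for g
    proof -
      have "\<rho> g x = x" if "x \<in> carrier V" for x
        using g that inj_onD[OF inj, of "\<rho> g x" x] by auto
      then show ?thesis using \<open>faithful_rep G K V \<rho>\<close> g by (auto simp: faithful_rep_def)
    qed
    then show ?thesis using rep by (simp add: faithful_rep_def)
  qed
qed

end

theorem has_faithful_irreducible_repI:
  fixes G :: "('g, 'm) monoid_scheme" and K :: "('k, 'n) ring_scheme"
    and V :: "('k, 'v) module" and \<rho> :: "'g \<Rightarrow> 'v \<Rightarrow> 'v"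
  assumes irr: "irreducible_rep G K V \<rho>" and faith: "faithful_rep G K V \<rho>"
  shows "has_faithful_irreducible_rep G K"
proof -
  interpret representation G K V \<rho> using irr by (simp add: irreducible_rep_def)
  interpret Gg: group G by (rule grp)
  have "carrier V \<noteq> {\<zero>\<^bsub>V\<^esub>}" using irr by (simp add: irreducible_rep_def)
  then obtain v where v: "v \<in> carrier V" "v \<noteq> \<zero>\<^bsub>V\<^esub>" using M.zero_closed by blast
  let ?a = "\<lambda>f. group_algebra_act G K V \<rho> f v"
  let ?W = "?a ` group_algebra_carrier G K"
  have "v \<in> ?W"
    using kG_single[of "\<one>\<^bsub>G\<^esub>" "\<one>\<^bsub>K\<^esub>" v] v act_one by (metis Gg.one_closed R.one_closed image_eqI smult_one)
  then have W: "?W = carrier V"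
    using irr kG_orbit_subrep[OF v(1)] v unfolding irreducible_rep_def by blast
  have "inj_on (inv_into (group_algebra_carrier G K) ?a) (carrier V)"
    by (rule inj_on_inv_into) (simp add: W)
  from transport_rep(2,3)[OF this] show ?thesis
    unfolding has_faithful_irreducible_rep_def using irr faith by blast
qed

end

theory Submission
  imports Defs
begin

text \<open>
  Write \<open>A\<close> for the abelian socle of \<open>G\<close> and \<open>p\<close> for the characteristic of \<open>K\<close>. The tool used
  in both directions is the norm element \<open>1 + d + \<dots> + d ^ (n - 1)\<close> of a group element with
  \<open>d ^ n = 1\<close>: it acts as the scalar \<open>n\<close> wherever \<open>d\<close> acts trivially, and its values are fixed
  by \<open>d\<close>. In the infinite setting irreducible submodules or quotients of a restriction
  need not exist, so all arguments work modulo a subrepresentation \<open>J\<close> that is maximal (by Zorn's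
  lemma) among those avoiding a given vector \<open>v\<close>.

  \<^bold>\<open>Necessity.\<close> Let \<open>V\<close> be faithful and irreducible. If \<open>p\<close> is a prime and \<open>N\<close> is a normal \<open>p\<close>-subgroup, then
  \<open>n - 1\<close> for \<open>n \<in> N\<close> annihilates \<open>V\<close>: by local finiteness a counterexample already lives in a finite
  subgroup \<open>H\<close>, where a finite normal \<open>p\<close>-subgroup has a nonzero fixed vector in every
  nonzero module of characteristic \<open>p\<close> (\<open>normal_p_subgroup_acts_trivially\<close>). Hence \<open>p\<close> is not
  in \<open>normal_primes G\<close>, and so the orders of the elements of \<open>A\<close> are invertible in \<open>K\<close>. Now restrict
  to \<open>A\<close>, choose \<open>J\<close> maximal avoiding some \<open>v \<noteq> 0\<close>, and let \<open>C\<close> consist of the elements fixing \<open>v\<close>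
  modulo \<open>J\<close>. If \<open>x\<close> and \<open>y\<close> in \<open>A\<close> spanned a noncyclic group of exponent \<open>q\<close> modulo \<open>C\<close>, then the
  norm elements of all its nontrivial elements would kill \<open>v\<close> modulo \<open>J\<close>; but their sum over
  suitable elements is the scalar \<open>q\<close> plus terms that also kill \<open>v\<close>. A normal subgroup of \<open>G\<close>
  contained in \<open>C\<close> is trivial, because the vectors killed by products of its norm elements form a
  subrepresentation of \<open>G\<close>, which would be all of \<open>V\<close>, whereas modulo \<open>J\<close> these products act on \<open>v\<close>
  as nonzero scalars (\<open>faithful_irreducible_cocyclic\<close>).

  \<^bold>\<open>Sufficiency.\<close> Given \<open>C\<close>, it suffices to find an irreducible module with a nonzero vector killed
  by the norm elements of all \<open>d \<in> A\<close> whose order modulo \<open>C\<close> is prime and of one suitable element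
  from each nonabelian minimal normal subgroup. Indeed no such element can then lie in the kernel
  of the representation, whereas a nontrivial normal subgroup meets the socle and therefore
  contains a nonabelian minimal normal subgroup or a nontrivial normal subgroup of \<open>G\<close> inside \<open>A\<close>,
  which is not contained in \<open>C\<close>. The elements concerned commute, so for finitely many of
  them one can write down a nonzero vector as in the group algebra of a finite abelian group:
  start with the indicator function of \<open>C\<close> and multiply by factors \<open>1 - y\<close>, where \<open>y\<close> lies outside
  the subgroup carrying the support so far (\<open>socle_witness\<close>). The finite solutions
  are combined into one vector of a module of functions modulo functions vanishing on all sufficiently
  large finite sets, and an irreducible section of that module is the desired representation
  (\<open>cocyclic_imp_faithful_irreducible\<close>).
\<close>

text \<open>
  Below, \<open>prime\<close> is the notion for natural numbers, not the one for elements of a monoid.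
\<close>

hide_const (open) Divisibility.prime

section \<open>Minimal normal subgroups and the socle\<close>

context group begin

lemma cancel_simps:
  assumes "x \<in> carrier G" "z \<in> carrier G"
  shows "inv x \<otimes> (x \<otimes> z) = z" "x \<otimes> (inv x \<otimes> z) = z"
  using assms by (simp_all flip: m_assoc)

lemma pow_in_subgroup: "subgroup H G \<Longrightarrow> x \<in> H \<Longrightarrow> x [^] (n::nat) \<in> H"
  by (induction n) (auto simp: subgroup.one_closed subgroup.m_closed)

lemma conj_pow:
  assumes "g \<in> carrier G" "x \<in> carrier G"
  shows "(g \<otimes> x \<otimes> inv g) [^] (n::nat) = g \<otimes> x [^] n \<otimes> inv g"
proof (induction n)
  case 0 then show ?case using assms by simp
next
  case (Suc n)
  then show ?case using assms by (simp add: m_assoc cancel_simps)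
qed

lemma generate_finite_subset:
  assumes "x \<in> generate G S"
  shows "\<exists>F. finite F \<and> F \<subseteq> S \<and> x \<in> generate G F"
  using assms
proof (induction rule: generate.induct)
  case one show ?case by (intro exI[of _ "{}"]) (auto intro: generate.one)
next
  case (incl h) then show ?case by (intro exI[of _ "{h}"]) (auto intro: generate.incl)
next
  case (inv h) then show ?case by (intro exI[of _ "{h}"]) (auto intro: generate.inv)
next
  case (eng a b)
  then obtain E F where EF: "finite E" "E \<subseteq> S" "a \<in> generate G E" "finite F" "F \<subseteq> S" "b \<in> generate G F" by blast
  have "a \<in> generate G (E \<union> F)" "b \<in> generate G (E \<union> F)"
    using EF mono_generate[of E "E \<union> F"] mono_generate[of F "E \<union> F"] by auto
  then show ?case using EF by (intro exI[of _ "E \<union> F"]) (auto intro: generate.eng)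
qed

text \<open>
  The commutator of \<open>x\<close> and \<open>y\<close> lies in both subgroups.
\<close>

lemma normals_disjoint_commute:
  assumes N: "N \<lhd> G" and M: "M \<lhd> G" and NM: "N \<inter> M \<subseteq> {\<one>}" and x: "x \<in> N" and y: "y \<in> M"
  shows "x \<otimes> y = y \<otimes> x"
proof -
  have c: "x \<in> carrier G" "y \<in> carrier G"
    using x y N M by (meson normal_imp_subgroup subgroup.mem_carrier)+
  have iN: "inv x \<in> N" and iM: "inv y \<in> M"
    using x y N M by (simp_all add: normal_imp_subgroup subgroup.m_inv_closed)
  have "x \<otimes> (y \<otimes> inv x \<otimes> inv y) \<in> N"
    using normal.inv_op_closed2[OF N c(2) iN] x N by (simp add: normal_imp_subgroup subgroup.m_closed)
  moreover have "x \<otimes> y \<otimes> inv x \<otimes> inv y \<in> M"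
    using normal.inv_op_closed2[OF M c(1) y] iM M by (simp add: normal_imp_subgroup subgroup.m_closed)
  ultimately have "x \<otimes> y \<otimes> inv x \<otimes> inv y = \<one>" using NM c by (auto simp: m_assoc)
  then have "x \<otimes> y \<otimes> inv (y \<otimes> x) = \<one>" using c by (simp add: inv_mult_group m_assoc)
  then show ?thesis using c by (metis inv_equality inv_inv m_closed inv_closed)
qed

lemma power_preimage_subgroup:
  assumes A: "subgroup A G" "\<And>x y. x \<in> A \<Longrightarrow> y \<in> A \<Longrightarrow> x \<otimes> y = y \<otimes> x" and C: "subgroup C G"
  shows "subgroup {h \<in> A. h [^] (m::nat) \<in> C} G"
proof (rule subgroupI)
  have AG: "\<And>x. x \<in> A \<Longrightarrow> x \<in> carrier G" using A subgroup.mem_carrier by metis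
  then show "{h \<in> A. h [^] m \<in> C} \<subseteq> carrier G" by auto
  have "\<one> \<in> {h \<in> A. h [^] m \<in> C}" using A C by (simp add: subgroup.one_closed)
  then show "{h \<in> A. h [^] m \<in> C} \<noteq> {}" by blast
  show "inv a \<in> {h \<in> A. h [^] m \<in> C}" if "a \<in> {h \<in> A. h [^] m \<in> C}" for a
    using that A C AG by (auto simp: nat_pow_inv subgroup.m_inv_closed)
  show "a \<otimes> b \<in> {h \<in> A. h [^] m \<in> C}"
    if "a \<in> {h \<in> A. h [^] m \<in> C}" "b \<in> {h \<in> A. h [^] m \<in> C}" for a b
    using that A(1) C AG pow_mult_distrib[OF A(2), of a b m] by (auto simp: subgroup.m_closed)
qed

lemma centralizer_subgroup:
  assumes "T \<subseteq> carrier G"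
  shows "subgroup {x \<in> carrier G. \<forall>y\<in>T. x \<otimes> y = y \<otimes> x} G"
proof (rule subgroupI)
  fix a assume a: "a \<in> {x \<in> carrier G. \<forall>y\<in>T. x \<otimes> y = y \<otimes> x}"
  have "inv a \<otimes> y = y \<otimes> inv a" if "y \<in> T" for y
  proof -
    have y: "y \<in> carrier G" "a \<otimes> y = y \<otimes> a" using a that assms by auto
    then have e: "a \<otimes> y \<otimes> inv a = y" using a by (simp add: m_assoc)
    have ac: "a \<in> carrier G" using a by simp
    have "inv a \<otimes> y = inv a \<otimes> a \<otimes> (y \<otimes> inv a)"
      by (subst e[symmetric]) (use y(1) ac in \<open>simp add: m_assoc cancel_simps\<close>)
    then show ?thesis using y(1) ac by simp
  qed
  then show "inv a \<in> {x \<in> carrier G. \<forall>y\<in>T. x \<otimes> y = y \<otimes> x}" using a by auto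
next
  fix a b
  assume a: "a \<in> {x \<in> carrier G. \<forall>y\<in>T. x \<otimes> y = y \<otimes> x}" and b: "b \<in> {x \<in> carrier G. \<forall>y\<in>T. x \<otimes> y = y \<otimes> x}"
  have "a \<otimes> b \<otimes> y = y \<otimes> (a \<otimes> b)" if "y \<in> T" for y
  proof -
    have c: "a \<in> carrier G" "b \<in> carrier G" "y \<in> carrier G" using a b that assms by auto
    have "a \<otimes> b \<otimes> y = a \<otimes> (y \<otimes> b)" using b c that by (simp add: m_assoc)
    also have "\<dots> = y \<otimes> a \<otimes> b" using a c that by (simp flip: m_assoc)
    finally show ?thesis using c by (simp add: m_assoc)
  qed
  then show "a \<otimes> b \<in> {x \<in> carrier G. \<forall>y\<in>T. x \<otimes> y = y \<otimes> x}" using a b by auto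
next
  show "{x \<in> carrier G. \<forall>y\<in>T. x \<otimes> y = y \<otimes> x} \<noteq> {}"
    using assms by (intro ex_in_conv[THEN iffD1] exI[of _ \<one>]) auto
qed auto

lemma generate_commute:
  assumes S: "S \<subseteq> carrier G" and T: "T \<subseteq> carrier G"
    and comm: "\<And>x y. x \<in> S \<Longrightarrow> y \<in> T \<Longrightarrow> x \<otimes> y = y \<otimes> x"
    and x: "x \<in> generate G S" and y: "y \<in> generate G T"
  shows "x \<otimes> y = y \<otimes> x"
proof -
  have "generate G S \<subseteq> {x \<in> carrier G. \<forall>y\<in>T. x \<otimes> y = y \<otimes> x}"
    by (rule generate_subgroup_incl) (use S comm centralizer_subgroup[OF T] in auto)
  then have "T \<subseteq> {z \<in> carrier G. \<forall>u\<in>{x}. z \<otimes> u = u \<otimes> z}" "x \<in> carrier G" using T x by auto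
  then have "generate G T \<subseteq> {z \<in> carrier G. \<forall>u\<in>{x}. z \<otimes> u = u \<otimes> z}"
    by (intro generate_subgroup_incl centralizer_subgroup) auto
  then show ?thesis using y by auto
qed

lemma minimal_normal_Int:
  assumes "minimal_normal N G" "minimal_normal M G" "N \<noteq> M"
  shows "N \<inter> M \<subseteq> {\<one>}"
proof -
  have "N \<inter> M \<lhd> G" using assms by (simp add: minimal_normal_def normal_subgroup_intersect)
  then have "N \<inter> M = {\<one>}" using assms unfolding minimal_normal_def by (metis Int_lower1 Int_lower2)
  then show ?thesis by simp
qed

lemma minimal_normal_sub:
  assumes "minimal_normal M G" "D \<lhd> G" "\<not> D \<inter> M \<subseteq> {\<one>}"
  shows "M \<subseteq> D"
proof -
  have "D \<inter> M \<lhd> G" using assms by (simp add: minimal_normal_def normal_subgroup_intersect)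
  then have "D \<inter> M = M" using assms unfolding minimal_normal_def by (metis Int_lower2 subset_refl)
  then show ?thesis by blast
qed

lemma minimal_normal_carrier: "minimal_normal N G \<Longrightarrow> x \<in> N \<Longrightarrow> x \<in> carrier G"
  by (meson minimal_normal_def normal_imp_subgroup subgroup.mem_carrier)

lemma minimal_normal_nontrivial:
  assumes "minimal_normal N G"
  obtains x where "x \<in> N" "x \<in> carrier G" "x \<noteq> \<one>"
proof -
  have "\<one> \<in> N" "N \<noteq> {\<one>}"
    using assms by (auto simp: minimal_normal_def normal_imp_subgroup subgroup.one_closed)
  then show thesis using that minimal_normal_carrier[OF assms] by blast
qed

lemma least_power_in_subgroup:
  assumes x: "x \<in> carrier G" "ord x > 0" and H: "subgroup H G"
  obtains k :: nat where "k > 0" "x [^] k \<in> H" "\<forall>m. 0 < m \<longrightarrow> m < k \<longrightarrow> x [^] m \<notin> H"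
proof -
  define k where "k = (LEAST k. k > 0 \<and> x [^] (k::nat) \<in> H)"
  have "\<exists>k>0. x [^] (k::nat) \<in> H" using x H by (intro exI[of _ "ord x"]) (simp add: subgroup.one_closed)
  then have "k > 0" "x [^] k \<in> H" unfolding k_def by (rule LeastI2_ex, simp)+
  moreover have "x [^] m \<notin> H" if "0 < m" "m < k" for m :: nat
    using not_less_Least[of m] that unfolding k_def by blast
  ultimately show thesis using that[of k] by blast
qed

lemma mem_core_iff:
  assumes C: "subgroup C G"
  shows "x \<in> core G C \<longleftrightarrow> x \<in> carrier G \<and> (\<forall>g\<in>carrier G. g \<otimes> x \<otimes> inv g \<in> C)"
proof -
  have CG: "\<And>c. c \<in> C \<Longrightarrow> c \<in> carrier G" using C subgroup.mem_carrier by metis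
  have *: "x \<in> (g <# C) #> inv g \<longleftrightarrow> x \<in> carrier G \<and> inv g \<otimes> x \<otimes> g \<in> C" if g: "g \<in> carrier G" for g
  proof
    assume "x \<in> (g <# C) #> inv g"
    then obtain c where "c \<in> C" "x = g \<otimes> c \<otimes> inv g" unfolding l_coset_def r_coset_def by auto
    then show "x \<in> carrier G \<and> inv g \<otimes> x \<otimes> g \<in> C" using g CG by (simp add: m_assoc cancel_simps)
  next
    assume x: "x \<in> carrier G \<and> inv g \<otimes> x \<otimes> g \<in> C"
    then have "g \<otimes> (inv g \<otimes> x \<otimes> g) \<otimes> inv g \<in> (g <# C) #> inv g" unfolding l_coset_def r_coset_def by blast
    then show "x \<in> (g <# C) #> inv g" using x g by (simp add: m_assoc cancel_simps)
  qed
  show ?thesis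
  proof
    assume x: "x \<in> core G C"
    then have mem: "x \<in> (g <# C) #> inv g" if "g \<in> carrier G" for g using that unfolding core_def by blast
    have "x \<in> carrier G" using mem[OF one_closed] *[OF one_closed] by blast
    moreover have "g \<otimes> x \<otimes> inv g \<in> C" if "g \<in> carrier G" for g
      using mem[of "inv g"] *[of "inv g"] that by simp
    ultimately show "x \<in> carrier G \<and> (\<forall>g\<in>carrier G. g \<otimes> x \<otimes> inv g \<in> C)" by blast
  next
    assume x: "x \<in> carrier G \<and> (\<forall>g\<in>carrier G. g \<otimes> x \<otimes> inv g \<in> C)"
    have "inv g \<otimes> x \<otimes> g \<in> C" if "g \<in> carrier G" for g
      using x that by (metis inv_closed inv_inv)
    then show "x \<in> core G C" using x * unfolding core_def by blast
  qed
qed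

lemma locally_finite_torsion:
  assumes "locally_finite G" "x \<in> carrier G"
  shows "ord x > 0"
  using assms finite_cyclic_subgroup_order[OF assms(2)] by (auto simp: locally_finite_def)

lemma ord_subgroup:
  assumes "subgroup N G" "x \<in> N"
  shows "group.ord (G\<lparr>carrier := N\<rparr>) x = ord x"
proof -
  interpret H: group "G\<lparr>carrier := N\<rparr>" by (rule subgroup_imp_group[OF assms(1)])
  have x: "x \<in> carrier G" using assms subgroup.mem_carrier by force
  have "\<And>n. ord x dvd n \<longleftrightarrow> H.ord x dvd n"
    using pow_eq_id[OF x] H.pow_eq_id[of x] assms by (simp add: nat_pow_consistent[symmetric])
  then show ?thesis by (metis dvd_antisym dvd_refl)
qed

lemma torsion_subgroup:
  assumes "locally_finite G" "subgroup N G"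
  shows "torsion_group (G\<lparr>carrier := N\<rparr>)"
proof -
  have "\<exists>n::nat. n > 0 \<and> x [^]\<^bsub>G\<lparr>carrier := N\<rparr>\<^esub> n = \<one>" if "x \<in> N" for x
  proof -
    have "x \<in> carrier G" using that assms subgroup.mem_carrier by force
    then show ?thesis using locally_finite_torsion[OF assms(1), of x]
      by (intro exI[of _ "ord x"]) (simp add: nat_pow_consistent[symmetric])
  qed
  then show ?thesis using subgroup_imp_group[OF assms(2)] by (simp add: torsion_group_def)
qed

definition abelian_minimal :: "'a set \<Rightarrow> bool" where
  "abelian_minimal N \<longleftrightarrow> minimal_normal N G \<and>
     comm_group (G\<lparr>carrier := N\<rparr>) \<and> torsion_group (G\<lparr>carrier := N\<rparr>)"

definition nonabelian_minimal :: "'a set \<Rightarrow> bool" where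
  "nonabelian_minimal N \<longleftrightarrow> minimal_normal N G \<and> \<not> comm_group (G\<lparr>carrier := N\<rparr>)"

lemma nonabelian_minimal_carrier: "nonabelian_minimal M \<Longrightarrow> x \<in> M \<Longrightarrow> x \<in> carrier G"
  by (auto simp: nonabelian_minimal_def intro: minimal_normal_carrier)

lemma abelian_soc_eq: "abelian_soc G = generate G (\<Union>{N. abelian_minimal N})"
  by (simp add: abelian_soc_def abelian_minimal_def)

lemma abelian_minimal_commute:
  assumes "abelian_minimal N" "x \<in> N" "y \<in> N"
  shows "x \<otimes> y = y \<otimes> x"
  using comm_groupE(4)[of "G\<lparr>carrier := N\<rparr>" x y] assms by (simp add: abelian_minimal_def)

lemma normal_Union_generate:
  assumes "\<And>N. N \<in> \<F> \<Longrightarrow> N \<lhd> G"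
  shows "generate G (\<Union>\<F>) \<lhd> G"
proof (rule normal_generateI)
  show "\<Union>\<F> \<subseteq> carrier G"
    using subgroup.subset[OF normal_imp_subgroup[OF assms]] by auto
  fix h g assume "h \<in> \<Union>\<F>" "g \<in> carrier G"
  then obtain N where "N \<in> \<F>" "g \<otimes> h \<otimes> inv g \<in> N" using normal.inv_op_closed2[OF assms] by auto
  then show "g \<otimes> h \<otimes> inv g \<in> \<Union>\<F>" by auto
qed

lemma abelian_soc_normal: "abelian_soc G \<lhd> G"
  unfolding abelian_soc_eq
  by (rule normal_Union_generate) (auto simp: abelian_minimal_def minimal_normal_def)

lemma abelian_soc_subgroup: "subgroup (abelian_soc G) G"
  using abelian_soc_normal normal_imp_subgroup by blast

lemma abelian_soc_carrier: "x \<in> abelian_soc G \<Longrightarrow> x \<in> carrier G"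
  using abelian_soc_subgroup subgroup.mem_carrier by force

lemma abelian_soc_commute:
  assumes "x \<in> abelian_soc G" "y \<in> abelian_soc G"
  shows "x \<otimes> y = y \<otimes> x"
proof (rule generate_commute)
  show "x \<in> generate G (\<Union>{N. abelian_minimal N})" "y \<in> generate G (\<Union>{N. abelian_minimal N})"
    using assms by (simp_all add: abelian_soc_eq)
  fix x y assume "x \<in> \<Union>{N. abelian_minimal N}" "y \<in> \<Union>{N. abelian_minimal N}"
  then obtain N M where NM: "abelian_minimal N" "x \<in> N" "abelian_minimal M" "y \<in> M" by auto
  show "x \<otimes> y = y \<otimes> x"
  proof (cases "N = M")
    case True then show ?thesis using NM abelian_minimal_commute by auto
  next
    case False
    show ?thesis
      by (rule normals_disjoint_commute[OF _ _ minimal_normal_Int[OF _ _ False] NM(2,4)])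
        (use NM in \<open>auto simp: abelian_minimal_def minimal_normal_def\<close>)
  qed
qed (auto simp: abelian_minimal_def intro: minimal_normal_carrier)

lemma abelian_soc_comm_group: "comm_group (G\<lparr>carrier := abelian_soc G\<rparr>)"
  by (rule group.group_comm_groupI)
    (use subgroup_imp_group[OF abelian_soc_subgroup] abelian_soc_commute in auto)

text \<open>
  Torsion provides an element of some prime order \<open>q\<close> in \<open>N\<close>. The elements of \<open>N\<close> killed by \<open>q\<close> form a
  normal subgroup of \<open>G\<close>, so by minimality they exhaust \<open>N\<close>.
\<close>

lemma abelian_minimal_exponent:
  assumes N: "abelian_minimal N"
  obtains q where "prime (q::nat)" "\<And>x. x \<in> N \<Longrightarrow> x [^] q = \<one>"
proof -
  have mN: "minimal_normal N G" and nN: "N \<lhd> G" and sN: "subgroup N G"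
    using N by (auto simp: abelian_minimal_def minimal_normal_def normal_imp_subgroup)
  obtain x where x: "x \<in> N" "x \<in> carrier G" "x \<noteq> \<one>" using minimal_normal_nontrivial[OF mN] .
  obtain n :: nat where "n > 0" "x [^] n = \<one>"
    using N x(1) by (auto simp: abelian_minimal_def torsion_group_def nat_pow_consistent[symmetric])
  then have "ord x dvd n" using pow_eq_id[OF x(2)] by simp
  then have ord: "ord x > 0" using \<open>n > 0\<close> by (auto intro: Nat.gr0I)
  have "ord x \<noteq> 1" using x(3) ord_eq_1[OF x(2)] by blast
  then obtain q where q: "prime q" "q dvd ord x" by (meson prime_factor_nat)
  define y where "y = x [^] (ord x div q)"
  have y: "y \<in> N" "y \<in> carrier G"
    using x sN unfolding y_def by (auto simp: pow_in_subgroup)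
  have y1: "y \<noteq> \<one>"
  proof
    assume "y = \<one>"
    then have "ord x dvd ord x div q" using x by (simp add: y_def pow_eq_id)
    moreover obtain k where k: "ord x = q * k" using q by auto
    ultimately have "q * k dvd k" "k > 0" using prime_gt_0_nat[OF q(1)] ord by (auto intro: Nat.gr0I)
    then show False using prime_gt_1_nat[OF q(1)] dvd_imp_le[of "q * k" k] by simp
  qed
  have yq: "y [^] q = \<one>" using x q by (simp add: y_def nat_pow_pow)
  define M where "M = {z \<in> N. z [^] q = \<one>}"
  have Nc: "\<And>z. z \<in> N \<Longrightarrow> z \<in> carrier G" using sN subgroup.mem_carrier by force
  have "subgroup M G"
    using power_preimage_subgroup[OF sN abelian_minimal_commute[OF N] triv_subgroup, of q] by (simp add: M_def)
  then have "M \<lhd> G"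
    by (rule normal_invI) (use Nc normal.inv_op_closed2[OF nN] in \<open>auto simp: M_def conj_pow\<close>)
  moreover have "M \<noteq> {\<one>}" using y y1 yq by (auto simp: M_def)
  moreover have "M \<subseteq> N" by (auto simp: M_def)
  ultimately have "M = N" using mN by (simp add: minimal_normal_def)
  then show thesis using that[OF q(1)] by (auto simp: M_def)
qed

lemma abelian_minimal_normal_prime:
  assumes N: "abelian_minimal N" and q: "prime (q::nat)" "\<And>x. x \<in> N \<Longrightarrow> x [^] q = \<one>"
  shows "q \<in> normal_primes G"
proof -
  have nN: "N \<lhd> G" "N \<noteq> {\<one>}" using N by (auto simp: abelian_minimal_def minimal_normal_def)
  have sN: "subgroup N G" using nN normal_imp_subgroup by blast
  have "\<exists>n. group.ord (G\<lparr>carrier := N\<rparr>) x = q ^ n" if "x \<in> N" for x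
  proof -
    have "x \<in> carrier G" using that sN by (rule subgroup.mem_carrier[rotated])
    then have "ord x dvd q" using pow_eq_id[of x q] q(2)[OF that] by simp
    then have "ord x = q ^ 0 \<or> ord x = q ^ 1" using q(1) by (metis power_0 power_one_right prime_nat_iff)
    then show ?thesis using ord_subgroup[OF sN that] by metis
  qed
  then have "p_group q (G\<lparr>carrier := N\<rparr>)"
    using subgroup_imp_group[OF sN] by (simp add: p_group_def)
  then show ?thesis using nN q(1) by (auto simp: normal_primes_def)
qed

text \<open>
  The point of this exponent is that it is invertible in every field whose characteristic is not in
  \<open>normal_primes G\<close>.
\<close>

lemma abelian_soc_exponent:
  assumes "x \<in> abelian_soc G"
  shows "\<exists>n>0. x [^] (n::nat) = \<one> \<and> (\<forall>p. prime p \<and> p dvd n \<longrightarrow> p \<in> normal_primes G)"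
proof -
  have *: "\<exists>n>0. x [^] (n::nat) = \<one> \<and> (\<forall>p. prime p \<and> p dvd n \<longrightarrow> p \<in> normal_primes G)"
    if N: "abelian_minimal N" "x \<in> N" for N x
  proof -
    obtain q :: nat where q: "prime q" "\<And>x. x \<in> N \<Longrightarrow> x [^] q = \<one>"
      using abelian_minimal_exponent[OF N(1)] by blast
    show ?thesis
      using q N abelian_minimal_normal_prime[OF N(1) q] prime_gt_0_nat[OF q(1)]
      by (intro exI[of _ q]) (auto dest: primes_dvd_imp_eq)
  qed
  show ?thesis using assms unfolding abelian_soc_eq
  proof (induction x rule: generate.induct)
    case one
    show ?case by (intro exI[of _ 1]) auto
  next
    case (incl h) then show ?case using * by auto
  next
    case (inv h)
    then obtain N where N: "abelian_minimal N" "h \<in> N" by auto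
    then have "h \<in> carrier G" by (auto simp: abelian_minimal_def intro: minimal_normal_carrier)
    then show ?case using *[OF N] by (metis nat_pow_inv inv_one)
  next
    case (eng a b)
    obtain m n where mn: "m > 0" "n > 0" "a [^] m = \<one>" "b [^] n = \<one>"
      "\<forall>p. prime p \<and> p dvd m \<longrightarrow> p \<in> normal_primes G"
      "\<forall>p. prime p \<and> p dvd n \<longrightarrow> p \<in> normal_primes G"
      using eng.IH by blast
    have ab: "a \<in> carrier G" "b \<in> carrier G" "a \<otimes> b = b \<otimes> a"
      using eng.hyps abelian_soc_carrier abelian_soc_commute by (auto simp: abelian_soc_eq)
    have "(a \<otimes> b) [^] (m * n) = (a [^] m) [^] n \<otimes> (b [^] n) [^] m"
      using pow_mult_distrib[OF ab(3,1,2)] ab(1,2) by (simp add: nat_pow_pow mult.commute)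
    also have "\<dots> = \<one>" using mn by simp
    finally show ?case
      using mn by (intro exI[of _ "m * n"]) (auto simp: prime_dvd_mult_iff)
  qed
qed

text \<open>
  The centre of \<open>M\<close> is normal in \<open>G\<close> and different from \<open>M\<close>.
\<close>

lemma nonabelian_minimal_center:
  assumes M: "nonabelian_minimal M" and m: "m \<in> M" and c: "\<And>y. y \<in> M \<Longrightarrow> m \<otimes> y = y \<otimes> m"
  shows "m = \<one>"
proof -
  have mM: "minimal_normal M G" and nM: "M \<lhd> G" and sM: "subgroup M G"
    using M by (auto simp: nonabelian_minimal_def minimal_normal_def normal_imp_subgroup)
  have Mc: "M \<subseteq> carrier G" using sM subgroup.subset by blast
  define Z where "Z = M \<inter> {x \<in> carrier G. \<forall>y\<in>M. x \<otimes> y = y \<otimes> x}"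
  have sZ: "subgroup Z G" unfolding Z_def by (rule subgroups_Inter_pair[OF sM centralizer_subgroup[OF Mc]])
  have "Z \<lhd> G"
  proof (rule normal_invI[OF sZ])
    fix g h assume g: "g \<in> carrier G" and h: "h \<in> Z"
    have hc: "h \<in> carrier G" using h by (simp add: Z_def)
    have "g \<otimes> h \<otimes> inv g \<otimes> y = y \<otimes> (g \<otimes> h \<otimes> inv g)" if y: "y \<in> M" for y
    proof -
      have yc: "y \<in> carrier G" using y Mc by auto
      have "inv g \<otimes> y \<otimes> g \<in> M" using normal.inv_op_closed1[OF nM g y] .
      then have "h \<otimes> (inv g \<otimes> y \<otimes> g) = inv g \<otimes> y \<otimes> g \<otimes> h" using h by (auto simp: Z_def)
      then have "g \<otimes> (h \<otimes> (inv g \<otimes> y \<otimes> g)) \<otimes> inv g = g \<otimes> (inv g \<otimes> y \<otimes> g \<otimes> h) \<otimes> inv g" by simp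
      moreover have "g \<otimes> (h \<otimes> (inv g \<otimes> y \<otimes> g)) \<otimes> inv g = g \<otimes> h \<otimes> inv g \<otimes> y"
        using g hc yc by (simp add: m_assoc cancel_simps)
      moreover have "g \<otimes> (inv g \<otimes> y \<otimes> g \<otimes> h) \<otimes> inv g = (g \<otimes> inv g) \<otimes> y \<otimes> (g \<otimes> h \<otimes> inv g)"
        using g hc yc by (simp add: m_assoc cancel_simps)
      ultimately show ?thesis using g hc yc by simp
    qed
    then show "g \<otimes> h \<otimes> inv g \<in> Z"
      using normal.inv_op_closed2[OF nM g] h g hc by (auto simp: Z_def)
  qed
  moreover have "Z \<noteq> M"
  proof
    assume "Z = M"
    then have "comm_group (G\<lparr>carrier := M\<rparr>)"
      by (intro group.group_comm_groupI) (use subgroup_imp_group[OF sM] in \<open>auto simp: Z_def\<close>)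
    then show False using M by (simp add: nonabelian_minimal_def)
  qed
  ultimately have "Z = {\<one>}" using mM unfolding minimal_normal_def Z_def by blast
  then show ?thesis using m c Mc by (auto simp: Z_def)
qed

lemma abelian_soc_commute_nonabelian:
  assumes "a \<in> abelian_soc G" "nonabelian_minimal M" "m \<in> M"
  shows "a \<otimes> m = m \<otimes> a"
proof (rule generate_commute)
  show "a \<in> generate G (\<Union>{N. abelian_minimal N})" using assms by (simp add: abelian_soc_eq)
  show "m \<in> generate G M" using assms by (simp add: generate.incl)
  fix x y assume "x \<in> \<Union>{N. abelian_minimal N}" and y: "y \<in> M"
  then obtain N where N: "abelian_minimal N" "x \<in> N" by auto
  have NM: "minimal_normal N G" "minimal_normal M G" "N \<noteq> M"
    using N assms by (auto simp: abelian_minimal_def nonabelian_minimal_def)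
  show "x \<otimes> y = y \<otimes> x"
    by (rule normals_disjoint_commute[OF _ _ minimal_normal_Int[OF NM] N(2) y])
      (use NM in \<open>auto simp: minimal_normal_def\<close>)
qed (use assms in \<open>auto simp: abelian_minimal_def nonabelian_minimal_def intro: minimal_normal_carrier\<close>)

lemma commute_nonabelian_family:
  assumes F: "\<And>N. N \<in> \<F> \<Longrightarrow> nonabelian_minimal N" and M: "nonabelian_minimal M" "M \<notin> \<F>"
    and x: "x \<in> generate G (abelian_soc G \<union> \<Union>\<F>)" and y: "y \<in> M"
  shows "x \<otimes> y = y \<otimes> x"
proof (rule generate_commute[OF _ _ _ x generate.incl[OF y]])
  fix x y assume x: "x \<in> abelian_soc G \<union> \<Union>\<F>" and y: "y \<in> M"
  show "x \<otimes> y = y \<otimes> x"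
  proof (cases "x \<in> abelian_soc G")
    case True then show ?thesis using abelian_soc_commute_nonabelian[OF _ M(1) y] by blast
  next
    case False
    then obtain N where N: "N \<in> \<F>" "x \<in> N" using x by auto
    have NM: "minimal_normal N G" "minimal_normal M G" "N \<noteq> M"
      using F N M by (auto simp: nonabelian_minimal_def)
    show ?thesis
      by (rule normals_disjoint_commute[OF _ _ minimal_normal_Int[OF NM] N(2) y])
        (use NM in \<open>auto simp: minimal_normal_def\<close>)
  qed
qed (use F M in \<open>auto intro: abelian_soc_carrier nonabelian_minimal_carrier\<close>)

text \<open>
  The generated subgroup centralises \<open>M\<close>, so \<open>x\<close> lies in the centre of \<open>M\<close>.
\<close>

lemma nonabelian_family_disjoint:
  assumes F: "\<And>N. N \<in> \<F> \<Longrightarrow> nonabelian_minimal N" and M: "nonabelian_minimal M" "M \<notin> \<F>"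
    and x: "x \<in> generate G (abelian_soc G \<union> \<Union>\<F>)" "x \<in> M"
  shows "x = \<one>"
  by (rule nonabelian_minimal_center[OF M(1) x(2)])
    (rule commute_nonabelian_family[OF F M x(1)])

lemma generate_nonabelian_family_subgroup:
  assumes F: "\<And>N. N \<in> \<F> \<Longrightarrow> nonabelian_minimal N"
  shows "subgroup (generate G (abelian_soc G \<union> \<Union>\<F>)) G"
  by (rule generate_is_subgroup)
    (use F in \<open>auto intro: abelian_soc_carrier nonabelian_minimal_carrier\<close>)

text \<open>
  One nonabelian factor \<open>M\<close> is removed at a time: in \<open>x = m \<otimes> t\<close> with \<open>m \<in> M\<close> and \<open>t\<close> in the product of the
  other factors, both \<open>x\<close> and \<open>t\<close> centralise \<open>M\<close>; hence so does \<open>m\<close>, and \<open>m\<close> is trivial.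
\<close>

lemma commuting_product_in_abelian_soc:
  assumes "finite \<F>" "\<And>N. N \<in> \<F> \<Longrightarrow> nonabelian_minimal N"
    and "x \<in> generate G (abelian_soc G \<union> \<Union>\<F>)"
    and "\<And>N m. N \<in> \<F> \<Longrightarrow> m \<in> N \<Longrightarrow> x \<otimes> m = m \<otimes> x"
  shows "x \<in> abelian_soc G"
  using assms
proof (induction \<F> rule: finite_induct)
  case empty
  then show ?case using generate_subgroup_incl[OF subset_refl abelian_soc_subgroup] by auto
next
  case (insert M \<F>)
  let ?T = "generate G (abelian_soc G \<union> \<Union>\<F>)"
  have F: "\<And>N. N \<in> \<F> \<Longrightarrow> nonabelian_minimal N" and M: "nonabelian_minimal M" using insert.prems by auto
  have nM: "M \<lhd> G" and sM: "subgroup M G"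
    using M by (auto simp: nonabelian_minimal_def minimal_normal_def normal_imp_subgroup)
  have sT: "subgroup ?T G" by (rule generate_nonabelian_family_subgroup[OF F])
  have s: "subgroup (M <#> ?T) G" by (rule mult_norm_subgroup[OF nM sT])
  have Mc: "\<And>u. u \<in> M \<Longrightarrow> u \<in> carrier G" and Tc: "\<And>u. u \<in> ?T \<Longrightarrow> u \<in> carrier G"
    using sM sT subgroup.mem_carrier by force+
  have prodI: "m \<otimes> t \<in> M <#> ?T" if "m \<in> M" "t \<in> ?T" for m t
    using that unfolding set_mult_def by blast
  have "u \<in> M <#> ?T" if "u \<in> ?T" for u
    using prodI[OF subgroup.one_closed[OF sM] that] Tc[OF that] by simp
  moreover have "u \<in> M <#> ?T" if "u \<in> M" for u
    using prodI[OF that subgroup.one_closed[OF sT]] Mc[OF that] by simp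
  ultimately have "generate G (abelian_soc G \<union> \<Union>(insert M \<F>)) \<subseteq> M <#> ?T"
    by (intro generate_subgroup_incl[OF _ s]) (auto intro: generate.incl)
  then obtain m t where mt: "m \<in> M" "t \<in> ?T" "x = m \<otimes> t"
    using insert.prems(2) unfolding set_mult_def by auto
  have "m \<otimes> y = y \<otimes> m" if y: "y \<in> M" for y
  proof -
    have ty: "t \<otimes> y = y \<otimes> t" by (rule commute_nonabelian_family[OF F M insert.hyps(2) mt(2) y])
    have "m \<otimes> y \<otimes> t = m \<otimes> t \<otimes> y" using ty Mc Tc y mt by (simp add: m_assoc)
    also have "\<dots> = y \<otimes> m \<otimes> t" using insert.prems(3)[OF insertI1 y] mt Mc Tc y by (simp add: m_assoc)
    finally show ?thesis using Mc Tc y mt by (simp)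
  qed
  then have "m = \<one>" by (rule nonabelian_minimal_center[OF M mt(1)])
  then have "x \<in> ?T" using mt Tc by simp
  then show ?case using insert.IH insert.prems by auto
qed

lemma soc_finite_support:
  assumes "locally_finite G" "x \<in> soc G"
  shows "\<exists>\<F>. finite \<F> \<and> (\<forall>N\<in>\<F>. nonabelian_minimal N) \<and> x \<in> generate G (abelian_soc G \<union> \<Union>\<F>)"
proof -
  obtain F where F: "finite F" "F \<subseteq> \<Union>{N. minimal_normal N G}" "x \<in> generate G F"
    using generate_finite_subset[of x "\<Union>{N. minimal_normal N G}"] assms(2) unfolding soc_def by blast
  then have "\<forall>h\<in>F. \<exists>N. minimal_normal N G \<and> h \<in> N" by blast
  then obtain N where N: "\<And>h. h \<in> F \<Longrightarrow> minimal_normal (N h) G \<and> h \<in> N h" by metis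
  let ?F = "{M \<in> N ` F. nonabelian_minimal M}"
  have "h \<in> abelian_soc G \<union> \<Union>?F" if h: "h \<in> F" for h
  proof (cases "nonabelian_minimal (N h)")
    case True then show ?thesis using N h by blast
  next
    case False
    then have "abelian_minimal (N h)"
      using N[OF h] torsion_subgroup[OF assms(1)]
      by (auto simp: nonabelian_minimal_def abelian_minimal_def minimal_normal_def normal_imp_subgroup)
    then show ?thesis using N[OF h] by (auto simp: abelian_soc_eq intro!: generate.incl)
  qed
  then have "generate G F \<subseteq> generate G (abelian_soc G \<union> \<Union>?F)" by (intro mono_generate) blast
  then show ?thesis using F by (intro exI[of _ ?F]) auto
qed

text \<open>
  Applied below to the kernel of a representation. A normal subgroup that does not contain the nonabelian
  minimal normal subgroup \<open>M\<close> meets it trivially and therefore centralises it; so \<open>D\<close> centralises all of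
  them, and its elements in the socle have no component outside the abelian socle.
\<close>

lemma normal_meets_socle:
  assumes lf: "locally_finite G" and D: "D \<lhd> G" "D \<inter> soc G \<noteq> {\<one>}"
    and disj: "\<And>M. nonabelian_minimal M \<Longrightarrow> \<not> M \<subseteq> D"
  obtains x where "x \<in> D" "x \<in> abelian_soc G" "x \<noteq> \<one>"
proof -
  have "soc G \<lhd> G" unfolding soc_def by (rule normal_Union_generate) (auto simp: minimal_normal_def)
  then have "\<one> \<in> D \<inter> soc G" using D by (simp add: normal_imp_subgroup subgroup.one_closed)
  then obtain x where x: "x \<in> D" "x \<in> soc G" "x \<noteq> \<one>" using D by blast
  obtain \<F> where F: "finite \<F>" "\<And>N. N \<in> \<F> \<Longrightarrow> nonabelian_minimal N"
    "x \<in> generate G (abelian_soc G \<union> \<Union>\<F>)" using soc_finite_support[OF lf x(2)] by auto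
  have "x \<otimes> m = m \<otimes> x" if N: "N \<in> \<F>" and m: "m \<in> N" for N m
  proof -
    have mN: "nonabelian_minimal N" "minimal_normal N G" using F N by (auto simp: nonabelian_minimal_def)
    have "D \<inter> N \<subseteq> {\<one>}" using minimal_normal_sub[OF mN(2) D(1)] disj[OF mN(1)] by blast
    then show ?thesis
      using normals_disjoint_commute[OF D(1) _ _ x(1) m] mN by (simp add: minimal_normal_def)
  qed
  then have "x \<in> abelian_soc G" using commuting_product_in_abelian_soc[OF F] by blast
  then show thesis using that x by blast
qed

end

section \<open>Constructing actions and representations\<close>

text \<open>
  Elements of \<open>BijGroup E\<close> are extensional functions on \<open>E\<close>, whence the restriction.
\<close>

lemma group_actionI:
  assumes G: "group G"
    and closed: "\<And>g x. g \<in> carrier G \<Longrightarrow> x \<in> E \<Longrightarrow> \<rho> g x \<in> E"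
    and one: "\<And>x. x \<in> E \<Longrightarrow> \<rho> \<one>\<^bsub>G\<^esub> x = x"
    and mult: "\<And>g h x. g \<in> carrier G \<Longrightarrow> h \<in> carrier G \<Longrightarrow> x \<in> E \<Longrightarrow> \<rho> (g \<otimes>\<^bsub>G\<^esub> h) x = \<rho> g (\<rho> h x)"
  shows "group_action G E (\<lambda>g. restrict (\<rho> g) E)"
proof -
  interpret group G by (rule G)
  have bij: "restrict (\<rho> g) E \<in> Bij E" if g: "g \<in> carrier G" for g
  proof -
    have "bij_betw (restrict (\<rho> g) E) E E"
      by (rule bij_betw_byWitness[where f' = "\<rho> (inv\<^bsub>G\<^esub> g)"])
        (use g closed in \<open>auto simp: mult[symmetric] one\<close>)
    then show ?thesis by (simp add: Bij_def)
  qed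
  have "group_hom G (BijGroup E) (\<lambda>g. restrict (\<rho> g) E)"
  proof (unfold group_hom_def group_hom_axioms_def, intro conjI homI)
    fix g h assume gh: "g \<in> carrier G" "h \<in> carrier G"
    show "restrict (\<rho> (g \<otimes>\<^bsub>G\<^esub> h)) E = restrict (\<rho> g) E \<otimes>\<^bsub>BijGroup E\<^esub> restrict (\<rho> h) E"
      using gh bij closed mult by (auto simp: BijGroup_def compose_def fun_eq_iff)
  qed (use bij G group_BijGroup in \<open>auto simp: BijGroup_def\<close>)
  then show ?thesis by (rule group_action.intro)
qed

lemma representationI:
  fixes V :: "('k, 'v) module"
  assumes G: "group G" and V: "module K V"
    and closed: "\<And>g x. g \<in> carrier G \<Longrightarrow> x \<in> carrier V \<Longrightarrow> \<rho> g x \<in> carrier V"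
    and one: "\<And>x. x \<in> carrier V \<Longrightarrow> \<rho> \<one>\<^bsub>G\<^esub> x = x"
    and mult: "\<And>g h x. g \<in> carrier G \<Longrightarrow> h \<in> carrier G \<Longrightarrow> x \<in> carrier V \<Longrightarrow> \<rho> (g \<otimes>\<^bsub>G\<^esub> h) x = \<rho> g (\<rho> h x)"
    and add: "\<And>g x y. g \<in> carrier G \<Longrightarrow> x \<in> carrier V \<Longrightarrow> y \<in> carrier V \<Longrightarrow> \<rho> g (x \<oplus>\<^bsub>V\<^esub> y) = \<rho> g x \<oplus>\<^bsub>V\<^esub> \<rho> g y"
    and smult: "\<And>g a x. g \<in> carrier G \<Longrightarrow> a \<in> carrier K \<Longrightarrow> x \<in> carrier V \<Longrightarrow> \<rho> g (a \<odot>\<^bsub>V\<^esub> x) = a \<odot>\<^bsub>V\<^esub> \<rho> g x"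
  shows "representation G K V (\<lambda>g. restrict (\<rho> g) (carrier V))"
proof -
  interpret module K V by (rule V)
  show ?thesis
    by (intro representation.intro group_actionI representation_axioms.intro)
      (use assms in auto)
qed

section \<open>Finite p-groups\<close>

text \<open>
  Orbits have \<open>p\<close>-power size, so the orbits with more than one point contribute a multiple of \<open>p\<close> to
  \<open>card E\<close>, and the number of fixed points cannot be one.
\<close>

lemma (in group_action) p_group_other_fixed_point:
  assumes p: "prime p" and ord: "order G = p ^ k"
    and E: "finite E" "p dvd card E" and e: "e \<in> E" "\<And>g. g \<in> carrier G \<Longrightarrow> \<phi> g e = e"
  obtains x where "x \<in> E" "x \<noteq> e" "\<forall>g\<in>carrier G. \<phi> g x = x"
proof (rule ccontr)
  assume no: "\<not> thesis"
  note found = that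
  interpret group G using group_hom group_hom.axioms(1) by blast
  let ?O = "orbits G E \<phi>"
  have part: "partition E ?O" by (rule orbit_partition)
  have disj: "A \<inter> B = {}" if "A \<in> ?O" "B \<in> ?O" "A \<noteq> B" for A B
    using part that unfolding partition_def by blast
  have un: "\<Union>?O = E" using part unfolding partition_def by blast
  have finO: "finite ?O" using E(1) un finite_UnionD by metis
  have oe: "orbit G \<phi> e = {e}"
    using e(2) one_closed unfolding orbit_def by (auto intro!: exI[of _ \<one>] simp: e(2)[OF one_closed])
  then have eO: "{e} \<in> ?O" using e(1) by (auto simp: orbits_def intro!: exI[of _ e])
  have "p dvd card A" if A: "A \<in> ?O - {{e}}" for A
  proof -
    obtain x where x: "x \<in> E" "A = orbit G \<phi> x" using A unfolding orbits_def by blast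
    have "card A dvd p ^ k" using orbit_stabilizer_theorem[OF x(1)] x(2) ord by (metis dvd_triv_left)
    then obtain i where i: "card A = p ^ i" using divides_primepow_nat[OF p] by blast
    have "card A \<noteq> 1"
    proof
      assume "card A = 1"
      then obtain y where y: "orbit G \<phi> x = {y}" using x by (metis card_1_singletonE)
      have "\<phi> g x \<in> orbit G \<phi> x" if "g \<in> carrier G" for g using that unfolding orbit_def by blast
      moreover have "x \<in> orbit G \<phi> x" using orbit_refl[OF x(1)] .
      ultimately have fx: "\<phi> g x = x" if "g \<in> carrier G" for g using that y by auto
      have "x = e"
      proof (rule ccontr)
        assume "x \<noteq> e"
        from found[OF x(1) this] fx no show False by simp
      qed
      then show False using A x oe by simp
    qed
    then show ?thesis using i by (cases i) auto
  qed
  then have "p dvd (\<Sum>A\<in>?O - {{e}}. card A)" by (rule dvd_sum)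
  moreover have "card E = (\<Sum>A\<in>?O. card A)"
  proof -
    have "finite A" if "A \<in> ?O" for A using finite_subset[of A E] Union_upper[OF that] un E(1) by simp
    moreover have "pairwise disjnt ?O" using disj by (auto simp: pairwise_def disjnt_def)
    ultimately show ?thesis using card_Union_disjoint[of ?O] un by simp
  qed
  then have "card E = 1 + (\<Sum>A\<in>?O - {{e}}. card A)"
    using sum.remove[OF finO eO, of card] by simp
  ultimately have "p dvd 1" using E(2) dvd_add_left_iff[of p "\<Sum>A\<in>?O - {{e}}. card A" 1] by simp
  then show False using p not_prime_unit by blast
qed

text \<open>
  By Sylow's theorem, a prime \<open>q \<noteq> p\<close> dividing the order would be the order of an element.
\<close>

lemma p_group_order:
  assumes p: "prime p" and P: "p_group p P" and fin: "finite (carrier P)"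
  shows "\<exists>k. order P = p ^ k"
proof -
  interpret group P using P by (simp add: p_group_def)
  have only: "q = p" if q: "prime q" "q dvd order P" for q
  proof -
    obtain m where "order P = q ^ 1 * m" using q(2) by auto
    then obtain H where H: "subgroup H P" "card H = q ^ 1"
      using sylow_thm[OF q(1) is_group _ fin] by blast
    then have "card H > 1" using prime_gt_1_nat[OF q(1)] by simp
    then have "\<not> H \<subseteq> {\<one>\<^bsub>P\<^esub>}" using card_mono[of "{\<one>\<^bsub>P\<^esub>}" H] by auto
    then obtain x where x: "x \<in> H" "x \<noteq> \<one>\<^bsub>P\<^esub>" by blast
    interpret H: group "P\<lparr>carrier := H\<rparr>" by (rule subgroup_imp_group[OF H(1)])
    have xc: "x \<in> carrier P" using x H(1) subgroup.mem_carrier by metis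
    have "ord x dvd card H"
      using H.ord_dvd_group_order[of x] ord_subgroup[OF H(1) x(1)] x(1) by (simp add: order_def)
    then have "ord x dvd q" using H by simp
    moreover have "ord x \<noteq> 1" using ord_eq_1[OF xc] x(2) by blast
    ultimately have "ord x = q" using q(1) by (metis prime_nat_iff)
    moreover obtain n where "ord x = p ^ n" using P xc by (auto simp: p_group_def)
    ultimately show ?thesis using p q(1) by (metis prime_dvd_power primes_dvd_imp_eq dvd_refl)
  qed
  have "order P > 0" using fin order_gt_0_iff_finite by blast
  then have "order P \<noteq> 0" "\<not> is_unit p" using \<open>order P > 0\<close> p not_prime_unit by auto
  then obtain m where m: "order P = p ^ multiplicity p (order P) * m" "\<not> p dvd m"
    using multiplicity_decompose' by metis
  have "m = 1"
  proof (rule ccontr)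
    assume "m \<noteq> 1"
    then obtain q where "prime q" "q dvd m" using prime_factor_nat by blast
    then show False using only[of q] m dvd_mult[of q m] by metis
  qed
  then show ?thesis using m by auto
qed

section \<open>The characteristic of the ground field\<close>

abbreviation nonzero_in :: "('k, 'n) ring_scheme \<Rightarrow> nat \<Rightarrow> bool" where
  "nonzero_in K n \<equiv> add_pow K n \<one>\<^bsub>K\<^esub> \<noteq> \<zero>\<^bsub>K\<^esub>"

text \<open>
  The characteristic is the order of \<open>1\<close> in the additive group, where order \<open>0\<close> means infinite order.
\<close>

lemma ring_char_eq_0_iff:
  fixes n :: nat
  assumes "field K"
  shows "add_pow K n \<one>\<^bsub>K\<^esub> = \<zero>\<^bsub>K\<^esub> \<longleftrightarrow> ring_char K dvd n"
proof -
  interpret field K by (rule assms)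
  define m where "m = add.ord \<one>\<^bsub>K\<^esub>"
  have m: "add_pow K n \<one>\<^bsub>K\<^esub> = \<zero>\<^bsub>K\<^esub> \<longleftrightarrow> m dvd n" for n :: nat
    using add.pow_eq_id[of "\<one>\<^bsub>K\<^esub>" n] by (simp add: m_def add_pow_def)
  have "ring_char K = m"
  proof (cases "m = 0")
    case True then show ?thesis by (auto simp: ring_char_def m)
  next
    case False
    have "(LEAST n. n > 0 \<and> m dvd n) = m"
      by (rule Least_equality) (use False in \<open>auto dest: dvd_imp_le\<close>)
    then show ?thesis using False by (auto simp: ring_char_def m)
  qed
  then show ?thesis using m by simp
qed

lemma ring_char_prime:
  assumes "field K" "ring_char K \<noteq> 0"
  shows "prime (ring_char K)"
proof -
  interpret field K by (rule assms(1))
  let ?p = "ring_char K"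
  have "?p \<noteq> 1" using ring_char_eq_0_iff[OF assms(1), of 1] by auto
  moreover have "?p dvd a \<or> ?p dvd b" if "?p dvd a * b" for a b :: nat
  proof -
    have "(add_pow K a \<one>\<^bsub>K\<^esub>) \<otimes>\<^bsub>K\<^esub> (add_pow K b \<one>\<^bsub>K\<^esub>) = add_pow K (a * b) \<one>\<^bsub>K\<^esub>"
      by (simp add: add_pow_ldistr add.nat_pow_pow mult.commute)
    also have "\<dots> = \<zero>\<^bsub>K\<^esub>" using that ring_char_eq_0_iff[OF assms(1)] by blast
    finally show ?thesis using integral ring_char_eq_0_iff[OF assms(1)] by auto
  qed
  ultimately have "Factorial_Ring.prime_elem ?p"
    using assms(2) by (intro Factorial_Ring.prime_elemI) auto
  then show ?thesis by (intro Factorial_Ring.primeI) auto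
qed

lemma ring_char_not_normal_prime_nonzero:
  assumes "field K" "ring_char K \<notin> normal_primes G" "n > 0"
    and "\<And>p. prime p \<Longrightarrow> p dvd n \<Longrightarrow> p \<in> normal_primes G"
  shows "nonzero_in K n"
  using assms ring_char_eq_0_iff[OF assms(1), of n] ring_char_prime[OF assms(1)]
  by (metis dvd_0_left_iff less_not_refl)

section \<open>Subrepresentations and their sections\<close>

context representation begin

lemma subrepE:
  assumes W: "subrepresentation W G K V \<rho>"
  shows "W \<subseteq> carrier V" "\<zero>\<^bsub>V\<^esub> \<in> W"
    "\<And>x. x \<in> W \<Longrightarrow> x \<in> carrier V"
    "\<And>x y. x \<in> W \<Longrightarrow> y \<in> W \<Longrightarrow> x \<oplus>\<^bsub>V\<^esub> y \<in> W"
    "\<And>a x. a \<in> carrier K \<Longrightarrow> x \<in> W \<Longrightarrow> a \<odot>\<^bsub>V\<^esub> x \<in> W"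
    "\<And>g x. g \<in> carrier G \<Longrightarrow> x \<in> W \<Longrightarrow> \<rho> g x \<in> W"
    "\<And>x. x \<in> W \<Longrightarrow> \<ominus>\<^bsub>V\<^esub> x \<in> W"
    "\<And>x y. x \<in> W \<Longrightarrow> y \<in> W \<Longrightarrow> x \<ominus>\<^bsub>V\<^esub> y \<in> W"
proof -
  have sm: "submodule W K V" and st: "\<And>g w. g \<in> carrier G \<Longrightarrow> w \<in> W \<Longrightarrow> \<rho> g w \<in> W"
    using W by (auto simp: subrepresentation_def)
  note sE = submoduleE[OF sm]
  show "W \<subseteq> carrier V" by (rule sE(1))
  then show "\<And>x. x \<in> W \<Longrightarrow> x \<in> carrier V" by blast
  show z: "\<zero>\<^bsub>V\<^esub> \<in> W" using sm subgroup.one_closed submodule.axioms(1) by force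
  show add: "\<And>x y. x \<in> W \<Longrightarrow> y \<in> W \<Longrightarrow> x \<oplus>\<^bsub>V\<^esub> y \<in> W" using sE(5) by blast
  show "\<And>a x. a \<in> carrier K \<Longrightarrow> x \<in> W \<Longrightarrow> a \<odot>\<^bsub>V\<^esub> x \<in> W" using sE(4) by blast
  show neg: "\<And>x. x \<in> W \<Longrightarrow> \<ominus>\<^bsub>V\<^esub> x \<in> W" using sE(3) by blast
  show "\<And>g x. g \<in> carrier G \<Longrightarrow> x \<in> W \<Longrightarrow> \<rho> g x \<in> W" by (rule st)
  show "\<And>x y. x \<in> W \<Longrightarrow> y \<in> W \<Longrightarrow> x \<ominus>\<^bsub>V\<^esub> y \<in> W" using add neg by (simp add: a_minus_def)
qed

lemma subrepI:
  assumes "W \<subseteq> carrier V" "\<zero>\<^bsub>V\<^esub> \<in> W"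
    "\<And>x y. x \<in> W \<Longrightarrow> y \<in> W \<Longrightarrow> x \<oplus>\<^bsub>V\<^esub> y \<in> W"
    "\<And>a x. a \<in> carrier K \<Longrightarrow> x \<in> W \<Longrightarrow> a \<odot>\<^bsub>V\<^esub> x \<in> W"
    "\<And>g x. g \<in> carrier G \<Longrightarrow> x \<in> W \<Longrightarrow> \<rho> g x \<in> W"
  shows "subrepresentation W G K V \<rho>"
proof -
  have "submodule W K V"
  proof (rule submoduleI)
    fix x assume x: "x \<in> W"
    then have "(\<ominus>\<^bsub>K\<^esub> \<one>\<^bsub>K\<^esub>) \<odot>\<^bsub>V\<^esub> x \<in> W" by (intro assms(4)) auto
    then show "\<ominus>\<^bsub>V\<^esub> x \<in> W" using smult_l_minus[of "\<one>\<^bsub>K\<^esub>" x] x assms(1) by (auto simp: subset_iff)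
  qed (use assms in auto)
  then show ?thesis using assms(5) by (simp add: subrepresentation_def)
qed

lemma zero_subrep: "subrepresentation {\<zero>\<^bsub>V\<^esub>} G K V \<rho>"
  by (rule subrepI) (auto simp: act_zero)

lemma carrier_subrep: "subrepresentation (carrier V) G K V \<rho>"
  by (rule subrepI) auto

lemma act_minus:
  assumes "g \<in> carrier G" "x \<in> carrier V" "y \<in> carrier V"
  shows "\<rho> g (x \<ominus>\<^bsub>V\<^esub> y) = \<rho> g x \<ominus>\<^bsub>V\<^esub> \<rho> g y"
proof -
  have "\<ominus>\<^bsub>V\<^esub> y = (\<ominus>\<^bsub>K\<^esub> \<one>\<^bsub>K\<^esub>) \<odot>\<^bsub>V\<^esub> y" "\<ominus>\<^bsub>V\<^esub> \<rho> g y = (\<ominus>\<^bsub>K\<^esub> \<one>\<^bsub>K\<^esub>) \<odot>\<^bsub>V\<^esub> \<rho> g y"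
    using assms by (simp_all add: smult_l_minus)
  then show ?thesis using assms linear_smult[of g "\<ominus>\<^bsub>K\<^esub> \<one>\<^bsub>K\<^esub>" y] by (simp add: a_minus_def linear_add)
qed

lemma subrep_congruence:
  assumes J: "subrepresentation J G K V \<rho>" and x: "x \<in> carrier V" "y \<in> carrier V"
  shows "x \<ominus>\<^bsub>V\<^esub> y \<in> J \<Longrightarrow> y \<ominus>\<^bsub>V\<^esub> x \<in> J"
    and "z \<in> carrier V \<Longrightarrow> x \<ominus>\<^bsub>V\<^esub> y \<in> J \<Longrightarrow> y \<ominus>\<^bsub>V\<^esub> z \<in> J \<Longrightarrow> x \<ominus>\<^bsub>V\<^esub> z \<in> J"
    and "x' \<in> carrier V \<Longrightarrow> y' \<in> carrier V \<Longrightarrow> x \<ominus>\<^bsub>V\<^esub> x' \<in> J \<Longrightarrow> y \<ominus>\<^bsub>V\<^esub> y' \<in> J \<Longrightarrow>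
      (x \<oplus>\<^bsub>V\<^esub> y) \<ominus>\<^bsub>V\<^esub> (x' \<oplus>\<^bsub>V\<^esub> y') \<in> J"
    and "a \<in> carrier K \<Longrightarrow> x \<ominus>\<^bsub>V\<^esub> y \<in> J \<Longrightarrow> a \<odot>\<^bsub>V\<^esub> x \<ominus>\<^bsub>V\<^esub> a \<odot>\<^bsub>V\<^esub> y \<in> J"
    and "g \<in> carrier G \<Longrightarrow> x \<ominus>\<^bsub>V\<^esub> y \<in> J \<Longrightarrow> \<rho> g x \<ominus>\<^bsub>V\<^esub> \<rho> g y \<in> J"
    and "x \<ominus>\<^bsub>V\<^esub> y \<in> J \<Longrightarrow> x \<in> J \<longleftrightarrow> y \<in> J"
proof -
  note E = subrepE[OF J]
  show sym: "x \<ominus>\<^bsub>V\<^esub> y \<in> J \<Longrightarrow> y \<ominus>\<^bsub>V\<^esub> x \<in> J"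
    using E(7)[of "x \<ominus>\<^bsub>V\<^esub> y"] x by (simp add: a_minus_def M.minus_add M.a_comm)
  show "x \<ominus>\<^bsub>V\<^esub> z \<in> J" if "z \<in> carrier V" "x \<ominus>\<^bsub>V\<^esub> y \<in> J" "y \<ominus>\<^bsub>V\<^esub> z \<in> J"
  proof -
    have "x \<ominus>\<^bsub>V\<^esub> z = (x \<ominus>\<^bsub>V\<^esub> y) \<oplus>\<^bsub>V\<^esub> (y \<ominus>\<^bsub>V\<^esub> z)"
      using x that(1) by (simp add: a_minus_def M.a_assoc M.r_neg1)
    then show ?thesis using E(4)[OF that(2,3)] by simp
  qed
  show "(x \<oplus>\<^bsub>V\<^esub> y) \<ominus>\<^bsub>V\<^esub> (x' \<oplus>\<^bsub>V\<^esub> y') \<in> J"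
    if "x' \<in> carrier V" "y' \<in> carrier V" "x \<ominus>\<^bsub>V\<^esub> x' \<in> J" "y \<ominus>\<^bsub>V\<^esub> y' \<in> J"
  proof -
    have "(x \<oplus>\<^bsub>V\<^esub> y) \<ominus>\<^bsub>V\<^esub> (x' \<oplus>\<^bsub>V\<^esub> y') = (x \<ominus>\<^bsub>V\<^esub> x') \<oplus>\<^bsub>V\<^esub> (y \<ominus>\<^bsub>V\<^esub> y')"
      using x that(1,2) by (simp add: a_minus_def M.minus_add M.a_ac)
    then show ?thesis using E(4)[OF that(3,4)] by simp
  qed
  show "a \<odot>\<^bsub>V\<^esub> x \<ominus>\<^bsub>V\<^esub> a \<odot>\<^bsub>V\<^esub> y \<in> J" if "a \<in> carrier K" "x \<ominus>\<^bsub>V\<^esub> y \<in> J"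
    using E(5)[OF that] x that(1) by (simp add: a_minus_def smult_r_distr smult_r_minus)
  show "\<rho> g x \<ominus>\<^bsub>V\<^esub> \<rho> g y \<in> J" if "g \<in> carrier G" "x \<ominus>\<^bsub>V\<^esub> y \<in> J"
    using E(6)[OF that] x that(1) by (simp add: act_minus)
  show "x \<in> J \<longleftrightarrow> y \<in> J" if "x \<ominus>\<^bsub>V\<^esub> y \<in> J"
  proof
    assume "y \<in> J"
    then have "(x \<ominus>\<^bsub>V\<^esub> y) \<oplus>\<^bsub>V\<^esub> y \<in> J" using E(4)[OF that] by blast
    then show "x \<in> J" using x by (simp add: a_minus_def M.a_assoc M.l_neg)
  next
    assume "x \<in> J"
    then have "(y \<ominus>\<^bsub>V\<^esub> x) \<oplus>\<^bsub>V\<^esub> x \<in> J" using E(4)[OF sym[OF that]] by blast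
    then show "y \<in> J" using x by (simp add: a_minus_def M.a_assoc M.l_neg)
  qed
qed

lemma minus_zero_eq: "x \<in> carrier V \<Longrightarrow> x \<ominus>\<^bsub>V\<^esub> x = \<zero>\<^bsub>V\<^esub>"
  by (simp add: a_minus_def M.r_neg)

lemma minus_of_zero: "x \<in> carrier V \<Longrightarrow> x \<ominus>\<^bsub>V\<^esub> \<zero>\<^bsub>V\<^esub> = x"
  by (simp add: a_minus_def)

lemma kernel_normal: "{g \<in> carrier G. \<forall>u\<in>carrier V. \<rho> g u = u} \<lhd> G"
proof -
  interpret h: group_hom G "BijGroup (carrier V)" \<rho> by (rule group_hom)
  have one: "\<one>\<^bsub>BijGroup (carrier V)\<^esub> = (\<lambda>u\<in>carrier V. u)" by (simp add: BijGroup_def)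
  have "\<rho> g = (\<lambda>u\<in>carrier V. u) \<longleftrightarrow> (\<forall>u\<in>carrier V. \<rho> g u = u)" if g: "g \<in> carrier G" for g
  proof -
    have "\<rho> g \<in> extensional (carrier V)" using bij_prop0[OF g] by (simp add: Bij_def)
    then show ?thesis by (auto simp: extensional_def fun_eq_iff)
  qed
  then have "{g \<in> carrier G. \<forall>u\<in>carrier V. \<rho> g u = u} = kernel G (BijGroup (carrier V)) \<rho>"
    unfolding kernel_def one by blast
  then show ?thesis using h.normal_kernel by simp
qed

text \<open>
  Zorn's lemma. Maximality is only asked relative to a vector \<open>z\<close>, since a representation
  that is not finitely generated need not have maximal proper subrepresentations.
\<close>

lemma maximal_subrep_avoiding:
  assumes J0: "subrepresentation J0 G K V \<rho>" and z: "z \<notin> J0"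
  obtains J where "subrepresentation J G K V \<rho>" "J0 \<subseteq> J" "z \<notin> J"
    "\<forall>J'. subrepresentation J' G K V \<rho> \<longrightarrow> J \<subset> J' \<longrightarrow> z \<in> J'"
proof -
  let ?S = "{J. subrepresentation J G K V \<rho> \<and> J0 \<subseteq> J \<and> z \<notin> J}"
  have "\<exists>M\<in>?S. \<forall>Q\<in>?S. M \<subseteq> Q \<longrightarrow> Q = M"
  proof (rule subset_Zorn_nonempty)
    show "?S \<noteq> {}" using J0 z by auto
    fix \<C> assume ne: "\<C> \<noteq> {}" and ch: "subset.chain ?S \<C>"
    have C: "\<And>J. J \<in> \<C> \<Longrightarrow> subrepresentation J G K V \<rho> \<and> J0 \<subseteq> J \<and> z \<notin> J"
      and tot: "\<And>I J. I \<in> \<C> \<Longrightarrow> J \<in> \<C> \<Longrightarrow> I \<subseteq> J \<or> J \<subseteq> I"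
      using ch by (auto simp: subset_chain_def)
    have "subrepresentation (\<Union>\<C>) G K V \<rho>"
    proof (rule subrepI)
      show "\<Union>\<C> \<subseteq> carrier V" using C subrepE(1) by blast
      show "\<zero>\<^bsub>V\<^esub> \<in> \<Union>\<C>" using C subrepE(2) ne by blast
      show "x \<oplus>\<^bsub>V\<^esub> y \<in> \<Union>\<C>" if xy: "x \<in> \<Union>\<C>" "y \<in> \<Union>\<C>" for x y
      proof -
        obtain I J where IJ: "I \<in> \<C>" "x \<in> I" "J \<in> \<C>" "y \<in> J" using xy by auto
        then obtain L where L: "L \<in> \<C>" "x \<in> L" "y \<in> L" using tot[of I J] by blast
        then show ?thesis using C[of L] subrepE(4)[of L x y] by blast
      qed
      show "a \<odot>\<^bsub>V\<^esub> x \<in> \<Union>\<C>" if "a \<in> carrier K" "x \<in> \<Union>\<C>" for a x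
        using that C subrepE(5) by (meson Union_iff)
      show "\<rho> g x \<in> \<Union>\<C>" if "g \<in> carrier G" "x \<in> \<Union>\<C>" for g x
        using that C subrepE(6) by (meson Union_iff)
    qed
    then show "\<Union>\<C> \<in> ?S" using C ne by blast
  qed
  then obtain J where J: "J \<in> ?S" "\<And>Q. Q \<in> ?S \<Longrightarrow> J \<subseteq> Q \<Longrightarrow> Q = J"
    by (elim bexE) simp
  show thesis
  proof (rule that)
    show "subrepresentation J G K V \<rho>" "J0 \<subseteq> J" "z \<notin> J" using J(1) by auto
    show "\<forall>J'. subrepresentation J' G K V \<rho> \<longrightarrow> J \<subset> J' \<longrightarrow> z \<in> J'"
    proof (intro allI impI)
      fix J' assume "subrepresentation J' G K V \<rho>" "J \<subset> J'"
      then show "z \<in> J'" using J(1) J(2)[of J'] by auto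
    qed
  qed
qed

text \<open>
  \<open>V'\<close> is the quotient \<open>W / J\<close> and \<open>i\<close> the quotient map; the listed equations determine both up to
  isomorphism and are all that is used of them.
\<close>

lemma section_representation:
  assumes J: "subrepresentation J G K V \<rho>" and W: "subrepresentation W G K V \<rho>" and JW: "J \<subseteq> W"
  obtains V' :: "('k, 'v set) module" and \<rho>' and i where
    "representation G K V' \<rho>'" "carrier V' = i ` W" "\<zero>\<^bsub>V'\<^esub> = i \<zero>\<^bsub>V\<^esub>"
    "\<forall>x\<in>W. \<forall>y\<in>W. i x \<oplus>\<^bsub>V'\<^esub> i y = i (x \<oplus>\<^bsub>V\<^esub> y)"
    "\<forall>a\<in>carrier K. \<forall>x\<in>W. a \<odot>\<^bsub>V'\<^esub> i x = i (a \<odot>\<^bsub>V\<^esub> x)"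
    "\<forall>g\<in>carrier G. \<forall>x\<in>W. \<rho>' g (i x) = i (\<rho> g x)"
    "\<forall>x\<in>W. \<forall>y\<in>W. i x = i y \<longleftrightarrow> x \<ominus>\<^bsub>V\<^esub> y \<in> J"
proof -
  note WE = subrepE[OF W] and cong = subrep_congruence[OF J]
  define i where "i = (\<lambda>x. {y \<in> carrier V. x \<ominus>\<^bsub>V\<^esub> y \<in> J})"
  define j where "j = inv_into W i"
  have i_eq: "i x = i y \<longleftrightarrow> x \<ominus>\<^bsub>V\<^esub> y \<in> J" if "x \<in> W" "y \<in> W" for x y
  proof
    have c: "x \<in> carrier V" "y \<in> carrier V" using that WE(3) by auto
    have "y \<in> i y" using c subrepE(2)[OF J] by (simp add: i_def minus_zero_eq)
    moreover assume "i x = i y"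
    ultimately show "x \<ominus>\<^bsub>V\<^esub> y \<in> J" by (auto simp: i_def)
  next
    have c: "x \<in> carrier V" "y \<in> carrier V" using that WE(3) by auto
    assume "x \<ominus>\<^bsub>V\<^esub> y \<in> J"
    then show "i x = i y" using cong(1,2) c unfolding i_def by blast
  qed
  have ij: "j Q \<in> W" "i (j Q) = Q" if "Q \<in> i ` W" for Q
    using that by (simp_all add: j_def inv_into_into f_inv_into_f)
  have j_cong: "j (i x) \<in> W" "j (i x) \<ominus>\<^bsub>V\<^esub> x \<in> J" if "x \<in> W" for x
    using ij[of "i x"] i_eq[of "j (i x)" x] that by auto
  define V' :: "('k, 'v set) module" where "V' = \<lparr>carrier = i ` W, monoid.mult = undefined, one = undefined,
      ring.zero = i \<zero>\<^bsub>V\<^esub>, add = (\<lambda>Q Y. i (j Q \<oplus>\<^bsub>V\<^esub> j Y)), smult = (\<lambda>a Q. i (a \<odot>\<^bsub>V\<^esub> j Q))\<rparr>"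
  define \<sigma> where "\<sigma> = (\<lambda>g Q. i (\<rho> g (j Q)))"
  have V': "carrier V' = i ` W" "\<zero>\<^bsub>V'\<^esub> = i \<zero>\<^bsub>V\<^esub>" by (simp_all add: V'_def)
  have add: "i x \<oplus>\<^bsub>V'\<^esub> i y = i (x \<oplus>\<^bsub>V\<^esub> y)" if "x \<in> W" "y \<in> W" for x y
    using that j_cong[OF that(1)] j_cong[OF that(2)] cong(3)[of "j (i x)" "j (i y)" x y] WE(3,4)
    by (simp add: V'_def i_eq)
  have smult: "a \<odot>\<^bsub>V'\<^esub> i x = i (a \<odot>\<^bsub>V\<^esub> x)" if "a \<in> carrier K" "x \<in> W" for a x
    using that j_cong[OF that(2)] cong(4)[of "j (i x)" x a] WE(3,5) by (simp add: V'_def i_eq)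
  have act: "\<sigma> g (i x) = i (\<rho> g x)" if "g \<in> carrier G" "x \<in> W" for g x
    using that j_cong[OF that(2)] cong(5)[of "j (i x)" x g] WE(3,6) by (simp add: \<sigma>_def i_eq)
  have ab: "abelian_group V'"
  proof (rule abelian_groupI)
    fix Q assume "Q \<in> carrier V'"
    then obtain x where x: "x \<in> W" "Q = i x" by (auto simp: V')
    show "\<exists>Y\<in>carrier V'. Y \<oplus>\<^bsub>V'\<^esub> Q = \<zero>\<^bsub>V'\<^esub>"
      by (rule bexI[of _ "i (\<ominus>\<^bsub>V\<^esub> x)"]) (use x WE in \<open>auto simp: V' add M.l_neg\<close>)
  qed (use WE in \<open>auto simp: V' add M.a_ac\<close>)
  have mod: "module K V'"
    by (rule moduleI[OF R.is_cring ab])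
      (use WE in \<open>auto simp: V' add smult smult_l_distr smult_r_distr smult_assoc1\<close>)
  interpret Gg: group G by (rule grp)
  have rep: "representation G K V' (\<lambda>g. restrict (\<sigma> g) (carrier V'))"
    by (rule representationI[OF grp mod])
      (use WE in \<open>auto simp: V' add smult act act_one act_mult linear_add linear_smult\<close>)
  show thesis
    by (rule that[OF rep V']) (use add smult act i_eq V' in auto)
qed

text \<open>
  Let \<open>J\<close> be maximal among the subrepresentations that contain \<open>J0\<close> and avoid \<open>z\<close>, and let \<open>W\<close> be generated
  by \<open>J\<close> and \<open>z\<close>. Every subrepresentation strictly above \<open>J\<close> contains \<open>z\<close>, so \<open>W / J\<close> is irreducible.
  The last clause records that its kernel fixes the class of \<open>z\<close>; together with \<open>z \<notin> J\<close> this
  suffices to exclude elements from the kernel.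
\<close>

lemma irreducible_section:
  assumes J0: "subrepresentation J0 G K V \<rho>" and z: "z \<in> carrier V" "z \<notin> J0"
  obtains U :: "('k, 'v set) module" and \<sigma> and J where
    "irreducible_rep G K U \<sigma>" "subrepresentation J G K V \<rho>" "J0 \<subseteq> J" "z \<notin> J"
    "\<forall>g\<in>carrier G. (\<forall>u\<in>carrier U. \<sigma> g u = u) \<longrightarrow> \<rho> g z \<ominus>\<^bsub>V\<^esub> z \<in> J"
proof -
  obtain J where J: "subrepresentation J G K V \<rho>" "J0 \<subseteq> J" "z \<notin> J"
    "\<forall>J'. subrepresentation J' G K V \<rho> \<longrightarrow> J \<subset> J' \<longrightarrow> z \<in> J'"
    by (rule maximal_subrep_avoiding[OF J0 z(2)])
  define W where "W = \<Inter>{Q. subrepresentation Q G K V \<rho> \<and> insert z J \<subseteq> Q}"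
  have ne: "carrier V \<in> {Q. subrepresentation Q G K V \<rho> \<and> insert z J \<subseteq> Q}"
    using carrier_subrep subrepE(1)[OF J(1)] z by auto
  have Wsub: "subrepresentation W G K V \<rho>"
  proof (rule subrepI)
    show "W \<subseteq> carrier V" using ne unfolding W_def by blast
  qed (auto simp: W_def subrepE)
  have zW: "z \<in> W" and JW: "J \<subseteq> W" by (auto simp: W_def)
  have Wmin: "W \<subseteq> Q" if "subrepresentation Q G K V \<rho>" "z \<in> Q" "J \<subseteq> Q" for Q
    using that by (auto simp: W_def)
  obtain U :: "('k, 'v set) module" and \<sigma> and i where
    U: "representation G K U \<sigma>" "carrier U = i ` W" "\<zero>\<^bsub>U\<^esub> = i \<zero>\<^bsub>V\<^esub>"
    "\<forall>x\<in>W. \<forall>y\<in>W. i x \<oplus>\<^bsub>U\<^esub> i y = i (x \<oplus>\<^bsub>V\<^esub> y)"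
    "\<forall>a\<in>carrier K. \<forall>x\<in>W. a \<odot>\<^bsub>U\<^esub> i x = i (a \<odot>\<^bsub>V\<^esub> x)"
    "\<forall>g\<in>carrier G. \<forall>x\<in>W. \<sigma> g (i x) = i (\<rho> g x)"
    "\<forall>x\<in>W. \<forall>y\<in>W. i x = i y \<longleftrightarrow> x \<ominus>\<^bsub>V\<^esub> y \<in> J"
    by (rule section_representation[OF J(1) Wsub JW])
  note WE = subrepE[OF Wsub]
  have iJ: "i x = \<zero>\<^bsub>U\<^esub> \<longleftrightarrow> x \<in> J" if "x \<in> W" for x
    using U(7)[rule_format, OF that WE(2)] U(3) WE(3)[OF that] by (simp add: minus_of_zero)
  have irr: "irreducible_rep G K U \<sigma>"
    unfolding irreducible_rep_def
  proof (intro conjI allI impI)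
    show "representation G K U \<sigma>" by (rule U)
    show "carrier U \<noteq> {\<zero>\<^bsub>U\<^esub>}" using iJ[OF zW] J(3) zW U(2) by auto
    fix Y assume Y: "subrepresentation Y G K U \<sigma>"
    note YE = representation.subrepE[OF U(1) Y]
    define Q where "Q = {x \<in> W. i x \<in> Y}"
    have Q: "subrepresentation Q G K V \<rho>"
    proof (rule subrepI)
      show "x \<oplus>\<^bsub>V\<^esub> y \<in> Q" if "x \<in> Q" "y \<in> Q" for x y
        using that YE(4)[of "i x" "i y"] U(4) WE(4) by (auto simp: Q_def)
      show "a \<odot>\<^bsub>V\<^esub> x \<in> Q" if "a \<in> carrier K" "x \<in> Q" for a x
        using that YE(5)[of a "i x"] U(5) WE(5) by (auto simp: Q_def)
      show "\<rho> g x \<in> Q" if "g \<in> carrier G" "x \<in> Q" for g x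
        using that YE(6)[of g "i x"] U(6) WE(6) by (auto simp: Q_def)
    qed (use WE YE(2) U(3) in \<open>auto simp: Q_def\<close>)
    have "i x \<in> Y" if "x \<in> J" for x
      using iJ[OF subsetD[OF JW that]] that YE(2) by simp
    then have JX: "J \<subseteq> Q" using JW by (auto simp: Q_def)
    have YX: "Y = i ` Q" using YE(1) U(2) by (auto simp: Q_def)
    show "Y = {\<zero>\<^bsub>U\<^esub>} \<or> Y = carrier U"
    proof (cases "Q = J")
      case True
      then have "Y \<subseteq> {\<zero>\<^bsub>U\<^esub>}" using YX iJ JW by auto
      then show ?thesis using YE(2) by blast
    next
      case False
      then have "z \<in> Q" using J(4) Q JX False by blast
      then have "Q = W" using Wmin[OF Q _ JX] by (auto simp: Q_def)
      then show ?thesis using YX U(2) by simp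
    qed
  qed
  show thesis
  proof (rule that[OF irr J(1-3)], intro ballI impI)
    fix g assume g: "g \<in> carrier G" "\<forall>u\<in>carrier U. \<sigma> g u = u"
    then have "i (\<rho> g z) = i z" using U(2,6) zW by auto
    then show "\<rho> g z \<ominus>\<^bsub>V\<^esub> z \<in> J" using U(7) WE(6) g zW by blast
  qed
qed

lemma restrict_to_subgroup:
  assumes H: "subgroup H G"
  shows "representation (G\<lparr>carrier := H\<rparr>) K V \<rho>"
proof -
  interpret Gg: group G by (rule grp)
  have HG: "\<And>h. h \<in> H \<Longrightarrow> h \<in> carrier G" using H subgroup.mem_carrier by metis
  have bij: "\<rho> g \<in> Bij (carrier V)" if "g \<in> carrier G" for g using bij_prop0[OF that] .
  have "group_hom (G\<lparr>carrier := H\<rparr>) (BijGroup (carrier V)) \<rho>"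
    using group_hom Gg.subgroup_imp_group[OF H] HG
    by (auto simp: group_hom_def group_hom_axioms_def hom_def)
  then show ?thesis
    by (intro representation.intro group_action.intro representation_axioms.intro module_axioms)
      (use HG in \<open>auto simp: linear_add linear_smult\<close>)
qed

section \<open>Fixed vectors of finite p-groups\<close>

text \<open>
  The orbit of \<open>v\<close> spans a finite vector space \<open>E\<close> over the prime field \<open>F\<close>. It is \<open>G\<close>-invariant and its
  cardinality is divisible by \<open>p\<close>, so \<open>0\<close> is not its only fixed point.
\<close>

lemma p_group_fixed_vector:
  assumes fin: "finite (carrier G)" and p: "prime p" and ord: "order G = p ^ k"
    and char: "add_pow K p \<one>\<^bsub>K\<^esub> = \<zero>\<^bsub>K\<^esub>" and v: "v \<in> carrier V" "v \<noteq> \<zero>\<^bsub>V\<^esub>"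
  obtains w where "w \<in> carrier V" "w \<noteq> \<zero>\<^bsub>V\<^esub>" "\<forall>g\<in>carrier G. \<rho> g w = w"
proof -
  interpret Gg: group G by (rule grp)
  define F where "F = range (\<lambda>n::nat. add_pow K n \<one>\<^bsub>K\<^esub>)"
  define s where "s = (\<lambda>c. \<Oplus>\<^bsub>V\<^esub>g\<in>carrier G. c g \<odot>\<^bsub>V\<^esub> \<rho> g v)"
  define E where "E = s ` (carrier G \<rightarrow>\<^sub>E F)"
  have FK: "F \<subseteq> carrier K" by (auto simp: F_def)
  have "finite F"
  proof -
    \<comment> \<open>The prime field is finite because multiples of \<open>1\<close> only depend on the residue modulo \<open>p\<close>.\<close>
    have "add_pow K n \<one>\<^bsub>K\<^esub> = add_pow K (n mod p) \<one>\<^bsub>K\<^esub>" for n :: nat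
    proof -
      have "add_pow K n \<one>\<^bsub>K\<^esub> = add_pow K (p * (n div p) + n mod p) \<one>\<^bsub>K\<^esub>" by simp
      also have "\<dots> = add_pow K (n div p) (add_pow K p \<one>\<^bsub>K\<^esub>) \<oplus>\<^bsub>K\<^esub> add_pow K (n mod p) \<one>\<^bsub>K\<^esub>"
        by (simp only: R.add.nat_pow_mult[symmetric] R.add.nat_pow_pow R.one_closed)
      finally show ?thesis by (simp add: char)
    qed
    then have "F \<subseteq> (\<lambda>n. add_pow K n \<one>\<^bsub>K\<^esub>) ` {..<p}"
      using prime_gt_0_nat[OF p] unfolding F_def by (metis (no_types, lifting) image_eqI image_subsetI lessThan_iff mod_less_divisor)
    then show ?thesis using finite_surj by blast
  qed
  then have finE: "finite E" using fin by (simp add: E_def finite_PiE)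
  have s_closed: "s c \<in> carrier V" if "c \<in> carrier G \<rightarrow> F" for c
    unfolding s_def using that FK v by (intro M.finsum_closed) auto
  have sE: "s c \<in> E" if c: "c \<in> carrier G \<rightarrow> F" for c
  proof -
    have "s c = s (restrict c (carrier G))"
      unfolding s_def by (rule M.finsum_cong') (use c FK v in auto)
    then show ?thesis using c by (auto simp: E_def)
  qed
  have EE: "\<exists>c\<in>carrier G \<rightarrow> F. w = s c" if "w \<in> E" for w using that by (auto simp: E_def PiE_iff)
  have EV: "E \<subseteq> carrier V" using EE s_closed by blast
  have F0: "\<zero>\<^bsub>K\<^esub> \<in> F" unfolding F_def by (rule image_eqI[of _ _ 0]) auto
  have F1: "\<one>\<^bsub>K\<^esub> \<in> F" unfolding F_def by (rule image_eqI[of _ _ 1]) auto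
  have Fadd: "a \<oplus>\<^bsub>K\<^esub> b \<in> F" if ab: "a \<in> F" "b \<in> F" for a b
  proof -
    obtain m n :: nat where "a = add_pow K m \<one>\<^bsub>K\<^esub>" "b = add_pow K n \<one>\<^bsub>K\<^esub>" using ab by (auto simp: F_def)
    then have "a \<oplus>\<^bsub>K\<^esub> b = add_pow K (m + n) \<one>\<^bsub>K\<^esub>" by (simp add: R.add.nat_pow_mult)
    then show ?thesis by (auto simp: F_def)
  qed
  have zE: "\<zero>\<^bsub>V\<^esub> \<in> E"
  proof -
    have "s (\<lambda>_. \<zero>\<^bsub>K\<^esub>) = \<zero>\<^bsub>V\<^esub>" unfolding s_def by (rule M.add.finprod_one_eqI) (use v in auto)
    then show ?thesis using sE[of "\<lambda>_. \<zero>\<^bsub>K\<^esub>"] F0 by auto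
  qed
  have vE: "v \<in> E"
  proof -
    let ?c = "\<lambda>g. if g = \<one>\<^bsub>G\<^esub> then \<one>\<^bsub>K\<^esub> else \<zero>\<^bsub>K\<^esub>"
    have "s ?c = (\<Oplus>\<^bsub>V\<^esub>g\<in>{\<one>\<^bsub>G\<^esub>}. ?c g \<odot>\<^bsub>V\<^esub> \<rho> g v)"
      unfolding s_def by (rule add.finprod_mono_neutral_cong_right) (use fin v in auto)
    also have "\<dots> = v" using v by (simp add: act_one)
    finally show ?thesis using sE[of ?c] F0 F1 by auto
  qed
  have addE: "x \<oplus>\<^bsub>V\<^esub> y \<in> E" if xy: "x \<in> E" "y \<in> E" for x y
  proof -
    obtain c d where cd: "c \<in> carrier G \<rightarrow> F" "x = s c" "d \<in> carrier G \<rightarrow> F" "y = s d" using EE xy by metis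
    have cdK: "c g \<in> carrier K" "d g \<in> carrier K" if "g \<in> carrier G" for g using that cd FK by auto
    have "x \<oplus>\<^bsub>V\<^esub> y = (\<Oplus>\<^bsub>V\<^esub>g\<in>carrier G. c g \<odot>\<^bsub>V\<^esub> \<rho> g v \<oplus>\<^bsub>V\<^esub> d g \<odot>\<^bsub>V\<^esub> \<rho> g v)"
      unfolding cd s_def by (subst M.finsum_addf) (use cdK v in auto)
    also have "\<dots> = s (\<lambda>g. c g \<oplus>\<^bsub>K\<^esub> d g)"
      unfolding s_def by (rule M.finsum_cong') (use cdK v in \<open>auto simp: smult_l_distr\<close>)
    also have "\<dots> \<in> E" by (rule sE) (use cd Fadd in auto)
    finally show ?thesis .
  qed
  have actE: "\<rho> h x \<in> E" if h: "h \<in> carrier G" and x: "x \<in> E" for h x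
  proof -
    obtain c where c: "c \<in> carrier G \<rightarrow> F" "x = s c" using EE x by metis
    have cK: "c g \<in> carrier K" if "g \<in> carrier G" for g using that c FK by auto
    have "\<rho> h x = (\<Oplus>\<^bsub>V\<^esub>g\<in>carrier G. \<rho> h (c g \<odot>\<^bsub>V\<^esub> \<rho> g v))"
      unfolding c(2) s_def by (rule act_finsum) (use fin cK h v in auto)
    also have "\<dots> = (\<Oplus>\<^bsub>V\<^esub>g\<in>carrier G. c (inv\<^bsub>G\<^esub> h \<otimes>\<^bsub>G\<^esub> (h \<otimes>\<^bsub>G\<^esub> g)) \<odot>\<^bsub>V\<^esub> \<rho> (h \<otimes>\<^bsub>G\<^esub> g) v)"
      by (rule M.finsum_cong') (use cK h v in \<open>auto simp: linear_smult act_mult Gg.cancel_simps\<close>)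
    also have "\<dots> = (\<Oplus>\<^bsub>V\<^esub>g\<in>(\<lambda>g. h \<otimes>\<^bsub>G\<^esub> g) ` carrier G. c (inv\<^bsub>G\<^esub> h \<otimes>\<^bsub>G\<^esub> g) \<odot>\<^bsub>V\<^esub> \<rho> g v)"
      by (rule M.finsum_reindex[symmetric]) (use cK h v in \<open>auto simp: inj_on_def\<close>)
    also have "(\<lambda>g. h \<otimes>\<^bsub>G\<^esub> g) ` carrier G = carrier G"
    proof
      show "carrier G \<subseteq> (\<lambda>g. h \<otimes>\<^bsub>G\<^esub> g) ` carrier G"
      proof
        fix x assume x: "x \<in> carrier G"
        show "x \<in> (\<lambda>g. h \<otimes>\<^bsub>G\<^esub> g) ` carrier G"
          by (rule image_eqI[of _ _ "inv\<^bsub>G\<^esub> h \<otimes>\<^bsub>G\<^esub> x"])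
            (use h x in \<open>auto simp: Gg.cancel_simps\<close>)
      qed
    qed (use h in auto)
    also have "(\<Oplus>\<^bsub>V\<^esub>g\<in>carrier G. c (inv\<^bsub>G\<^esub> h \<otimes>\<^bsub>G\<^esub> g) \<odot>\<^bsub>V\<^esub> \<rho> g v) = s (\<lambda>g. c (inv\<^bsub>G\<^esub> h \<otimes>\<^bsub>G\<^esub> g))"
      by (simp add: s_def)
    also have "\<dots> \<in> E" by (rule sE) (use c h in auto)
    finally show ?thesis .
  qed
  have pE: "add_pow V p x = \<zero>\<^bsub>V\<^esub>" if "x \<in> carrier V" for x
  proof -
    have "add_pow V n x = (add_pow K n \<one>\<^bsub>K\<^esub>) \<odot>\<^bsub>V\<^esub> x" for n :: nat
      by (induction n) (use that in \<open>auto simp: smult_l_distr\<close>)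
    then show ?thesis using char that by simp
  qed
  have powE: "add_pow V n x \<in> E" if "x \<in> E" for x and n :: nat
    by (induction n) (use that zE addE in auto)
  have sub: "subgroup E (add_monoid V)"
  proof (rule M.add.subgroupI)
    show "\<ominus>\<^bsub>V\<^esub> x \<in> E" if "x \<in> E" for x
    proof -
      have xV: "x \<in> carrier V" using that EV by auto
      have "add_pow V (p - 1) x \<oplus>\<^bsub>V\<^esub> x = add_pow V (Suc (p - 1)) x" by simp
      also have "\<dots> = \<zero>\<^bsub>V\<^esub>" using pE[OF xV] prime_gt_0_nat[OF p] by simp
      finally have "\<ominus>\<^bsub>V\<^esub> x = add_pow V (p - 1) x" using xV by (simp add: M.minus_equality)
      then show ?thesis using powE that by simp
    qed
  qed (use EV zE addE in auto)
  have "p dvd card E"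
  proof -
    interpret H: group "(add_monoid V)\<lparr>carrier := E\<rparr>" by (rule M.add.subgroup_imp_group[OF sub])
    have o: "H.ord v = M.add.ord v" by (rule M.add.ord_subgroup[OF sub vE])
    have "M.add.ord v dvd p" using M.add.pow_eq_id[of v p] pE[OF v(1)] v by (simp add: add_pow_def)
    moreover have "M.add.ord v \<noteq> 1" using M.add.ord_eq_1[of v] v by auto
    ultimately have "M.add.ord v = p" using p by (metis prime_nat_iff)
    then show ?thesis using H.ord_dvd_group_order[of v] o vE by (simp add: order_def)
  qed
  have "group_action G E (\<lambda>g. restrict (\<rho> g) E)"
    by (rule group_actionI[OF grp]) (use actE EV in \<open>auto simp: act_one act_mult subset_iff\<close>)
  then interpret A: group_action G E "\<lambda>g. restrict (\<rho> g) E" .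
  have z_fixed: "restrict (\<rho> g) E \<zero>\<^bsub>V\<^esub> = \<zero>\<^bsub>V\<^esub>" if "g \<in> carrier G" for g
    using that zE by (simp add: act_zero)
  obtain w where w: "w \<in> E" "w \<noteq> \<zero>\<^bsub>V\<^esub>" "\<forall>g\<in>carrier G. restrict (\<rho> g) E w = w"
    by (rule A.p_group_other_fixed_point[OF p ord finE \<open>p dvd card E\<close> zE z_fixed])
  show thesis by (rule that[of w]) (use w EV in auto)
qed

section \<open>Norm elements of cyclic subgroups\<close>

lemma minus_eq_zero_iff: "x \<in> carrier V \<Longrightarrow> y \<in> carrier V \<Longrightarrow> x \<ominus>\<^bsub>V\<^esub> y = \<zero>\<^bsub>V\<^esub> \<longleftrightarrow> x = y"
  by (metis M.add.inv_equality M.minus_minus M.a_inv_closed a_minus_def minus_zero_eq)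

text \<open>
  The action of the norm element \<open>1 + d + \<dots> + d ^ (n - 1)\<close> of the group algebra; in the applications
  \<open>d ^ n = 1\<close>, at least modulo some subgroup.
\<close>

definition cyc_sum :: "nat \<Rightarrow> 'g \<Rightarrow> 'v \<Rightarrow> 'v" where
  "cyc_sum n d v = (\<Oplus>\<^bsub>V\<^esub>j\<in>{..<n}. \<rho> (d [^]\<^bsub>G\<^esub> j) v)"

lemma pow_carrier: "d \<in> carrier G \<Longrightarrow> d [^]\<^bsub>G\<^esub> (j::nat) \<in> carrier G"
  by (simp add: group.is_monoid[OF grp] monoid.nat_pow_closed)

lemma cyc_sum_0 [simp]: "cyc_sum 0 d v = \<zero>\<^bsub>V\<^esub>"
  by (simp add: cyc_sum_def)

lemma cyc_sum_Suc:
  assumes "d \<in> carrier G" "v \<in> carrier V"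
  shows "cyc_sum (Suc n) d v = \<rho> (d [^]\<^bsub>G\<^esub> n) v \<oplus>\<^bsub>V\<^esub> cyc_sum n d v"
  unfolding cyc_sum_def lessThan_Suc
  by (rule M.finsum_insert) (use assms pow_carrier in auto)

lemma cyc_sum_closed [simp]:
  assumes "d \<in> carrier G" "v \<in> carrier V"
  shows "cyc_sum n d v \<in> carrier V"
  unfolding cyc_sum_def by (rule M.finsum_closed) (use assms pow_carrier in auto)

lemma cyc_sum_add:
  assumes "d \<in> carrier G" "u \<in> carrier V" "v \<in> carrier V"
  shows "cyc_sum n d (u \<oplus>\<^bsub>V\<^esub> v) = cyc_sum n d u \<oplus>\<^bsub>V\<^esub> cyc_sum n d v"
  by (induction n) (use assms pow_carrier in \<open>auto simp: cyc_sum_Suc linear_add M.a_ac\<close>)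

lemma cyc_sum_smult:
  assumes "d \<in> carrier G" "a \<in> carrier K" "v \<in> carrier V"
  shows "cyc_sum n d (a \<odot>\<^bsub>V\<^esub> v) = a \<odot>\<^bsub>V\<^esub> cyc_sum n d v"
  by (induction n) (use assms pow_carrier in \<open>auto simp: cyc_sum_Suc linear_smult smult_r_distr\<close>)

lemma cyc_sum_minus:
  assumes "d \<in> carrier G" "u \<in> carrier V" "v \<in> carrier V"
  shows "cyc_sum n d (u \<ominus>\<^bsub>V\<^esub> v) = cyc_sum n d u \<ominus>\<^bsub>V\<^esub> cyc_sum n d v"
proof -
  have m: "\<ominus>\<^bsub>V\<^esub> w = (\<ominus>\<^bsub>K\<^esub> \<one>\<^bsub>K\<^esub>) \<odot>\<^bsub>V\<^esub> w" if "w \<in> carrier V" for w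
    using that by (simp add: smult_l_minus)
  have "cyc_sum n d (\<ominus>\<^bsub>V\<^esub> v) = \<ominus>\<^bsub>V\<^esub> cyc_sum n d v"
    using assms by (simp add: m cyc_sum_smult del: M.minus_minus)
  then show ?thesis using assms by (simp add: a_minus_def cyc_sum_add)
qed

lemma act_cyc_sum:
  assumes g: "g \<in> carrier G" and d: "d \<in> carrier G" and v: "v \<in> carrier V"
  shows "\<rho> g (cyc_sum n d v) = cyc_sum n (g \<otimes>\<^bsub>G\<^esub> d \<otimes>\<^bsub>G\<^esub> inv\<^bsub>G\<^esub> g) (\<rho> g v)"
proof (induction n)
  case 0 then show ?case using g by (simp add: act_zero)
next
  case (Suc n)
  interpret Gg: group G by (rule grp)
  have "\<rho> ((g \<otimes>\<^bsub>G\<^esub> d \<otimes>\<^bsub>G\<^esub> inv\<^bsub>G\<^esub> g) [^]\<^bsub>G\<^esub> n) (\<rho> g v) = \<rho> g (\<rho> (d [^]\<^bsub>G\<^esub> n) v)"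
    unfolding Gg.conj_pow[OF g d] using g d v by (simp add: Gg.m_assoc flip: act_mult)
  then show ?case using Suc g d v by (simp add: cyc_sum_Suc linear_add)
qed

lemma act_cyc_sum_commute:
  assumes g: "g \<in> carrier G" and d: "d \<in> carrier G" and v: "v \<in> carrier V"
    and c: "g \<otimes>\<^bsub>G\<^esub> d = d \<otimes>\<^bsub>G\<^esub> g"
  shows "\<rho> g (cyc_sum n d v) = cyc_sum n d (\<rho> g v)"
proof -
  interpret Gg: group G by (rule grp)
  have "g \<otimes>\<^bsub>G\<^esub> d \<otimes>\<^bsub>G\<^esub> inv\<^bsub>G\<^esub> g = d" using c g d by (simp add: Gg.m_assoc)
  then show ?thesis using act_cyc_sum[OF g d v] by simp
qed

lemma cyc_sum_commute:
  assumes d: "d \<in> carrier G" and e: "e \<in> carrier G" and v: "v \<in> carrier V"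
    and c: "d \<otimes>\<^bsub>G\<^esub> e = e \<otimes>\<^bsub>G\<^esub> d"
  shows "cyc_sum n d (cyc_sum m e v) = cyc_sum m e (cyc_sum n d v)"
proof (induction n)
  case 0
  have "cyc_sum m e (\<zero>\<^bsub>K\<^esub> \<odot>\<^bsub>V\<^esub> \<zero>\<^bsub>V\<^esub>) = \<zero>\<^bsub>V\<^esub>"
    by (subst cyc_sum_smult) (use e in auto)
  then show ?case by simp
next
  case (Suc n)
  interpret Gg: group G by (rule grp)
  have "d [^]\<^bsub>G\<^esub> n \<otimes>\<^bsub>G\<^esub> e = e \<otimes>\<^bsub>G\<^esub> d [^]\<^bsub>G\<^esub> n"
    using Gg.group_commutes_pow[OF c d e] .
  then have "\<rho> (d [^]\<^bsub>G\<^esub> n) (cyc_sum m e v) = cyc_sum m e (\<rho> (d [^]\<^bsub>G\<^esub> n) v)"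
    by (intro act_cyc_sum_commute) (use d e v in auto)
  then show ?case using Suc d e v by (simp add: cyc_sum_Suc cyc_sum_add)
qed

lemma cyc_sum_telescope:
  assumes d: "d \<in> carrier G" and v: "v \<in> carrier V"
  shows "\<rho> d (cyc_sum n d v) \<oplus>\<^bsub>V\<^esub> v = \<rho> (d [^]\<^bsub>G\<^esub> n) v \<oplus>\<^bsub>V\<^esub> cyc_sum n d v"
proof (induction n)
  case 0 then show ?case using d v by (simp add: act_zero act_one)
next
  case (Suc n)
  interpret Gg: group G by (rule grp)
  have "\<rho> d (\<rho> (d [^]\<^bsub>G\<^esub> n) v) = \<rho> (d [^]\<^bsub>G\<^esub> Suc n) v"
    using d v Gg.group_commutes_pow[OF refl d d, of n] by (simp flip: act_mult)
  then have "\<rho> d (cyc_sum (Suc n) d v) \<oplus>\<^bsub>V\<^esub> v =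
      \<rho> (d [^]\<^bsub>G\<^esub> Suc n) v \<oplus>\<^bsub>V\<^esub> (\<rho> d (cyc_sum n d v) \<oplus>\<^bsub>V\<^esub> v)"
    using d v by (simp add: cyc_sum_Suc linear_add M.a_assoc)
  then show ?case using Suc d v by (simp add: cyc_sum_Suc)
qed

text \<open>
  The identity \<open>(d - 1) (1 + d + \<dots> + d ^ (n - 1)) = d ^ n - 1\<close>.
\<close>

lemma cyc_sum_diff:
  assumes d: "d \<in> carrier G" and v: "v \<in> carrier V"
  shows "\<rho> d (cyc_sum n d v) \<ominus>\<^bsub>V\<^esub> cyc_sum n d v = \<rho> (d [^]\<^bsub>G\<^esub> n) v \<ominus>\<^bsub>V\<^esub> v"
proof -
  let ?a = "\<rho> d (cyc_sum n d v)" and ?b = "cyc_sum n d v" and ?c = "\<rho> (d [^]\<^bsub>G\<^esub> n) v"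
  have c: "?a \<in> carrier V" "?b \<in> carrier V" "?c \<in> carrier V" using d v pow_carrier by auto
  have "?a \<ominus>\<^bsub>V\<^esub> ?b = (?a \<oplus>\<^bsub>V\<^esub> v) \<ominus>\<^bsub>V\<^esub> ?b \<ominus>\<^bsub>V\<^esub> v"
    using c v by (simp add: a_minus_def M.a_ac M.r_neg1 M.r_neg2)
  also have "\<dots> = ?c \<oplus>\<^bsub>V\<^esub> ?b \<ominus>\<^bsub>V\<^esub> ?b \<ominus>\<^bsub>V\<^esub> v" using cyc_sum_telescope[OF d v] by simp
  also have "\<dots> = ?c \<ominus>\<^bsub>V\<^esub> v" using c v by (simp add: a_minus_def M.a_assoc M.r_neg)
  finally show ?thesis .
qed

lemma cyc_sum_kills:
  assumes d: "d \<in> carrier G" and v: "v \<in> carrier V" and n: "d [^]\<^bsub>G\<^esub> n = \<one>\<^bsub>G\<^esub>"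
  shows "cyc_sum n d (\<rho> d v \<ominus>\<^bsub>V\<^esub> v) = \<zero>\<^bsub>V\<^esub>"
  using act_cyc_sum_commute[OF d d v refl] cyc_sum_diff[OF d v, of n] d v n
  by (simp add: cyc_sum_minus act_one minus_zero_eq)

lemma subrep_finsum:
  assumes W: "subrepresentation W G K V \<rho>" and "finite A" "F \<in> A \<rightarrow> W"
  shows "(\<Oplus>\<^bsub>V\<^esub>a\<in>A. F a) \<in> W"
  using assms(2,3)
proof (induction A)
  case empty then show ?case using subrepE(2)[OF W] by simp
next
  case (insert a A)
  then have "F \<in> A \<rightarrow> W" "F a \<in> W" "F \<in> A \<rightarrow> carrier V" "F a \<in> carrier V"
    using subrepE(1)[OF W] by auto
  then show ?case using insert subrepE(4)[OF W] by simp
qed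

lemma act_mod_pow:
  assumes J: "subrepresentation J G K V \<rho>" and d: "d \<in> carrier G" and v: "v \<in> carrier V"
    and dv: "\<rho> d v \<ominus>\<^bsub>V\<^esub> v \<in> J"
  shows "\<rho> (d [^]\<^bsub>G\<^esub> (n::nat)) v \<ominus>\<^bsub>V\<^esub> v \<in> J"
proof (induction n)
  case 0
  then show ?case using v subrepE(2)[OF J] by (simp add: act_one minus_zero_eq)
next
  case (Suc n)
  interpret Gg: group G by (rule grp)
  have "\<rho> d (\<rho> (d [^]\<^bsub>G\<^esub> n) v) \<ominus>\<^bsub>V\<^esub> \<rho> d v \<in> J"
    by (rule subrep_congruence(5)[OF J]) (use d v Suc in auto)
  then have "\<rho> (d [^]\<^bsub>G\<^esub> Suc n) v \<ominus>\<^bsub>V\<^esub> \<rho> d v \<in> J"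
    using d v Gg.group_commutes_pow[OF refl d d, of n] by (simp flip: act_mult)
  then show ?case by (rule subrep_congruence(2)[OF J _ _ _ _ dv, rotated -1]) (use d v in auto)
qed

lemma cyc_sum_mod:
  assumes J: "subrepresentation J G K V \<rho>" and d: "d \<in> carrier G" and v: "v \<in> carrier V"
    and dv: "\<rho> d v \<ominus>\<^bsub>V\<^esub> v \<in> J"
  shows "cyc_sum n d v \<ominus>\<^bsub>V\<^esub> (add_pow K n \<one>\<^bsub>K\<^esub>) \<odot>\<^bsub>V\<^esub> v \<in> J"
proof (induction n)
  case 0 then show ?case using v subrepE(2)[OF J] by (simp add: minus_zero_eq)
next
  case (Suc n)
  have "(\<rho> (d [^]\<^bsub>G\<^esub> n) v \<oplus>\<^bsub>V\<^esub> cyc_sum n d v) \<ominus>\<^bsub>V\<^esub> (v \<oplus>\<^bsub>V\<^esub> (add_pow K n \<one>\<^bsub>K\<^esub>) \<odot>\<^bsub>V\<^esub> v) \<in> J"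
    by (rule subrep_congruence(3)[OF J _ _ _ _ act_mod_pow[OF J d v dv] Suc])
      (use d v pow_carrier in auto)
  moreover have "v \<oplus>\<^bsub>V\<^esub> (add_pow K n \<one>\<^bsub>K\<^esub>) \<odot>\<^bsub>V\<^esub> v = (add_pow K (Suc n) \<one>\<^bsub>K\<^esub>) \<odot>\<^bsub>V\<^esub> v"
    using v by (simp add: smult_l_distr M.a_comm)
  ultimately show ?case using d v by (simp add: cyc_sum_Suc)
qed

lemma cyc_sum_in_subrep:
  assumes J: "subrepresentation J G K V \<rho>" and d: "d \<in> carrier G" and v: "v \<in> J"
  shows "cyc_sum n d v \<in> J"
  unfolding cyc_sum_def by (rule subrep_finsum[OF J]) (use d v pow_carrier subrepE(6)[OF J] in auto)

lemma cyc_sum_subgroup: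
  assumes H: "subgroup H G" and d: "d \<in> H"
  shows "representation.cyc_sum (G\<lparr>carrier := H\<rparr>) V \<rho> n d v = cyc_sum n d v"
proof -
  interpret Gg: group G by (rule grp)
  interpret H: representation "G\<lparr>carrier := H\<rparr>" K V \<rho> by (rule restrict_to_subgroup[OF H])
  show ?thesis unfolding cyc_sum_def H.cyc_sum_def by (simp flip: Gg.nat_pow_consistent)
qed

lemma smult_cancel_subrep:
  assumes K: "field K" and J: "subrepresentation J G K V \<rho>" and a: "a \<in> carrier K" "a \<noteq> \<zero>\<^bsub>K\<^esub>"
    and v: "v \<in> carrier V" "a \<odot>\<^bsub>V\<^esub> v \<in> J"
  shows "v \<in> J"
proof -
  have i: "inv\<^bsub>K\<^esub> a \<in> carrier K" "inv\<^bsub>K\<^esub> a \<otimes>\<^bsub>K\<^esub> a = \<one>\<^bsub>K\<^esub>"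
    using a field.field_Units[OF K] monoid.Units_inv_closed[OF R.monoid_axioms] monoid.Units_l_inv[OF R.monoid_axioms] by auto
  then have "inv\<^bsub>K\<^esub> a \<odot>\<^bsub>V\<^esub> (a \<odot>\<^bsub>V\<^esub> v) = v" using a v by (simp flip: smult_assoc1)
  then show ?thesis using subrepE(5)[OF J i(1) v(2)] by simp
qed

text \<open>
  Modulo \<open>J\<close> the norm element acts on \<open>v\<close> as the scalar \<open>n\<close>.
\<close>

lemma fixed_and_cyc_sum_in_subrep:
  assumes K: "field K" and J: "subrepresentation J G K V \<rho>" and d: "d \<in> carrier G" and v: "v \<in> carrier V"
    and dv: "\<rho> d v \<ominus>\<^bsub>V\<^esub> v \<in> J" and cs: "cyc_sum n d v \<in> J"
    and n: "nonzero_in K n"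
  shows "v \<in> J"
proof (rule smult_cancel_subrep[OF K J _ n v])
  show "add_pow K n \<one>\<^bsub>K\<^esub> \<odot>\<^bsub>V\<^esub> v \<in> J"
    using subrep_congruence(6)[OF J _ _ cyc_sum_mod[OF J d v dv]] cs d v by simp
qed simp

text \<open>
  A relative form of the fact that the fixed vectors of a normal subgroup form a subrepresentation.
\<close>

lemma fixed_mod_subrep:
  assumes H: "subgroup H G" and J: "subrepresentation J (G\<lparr>carrier := H\<rparr>) K V \<rho>"
    and P: "P \<subseteq> carrier G"
    and conj: "\<And>h x. h \<in> H \<Longrightarrow> x \<in> P \<Longrightarrow> inv\<^bsub>G\<^esub> h \<otimes>\<^bsub>G\<^esub> x \<otimes>\<^bsub>G\<^esub> h \<in> P"
  shows "subrepresentation {y \<in> carrier V. \<forall>x\<in>P. \<rho> x y \<ominus>\<^bsub>V\<^esub> y \<in> J} (G\<lparr>carrier := H\<rparr>) K V \<rho>"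
    (is "subrepresentation ?Y _ K V \<rho>")
proof -
  interpret Gg: group G by (rule grp)
  interpret H: representation "G\<lparr>carrier := H\<rparr>" K V \<rho> by (rule restrict_to_subgroup[OF H])
  note JE = H.subrepE[OF J] and cong = H.subrep_congruence[OF J]
  show ?thesis
  proof (rule H.subrepI)
    show "\<zero>\<^bsub>V\<^esub> \<in> ?Y" using P JE(2) by (auto simp: act_zero minus_zero_eq)
    show "x \<oplus>\<^bsub>V\<^esub> y \<in> ?Y" if "x \<in> ?Y" "y \<in> ?Y" for x y
      using that P cong(3) by (auto simp: linear_add subset_iff)
    show "a \<odot>\<^bsub>V\<^esub> x \<in> ?Y" if "a \<in> carrier K" "x \<in> ?Y" for a x
      using that P cong(4) by (auto simp: linear_smult subset_iff)
    show "\<rho> h y \<in> ?Y" if h: "h \<in> carrier (G\<lparr>carrier := H\<rparr>)" and y: "y \<in> ?Y" for h y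
    proof -
      have hH: "h \<in> H" and hG: "h \<in> carrier G" and yV: "y \<in> carrier V"
        using h y subgroup.mem_carrier[OF H] by auto
      have "\<rho> x (\<rho> h y) \<ominus>\<^bsub>V\<^esub> \<rho> h y \<in> J" if x: "x \<in> P" for x
      proof -
        have xG: "x \<in> carrier G" using P x by blast
        have "\<rho> (inv\<^bsub>G\<^esub> h \<otimes>\<^bsub>G\<^esub> x \<otimes>\<^bsub>G\<^esub> h) y \<ominus>\<^bsub>V\<^esub> y \<in> J" using y conj[OF hH x] by simp
        then have "\<rho> h (\<rho> (inv\<^bsub>G\<^esub> h \<otimes>\<^bsub>G\<^esub> x \<otimes>\<^bsub>G\<^esub> h) y) \<ominus>\<^bsub>V\<^esub> \<rho> h y \<in> J"
          by (intro cong(5)) (use hH hG xG yV in auto)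
        moreover have "\<rho> h (\<rho> (inv\<^bsub>G\<^esub> h \<otimes>\<^bsub>G\<^esub> x \<otimes>\<^bsub>G\<^esub> h) y) = \<rho> x (\<rho> h y)"
          using hG xG yV by (simp add: Gg.m_assoc Gg.cancel_simps flip: act_mult)
        ultimately show ?thesis by simp
      qed
      then show ?thesis using hG yV by simp
    qed
  qed auto
qed

section \<open>Normal p-subgroups in characteristic p\<close>

text \<open>
  Suppose \<open>w = n v - v\<close> is nonzero. By irreducibility \<open>v = a w\<close> for some \<open>a\<close> in the group algebra. Let \<open>H\<close> be the
  finite subgroup generated by \<open>n\<close> and the support of \<open>a\<close>, let \<open>P = N \<inter> H\<close>, and let \<open>J\<close> be an
  \<open>H\<close>-subrepresentation maximal among those avoiding \<open>v\<close>. The vectors fixed by \<open>P\<close> modulo \<open>J\<close> form an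
  \<open>H\<close>-subrepresentation, which is larger than \<open>J\<close> because the \<open>p\<close>-group \<open>P\<close> has a nonzero fixed vector
  in the quotient by \<open>J\<close>. Hence it contains \<open>v\<close>, so \<open>w \<in> J\<close> and \<open>v = a w \<in> J\<close>, a contradiction.
\<close>

theorem normal_p_subgroup_acts_trivially:
  assumes lf: "locally_finite G" and irr: "irreducible_rep G K V \<rho>"
    and N: "N \<lhd> G" and Np: "p_group p (G\<lparr>carrier := N\<rparr>)"
    and p: "prime p" and char: "add_pow K p \<one>\<^bsub>K\<^esub> = \<zero>\<^bsub>K\<^esub>"
    and n: "n \<in> N" and v: "v \<in> carrier V"
  shows "\<rho> n v = v"
proof (rule ccontr)
  assume nv: "\<rho> n v \<noteq> v"
  interpret Gg: group G by (rule grp)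
  have sN: "subgroup N G" using N normal_imp_subgroup by blast
  have nG: "n \<in> carrier G" using n sN subgroup.mem_carrier by metis
  define w where "w = \<rho> n v \<ominus>\<^bsub>V\<^esub> v"
  have wV: "w \<in> carrier V" using nG v by (simp add: w_def)
  have w0: "w \<noteq> \<zero>\<^bsub>V\<^esub>" using nv nG v by (simp add: w_def minus_eq_zero_iff)
  have v0: "v \<noteq> \<zero>\<^bsub>V\<^esub>" using nv nG by (auto simp: act_zero)
  let ?O = "(\<lambda>f. group_algebra_act G K V \<rho> f w) ` group_algebra_carrier G K"
  have "w \<in> ?O"
    using kG_single[of "\<one>\<^bsub>G\<^esub>" "\<one>\<^bsub>K\<^esub>" w] wV act_one by (metis Gg.one_closed R.one_closed image_eqI smult_one)
  then have "?O = carrier V"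
    using irr kG_orbit_subrep[OF wV] w0 unfolding irreducible_rep_def by blast
  then obtain f where f: "f \<in> group_algebra_carrier G K" "v = group_algebra_act G K V \<rho> f w"
    using v by auto
  define S where "S = {g \<in> carrier G. f g \<noteq> \<zero>\<^bsub>K\<^esub>}"
  have S: "finite S" "S \<subseteq> carrier G" using f(1) by (auto simp: S_def group_algebra_carrier_def)
  have v_eq: "v = (\<Oplus>\<^bsub>V\<^esub>g\<in>S. f g \<odot>\<^bsub>V\<^esub> \<rho> g w)" using f(2) by (simp add: group_algebra_act_def S_def)
  define H where "H = generate G (insert n S)"
  have sH: "subgroup H G" unfolding H_def by (rule Gg.generate_is_subgroup) (use S nG in auto)
  have HG: "\<And>h. h \<in> H \<Longrightarrow> h \<in> carrier G" using sH subgroup.mem_carrier by metis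
  have "carrier G \<inter> insert n S = insert n S" using S nG by auto
  then have finH: "finite H"
    using lf S nG unfolding locally_finite_def H_def
    by (metis (no_types, lifting) carrier_subgroup_generated finite_insert insert_subset)
  have SH: "S \<subseteq> H" "n \<in> H" by (auto simp: H_def intro: generate.incl)
  interpret H: representation "G\<lparr>carrier := H\<rparr>" K V \<rho> by (rule restrict_to_subgroup[OF sH])
  obtain J where J: "subrepresentation J (G\<lparr>carrier := H\<rparr>) K V \<rho>" "{\<zero>\<^bsub>V\<^esub>} \<subseteq> J" "v \<notin> J"
    "\<forall>J'. subrepresentation J' (G\<lparr>carrier := H\<rparr>) K V \<rho> \<longrightarrow> J \<subset> J' \<longrightarrow> v \<in> J'"
    by (rule H.maximal_subrep_avoiding[OF H.zero_subrep]) (use v0 in auto)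
  note JE = H.subrepE[OF J(1)] and cong = H.subrep_congruence[OF J(1)]
  define P where "P = N \<inter> H"
  have sP: "subgroup P G" unfolding P_def by (rule Gg.subgroups_Inter_pair[OF sN sH])
  have PH: "P \<subseteq> H" by (auto simp: P_def)
  have finP: "finite P" using finite_subset[OF PH finH] .
  have "\<exists>k. group.ord (G\<lparr>carrier := P\<rparr>) x = p ^ k" if x: "x \<in> P" for x
  proof -
    have "x \<in> N" using x by (simp add: P_def)
    then obtain k where "group.ord (G\<lparr>carrier := N\<rparr>) x = p ^ k" using Np by (auto simp: p_group_def)
    then show ?thesis using Gg.ord_subgroup[OF sN \<open>x \<in> N\<close>] Gg.ord_subgroup[OF sP x] by (intro exI[of _ k]) simp
  qed
  then have "p_group p (G\<lparr>carrier := P\<rparr>)" using Gg.subgroup_imp_group[OF sP] by (simp add: p_group_def)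
  then obtain k where k: "order (G\<lparr>carrier := P\<rparr>) = p ^ k"
    using p_group_order[OF p] finP by fastforce
  obtain U :: "('k, 'v set) module" and \<sigma> and i where
    U: "representation (G\<lparr>carrier := H\<rparr>) K U \<sigma>" "carrier U = i ` carrier V" "\<zero>\<^bsub>U\<^esub> = i \<zero>\<^bsub>V\<^esub>"
    "\<forall>x\<in>carrier V. \<forall>y\<in>carrier V. i x \<oplus>\<^bsub>U\<^esub> i y = i (x \<oplus>\<^bsub>V\<^esub> y)"
    "\<forall>a\<in>carrier K. \<forall>x\<in>carrier V. a \<odot>\<^bsub>U\<^esub> i x = i (a \<odot>\<^bsub>V\<^esub> x)"
    "\<forall>g\<in>carrier (G\<lparr>carrier := H\<rparr>). \<forall>x\<in>carrier V. \<sigma> g (i x) = i (\<rho> g x)"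
    "\<forall>x\<in>carrier V. \<forall>y\<in>carrier V. i x = i y \<longleftrightarrow> x \<ominus>\<^bsub>V\<^esub> y \<in> J"
    by (rule H.section_representation[OF J(1) H.carrier_subrep JE(1)])
  interpret U: representation "G\<lparr>carrier := H\<rparr>" K U \<sigma> by (rule U(1))
  have "subgroup P (G\<lparr>carrier := H\<rparr>)" by (rule Gg.subgroup_incl[OF sP sH PH])
  then have repP: "representation (G\<lparr>carrier := P\<rparr>) K U \<sigma>" using U.restrict_to_subgroup[of P] by simp
  interpret P: representation "G\<lparr>carrier := P\<rparr>" K U \<sigma> by (rule repP)
  have "i v \<noteq> \<zero>\<^bsub>U\<^esub>" using U(3,7) v J(3) by (simp add: minus_of_zero)
  moreover have "i v \<in> carrier U" using U(2) v by simp
  ultimately obtain u' where u': "u' \<in> carrier U" "u' \<noteq> \<zero>\<^bsub>U\<^esub>"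
    "\<forall>g\<in>carrier (G\<lparr>carrier := P\<rparr>). \<sigma> g u' = u'"
    using P.p_group_fixed_vector[OF _ p k char] finP by auto
  then obtain u where u: "u \<in> carrier V" "u' = i u" using U(2) by auto
  have uJ: "u \<notin> J" using u' u U(3,7) by (simp add: minus_of_zero)
  have ufix: "\<rho> x u \<ominus>\<^bsub>V\<^esub> u \<in> J" if "x \<in> P" for x
  proof -
    have "x \<in> H" using that PH by auto
    then have "\<sigma> x (i u) = i (\<rho> x u)" "\<rho> x u \<in> carrier V" using U(6) u HG by auto
    moreover from this have "i (\<rho> x u) = i u" using u'(3) u(2) that by simp
    ultimately show ?thesis using u(1) U(7) by blast
  qed
  define Y where "Y = {y \<in> carrier V. \<forall>x\<in>P. \<rho> x y \<ominus>\<^bsub>V\<^esub> y \<in> J}"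
  have PG: "\<And>x. x \<in> P \<Longrightarrow> x \<in> carrier G" using PH HG by auto
  have "subrepresentation Y (G\<lparr>carrier := H\<rparr>) K V \<rho>"
    unfolding Y_def
  proof (rule fixed_mod_subrep[OF sH J(1)])
    show "P \<subseteq> carrier G" using PG by blast
    show "inv\<^bsub>G\<^esub> h \<otimes>\<^bsub>G\<^esub> x \<otimes>\<^bsub>G\<^esub> h \<in> P" if "h \<in> H" "x \<in> P" for h x
      using that sH normal.inv_op_closed1[OF N HG] by (simp add: P_def subgroup.m_closed subgroup.m_inv_closed)
  qed
  moreover have "J \<subset> Y"
  proof
    show "J \<subseteq> Y" using JE PH HG by (auto simp: Y_def)
    show "J \<noteq> Y" using uJ ufix u by (auto simp: Y_def)
  qed
  ultimately have "v \<in> Y" using J(4) by blast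
  then have wJ: "w \<in> J" using n SH by (auto simp: Y_def w_def P_def)
  have "v \<in> J"
    unfolding v_eq by (rule H.subrep_finsum[OF J(1) S(1)])
      (use wJ JE(5,6) SH f(1) S(2) in \<open>auto simp: group_algebra_carrier_def PiE_iff subset_iff\<close>)
  then show False using J(3) by simp
qed

end

section \<open>From a faithful irreducible representation to a subgroup of the abelian socle\<close>

text \<open>
  For \<open>C\<close> a subgroup of an abelian group \<open>A\<close>: for each prime \<open>q\<close>, the elements of \<open>A / C\<close> killed by \<open>q\<close> form a
  cyclic group, expressed by representatives. If \<open>A\<close> is generated by elements of prime order,
  this is equivalent to \<open>A / C\<close> being locally cyclic, and it is the form of that condition which interacts
  with norm elements.
\<close>

definition prime_torsion_cyclic :: "('a, 'm) monoid_scheme \<Rightarrow> 'a set \<Rightarrow> 'a set \<Rightarrow> bool" where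
  "prime_torsion_cyclic G A C \<longleftrightarrow>
     (\<forall>(q::nat) x y. prime q \<longrightarrow> x \<in> A \<longrightarrow> y \<in> A \<longrightarrow>
        x [^]\<^bsub>G\<^esub> q \<in> C \<longrightarrow> y [^]\<^bsub>G\<^esub> q \<in> C \<longrightarrow> y \<notin> C \<longrightarrow> (\<exists>j::nat. x \<otimes>\<^bsub>G\<^esub> y [^]\<^bsub>G\<^esub> j \<in> C))"

lemma (in group) subgroup_coprime_powers:
  assumes H: "subgroup H G" and y: "y \<in> carrier G" and ab: "y [^] (a::nat) \<in> H" "y [^] (b::nat) \<in> H"
    and cop: "coprime a b"
  shows "y \<in> H"
proof (cases "a = 0")
  case True
  then have "b = 1" using cop by simp
  then show ?thesis using ab y by simp
next
  case False
  then obtain s t where st: "a * s = b * t + 1"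
    using bezout_nat[OF False, of b] cop by (auto simp: coprime_iff_gcd_eq_1)
  have s: "(y [^] a) [^] s = (y [^] b) [^] t \<otimes> y"
    using y st by (simp add: nat_pow_pow)
  have i: "(y [^] a) [^] s \<in> H" "(y [^] b) [^] t \<in> H" using ab H pow_in_subgroup by auto
  then have "inv ((y [^] b) [^] t) \<otimes> ((y [^] b) [^] t \<otimes> y) \<in> H"
    using H s by (metis subgroup.m_closed subgroup.m_inv_closed)
  then show ?thesis using y by (simp add: cancel_simps)
qed

context representation begin

text \<open>
  The vectors killed by some product of norm elements belonging to \<open>L\<close>, with repetitions
  allowed in the product.
\<close>

inductive annihilated :: "(nat \<times> 'g) set \<Rightarrow> 'v \<Rightarrow> bool" for L where
  zero: "annihilated L \<zero>\<^bsub>V\<^esub>"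
| step: "u \<in> carrier V \<Longrightarrow> (n, d) \<in> L \<Longrightarrow> annihilated L (cyc_sum n d u) \<Longrightarrow> annihilated L u"

lemma annihilated_carrier: "annihilated L u \<Longrightarrow> u \<in> carrier V"
  by (induction rule: annihilated.induct) auto

lemma cyc_sum_zero: "d \<in> carrier G \<Longrightarrow> cyc_sum n d \<zero>\<^bsub>V\<^esub> = \<zero>\<^bsub>V\<^esub>"
  using cyc_sum_smult[of d "\<zero>\<^bsub>K\<^esub>" "\<zero>\<^bsub>V\<^esub>" n] by simp

text \<open>
  Closure under addition uses that the norm elements commute; invariance under \<open>G\<close> uses that conjugation
  permutes \<open>L\<close>.
\<close>

lemma annihilated_subrep:
  assumes LG: "\<And>n d. (n, d) \<in> L \<Longrightarrow> d \<in> carrier G"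
    and comm: "\<And>n d m e. (n, d) \<in> L \<Longrightarrow> (m, e) \<in> L \<Longrightarrow> d \<otimes>\<^bsub>G\<^esub> e = e \<otimes>\<^bsub>G\<^esub> d"
    and conj: "\<And>n d g. (n, d) \<in> L \<Longrightarrow> g \<in> carrier G \<Longrightarrow> (n, g \<otimes>\<^bsub>G\<^esub> d \<otimes>\<^bsub>G\<^esub> inv\<^bsub>G\<^esub> g) \<in> L"
  shows "subrepresentation {u. annihilated L u} G K V \<rho>"
proof -
  have cyc: "annihilated L (cyc_sum m e u)" if "annihilated L u" "(m, e) \<in> L" for u m e
    using that
  proof (induction rule: annihilated.induct)
    case zero
    then show ?case using LG by (simp add: cyc_sum_zero annihilated.zero)
  next
    case (step u n d)
    have "cyc_sum m e (cyc_sum n d u) = cyc_sum n d (cyc_sum m e u)"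
      by (rule cyc_sum_commute) (use step LG comm in auto)
    then have "annihilated L (cyc_sum n d (cyc_sum m e u))" using step by simp
    moreover have "cyc_sum m e u \<in> carrier V" using LG step by simp
    ultimately show ?case using step.hyps(2) annihilated.step by blast
  qed
  have add: "annihilated L (u \<oplus>\<^bsub>V\<^esub> w)" if "annihilated L u" "annihilated L w" for u w
    using that
  proof (induction arbitrary: w rule: annihilated.induct)
    case zero then show ?case using annihilated_carrier by simp
  next
    case (step u n d)
    have w: "w \<in> carrier V" using step.prems annihilated_carrier by blast
    have "annihilated L (cyc_sum n d u \<oplus>\<^bsub>V\<^esub> cyc_sum n d w)"
      by (rule step.IH[OF cyc[OF step.prems step.hyps(2)]])
    then have "annihilated L (cyc_sum n d (u \<oplus>\<^bsub>V\<^esub> w))"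
      using step.hyps w LG by (simp add: cyc_sum_add)
    then show ?case using annihilated.step[OF _ step.hyps(2)] step.hyps(1) w by blast
  qed
  have smult: "annihilated L (a \<odot>\<^bsub>V\<^esub> u)" if a: "a \<in> carrier K" and u: "annihilated L u" for a u
    using u
  proof (induction rule: annihilated.induct)
    case zero then show ?case using a annihilated.zero by simp
  next
    case (step u n d)
    then have "annihilated L (cyc_sum n d (a \<odot>\<^bsub>V\<^esub> u))" using a LG by (simp add: cyc_sum_smult)
    then show ?case using annihilated.step[OF _ step.hyps(2)] step.hyps(1) a by blast
  qed
  have act: "annihilated L (\<rho> g u)" if g: "g \<in> carrier G" and u: "annihilated L u" for g u
    using u
  proof (induction rule: annihilated.induct)
    case zero then show ?case using g annihilated.zero by (simp add: act_zero)
  next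
    case (step u n d)
    then have "annihilated L (cyc_sum n (g \<otimes>\<^bsub>G\<^esub> d \<otimes>\<^bsub>G\<^esub> inv\<^bsub>G\<^esub> g) (\<rho> g u))"
      using g LG by (simp add: act_cyc_sum)
    then show ?case using annihilated.step[OF _ conj[OF step.hyps(2) g]] step.hyps(1) g by blast
  qed
  show ?thesis
    by (rule subrepI) (use annihilated_carrier annihilated.zero add smult act in auto)
qed

text \<open>
  The elements in \<open>L\<close> fix \<open>u\<close> modulo \<open>J\<close>, so each norm element acts on \<open>u\<close> modulo \<open>J\<close> as a nonzero scalar; a product
  of them can kill \<open>u\<close> only if \<open>u \<in> J\<close>.
\<close>

lemma annihilated_in_subrep:
  assumes K: "field K" and J: "subrepresentation J G K V \<rho>"
    and LG: "\<And>n d. (n, d) \<in> L \<Longrightarrow> d \<in> carrier G"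
    and comm: "\<And>n d m e. (n, d) \<in> L \<Longrightarrow> (m, e) \<in> L \<Longrightarrow> d \<otimes>\<^bsub>G\<^esub> e = e \<otimes>\<^bsub>G\<^esub> d"
    and nz: "\<And>n d. (n, d) \<in> L \<Longrightarrow> nonzero_in K n"
    and u: "annihilated L u" and triv: "\<And>n d. (n, d) \<in> L \<Longrightarrow> \<rho> d u \<ominus>\<^bsub>V\<^esub> u \<in> J"
  shows "u \<in> J"
  using u triv
proof (induction rule: annihilated.induct)
  case zero then show ?case using subrepE(2)[OF J] by simp
next
  case (step u n d)
  have dG: "d \<in> carrier G" using LG step.hyps by blast
  have "cyc_sum n d u \<in> J"
  proof (rule step.IH)
    fix m e assume e: "(m, e) \<in> L"
    have eG: "e \<in> carrier G" using LG e by blast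
    have "cyc_sum n d (\<rho> e u \<ominus>\<^bsub>V\<^esub> u) \<in> J"
      by (rule cyc_sum_in_subrep[OF J dG step.prems[OF e]])
    moreover have "\<rho> e (cyc_sum n d u) = cyc_sum n d (\<rho> e u)"
      by (rule act_cyc_sum_commute[OF eG dG step.hyps(1) comm[OF e step.hyps(2)]])
    ultimately show "\<rho> e (cyc_sum n d u) \<ominus>\<^bsub>V\<^esub> cyc_sum n d u \<in> J"
      using dG eG step.hyps(1) by (simp add: cyc_sum_minus)
  qed
  then show ?case
    using fixed_and_cyc_sum_in_subrep[OF K J dG step.hyps(1) step.prems[OF step.hyps(2)]] nz step.hyps(2) by blast
qed

text \<open>
  Take an \<open>A\<close>-subrepresentation \<open>J\<close> that is maximal among those avoiding some \<open>v \<noteq> 0\<close>, and let \<open>C\<close> be the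
  stabiliser of \<open>v\<close> modulo \<open>J\<close>. For \<open>x \<in> A - C\<close> the vectors fixed by \<open>x\<close> modulo \<open>J\<close> form a subrepresentation
  above \<open>J\<close> that does not contain \<open>v\<close>, hence they are just \<open>J\<close>. So if \<open>x ^ q \<in> C\<close>, the norm element of \<open>x\<close>,
  whose values on \<open>v\<close> are fixed by \<open>x\<close> modulo \<open>J\<close>, maps \<open>v\<close> into \<open>J\<close>.

  Suppose now \<open>x ^ q\<close> and \<open>y ^ q\<close> are in \<open>C\<close>, but neither \<open>y\<close> nor any \<open>x y ^ j\<close> is. Adding
  up the norm elements of \<open>x y ^ j\<close> for \<open>j < q\<close> gives
  \<open>\<Sum>j<q. \<Sum>i<q. x ^ i y ^ (i j) = q + (\<Sum>0<i<q. x ^ i N (y ^ i))\<close>, where \<open>N\<close> stands for the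
  norm element. All norm elements here map \<open>v\<close> into \<open>J\<close>, so \<open>q v \<in> J\<close>. As \<open>q\<close> is invertible in \<open>K\<close>, this is
  a contradiction.
\<close>

theorem faithful_irreducible_cocyclic:
  assumes K: "field K" and irr: "irreducible_rep G K V \<rho>" and faith: "faithful_rep G K V \<rho>"
    and A: "A \<lhd> G" and comm: "\<And>x y. x \<in> A \<Longrightarrow> y \<in> A \<Longrightarrow> x \<otimes>\<^bsub>G\<^esub> y = y \<otimes>\<^bsub>G\<^esub> x"
    and expo: "\<And>x. x \<in> A \<Longrightarrow> \<exists>n::nat. x [^]\<^bsub>G\<^esub> n = \<one>\<^bsub>G\<^esub> \<and> nonzero_in K n"
  obtains C where "subgroup C G" "C \<subseteq> A" "core G C = {\<one>\<^bsub>G\<^esub>}"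
    "prime_torsion_cyclic G A C"
proof -
  interpret Gg: group G by (rule grp)
  have sA: "subgroup A G" using A normal_imp_subgroup by blast
  have AG: "\<And>x. x \<in> A \<Longrightarrow> x \<in> carrier G" using sA subgroup.mem_carrier by metis
  have Ap: "\<And>x n. x \<in> A \<Longrightarrow> x [^]\<^bsub>G\<^esub> (n::nat) \<in> A" using Gg.pow_in_subgroup[OF sA] by blast
  have Am: "\<And>x y. x \<in> A \<Longrightarrow> y \<in> A \<Longrightarrow> x \<otimes>\<^bsub>G\<^esub> y \<in> A" using sA subgroup.m_closed by metis
  obtain v where v: "v \<in> carrier V" "v \<noteq> \<zero>\<^bsub>V\<^esub>"
    using irr M.zero_closed unfolding irreducible_rep_def by blast
  interpret A: representation "G\<lparr>carrier := A\<rparr>" K V \<rho> by (rule restrict_to_subgroup[OF sA])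
  obtain J where J: "subrepresentation J (G\<lparr>carrier := A\<rparr>) K V \<rho>" "{\<zero>\<^bsub>V\<^esub>} \<subseteq> J" "v \<notin> J"
    "\<forall>J'. subrepresentation J' (G\<lparr>carrier := A\<rparr>) K V \<rho> \<longrightarrow> J \<subset> J' \<longrightarrow> v \<in> J'"
    by (rule A.maximal_subrep_avoiding[OF A.zero_subrep]) (use v in auto)
  note JE = A.subrepE[OF J(1)] and cong = A.subrep_congruence[OF J(1)]
  have cs: "A.cyc_sum n d u = cyc_sum n d u" if "d \<in> A" for n d u
    by (rule cyc_sum_subgroup[OF sA that])
  define C where "C = {x \<in> A. \<rho> x v \<ominus>\<^bsub>V\<^esub> v \<in> J}"
  have CA: "C \<subseteq> A" by (auto simp: C_def)
  have sC: "subgroup C G"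
  proof (rule Gg.subgroupI)
    show "C \<subseteq> carrier G" using CA AG by auto
    have "\<one>\<^bsub>G\<^esub> \<in> C" using sA v JE(2) by (simp add: C_def subgroup.one_closed act_one minus_zero_eq)
    then show "C \<noteq> {}" by auto
    show "inv\<^bsub>G\<^esub> a \<in> C" if a: "a \<in> C" for a
    proof -
      have aA: "a \<in> A" "inv\<^bsub>G\<^esub> a \<in> A" "a \<in> carrier G" "\<rho> a v \<ominus>\<^bsub>V\<^esub> v \<in> J"
        using a sA AG by (auto simp: C_def subgroup.m_inv_closed)
      have "\<rho> (inv\<^bsub>G\<^esub> a) (\<rho> a v) \<ominus>\<^bsub>V\<^esub> \<rho> (inv\<^bsub>G\<^esub> a) v \<in> J"
        by (rule cong(5)) (use aA v in auto)
      then have "v \<ominus>\<^bsub>V\<^esub> \<rho> (inv\<^bsub>G\<^esub> a) v \<in> J" using aA v by (simp add: act_one flip: act_mult)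
      then have "\<rho> (inv\<^bsub>G\<^esub> a) v \<ominus>\<^bsub>V\<^esub> v \<in> J" by (rule cong(1)[rotated -1]) (use aA v in auto)
      then show ?thesis using aA by (simp add: C_def)
    qed
    show "a \<otimes>\<^bsub>G\<^esub> b \<in> C" if a: "a \<in> C" and b: "b \<in> C" for a b
    proof -
      have ab: "a \<in> A" "b \<in> A" "a \<in> carrier G" "b \<in> carrier G" "\<rho> a v \<ominus>\<^bsub>V\<^esub> v \<in> J" "\<rho> b v \<ominus>\<^bsub>V\<^esub> v \<in> J"
        using a b AG by (auto simp: C_def)
      have "\<rho> a (\<rho> b v) \<ominus>\<^bsub>V\<^esub> \<rho> a v \<in> J" by (rule cong(5)) (use ab v in auto)
      then have "\<rho> a (\<rho> b v) \<ominus>\<^bsub>V\<^esub> v \<in> J" by (rule cong(2)[rotated -2, OF _ ab(5)]) (use ab v in auto)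
      then show ?thesis using ab v Am by (simp add: C_def act_mult)
    qed
  qed
  have outside: "cyc_sum q x v \<in> J" if x: "x \<in> A" "x \<notin> C" "x [^]\<^bsub>G\<^esub> q \<in> C" for x and q :: nat
  proof -
    define Y where "Y = {u \<in> carrier V. \<rho> x u \<ominus>\<^bsub>V\<^esub> u \<in> J}"
    have xG: "x \<in> carrier G" using x AG by blast
    have "subrepresentation Y (G\<lparr>carrier := A\<rparr>) K V \<rho>"
    proof -
      have "inv\<^bsub>G\<^esub> h \<otimes>\<^bsub>G\<^esub> x \<otimes>\<^bsub>G\<^esub> h = x" if "h \<in> A" for h
        using comm[OF x(1) that] AG[OF that] xG by (simp add: Gg.m_assoc Gg.cancel_simps)
      then show ?thesis using fixed_mod_subrep[OF sA J(1), of "{x}"] xG by (simp add: Y_def)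
    qed
    moreover have "v \<notin> Y" using x by (simp add: Y_def C_def)
    moreover have "J \<subseteq> Y" using JE x(1) by (auto simp: Y_def)
    ultimately have JY: "J = Y" using J(4) by blast
    have "\<rho> x (cyc_sum q x v) \<ominus>\<^bsub>V\<^esub> cyc_sum q x v \<in> J"
      using cyc_sum_diff[OF xG v(1), of q] x(3) by (simp add: C_def)
    then have "cyc_sum q x v \<in> Y" using xG v by (simp add: Y_def)
    then show ?thesis using JY by blast
  qed
  \<comment> \<open>\<open>A\<close> has an exponent prime to the characteristic at each element, so if \<open>q\<close> were the
      characteristic, then \<open>y ^ q \<in> C\<close> would force \<open>y \<in> C\<close>.\<close>
  have qnz: "nonzero_in K q"
    if q: "prime q" and y: "y \<in> A" "y [^]\<^bsub>G\<^esub> q \<in> C" "y \<notin> C" for q :: nat and y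
  proof
    assume q0: "add_pow K q \<one>\<^bsub>K\<^esub> = \<zero>\<^bsub>K\<^esub>"
    obtain n :: nat where n: "y [^]\<^bsub>G\<^esub> n = \<one>\<^bsub>G\<^esub>" "nonzero_in K n" using expo[OF y(1)] by blast
    have "\<not> q dvd n" using n(2) q0 ring_char_eq_0_iff[OF K] by (meson dvd_trans)
    then have "coprime q n" using q prime_imp_coprime by blast
    moreover have "y [^]\<^bsub>G\<^esub> n \<in> C" using n(1) sC by (simp add: subgroup.one_closed)
    ultimately show False using Gg.subgroup_coprime_powers[OF sC _ y(2)] y AG by blast
  qed
  have cocyclic: "\<exists>j::nat. x \<otimes>\<^bsub>G\<^esub> y [^]\<^bsub>G\<^esub> j \<in> C"
    if q: "prime q" and x: "x \<in> A" "x [^]\<^bsub>G\<^esub> q \<in> C"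
      and y: "y \<in> A" "y [^]\<^bsub>G\<^esub> q \<in> C" "y \<notin> C" for q :: nat and x y
  proof (rule ccontr)
    assume no: "\<nexists>j::nat. x \<otimes>\<^bsub>G\<^esub> y [^]\<^bsub>G\<^esub> j \<in> C"
    have xyG: "x \<in> carrier G" "y \<in> carrier G" using x y AG by auto
    have cy: "x \<otimes>\<^bsub>G\<^esub> y [^]\<^bsub>G\<^esub> (j::nat) = y [^]\<^bsub>G\<^esub> j \<otimes>\<^bsub>G\<^esub> x" for j using comm x y Ap by blast
    have pw: "(x \<otimes>\<^bsub>G\<^esub> y [^]\<^bsub>G\<^esub> j) [^]\<^bsub>G\<^esub> i = x [^]\<^bsub>G\<^esub> i \<otimes>\<^bsub>G\<^esub> (y [^]\<^bsub>G\<^esub> i) [^]\<^bsub>G\<^esub> j" for i j :: nat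
      using Gg.pow_mult_distrib[OF cy[of j]] xyG by (simp add: Gg.nat_pow_pow mult.commute)
    have yi: "y [^]\<^bsub>G\<^esub> i \<notin> C" if i: "0 < i" "i < q" for i :: nat
    proof
      assume yi: "y [^]\<^bsub>G\<^esub> i \<in> C"
      have "coprime q i" using q i by (meson dvd_imp_le not_le prime_imp_coprime)
      then show False using Gg.subgroup_coprime_powers[OF sC xyG(2) y(2) yi] y(3) by blast
    qed
    let ?t = "\<lambda>j i. \<rho> (x [^]\<^bsub>G\<^esub> i \<otimes>\<^bsub>G\<^esub> (y [^]\<^bsub>G\<^esub> i) [^]\<^bsub>G\<^esub> j) v"
    have tV: "?t j i \<in> carrier V" for i j :: nat using xyG v by simp
    have S1: "(\<Oplus>\<^bsub>V\<^esub>i\<in>{..<q}. ?t j i) \<in> J" for j :: nat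
    proof -
      have "x \<otimes>\<^bsub>G\<^esub> y [^]\<^bsub>G\<^esub> j \<in> A" using Am x(1) Ap[OF y(1)] by blast
      moreover have "(x \<otimes>\<^bsub>G\<^esub> y [^]\<^bsub>G\<^esub> j) [^]\<^bsub>G\<^esub> q \<in> C"
        unfolding pw using sC x(2) Gg.pow_in_subgroup[OF sC y(2)] by (simp add: subgroup.m_closed)
      ultimately have "cyc_sum q (x \<otimes>\<^bsub>G\<^esub> y [^]\<^bsub>G\<^esub> j) v \<in> J" using outside no by blast
      then show ?thesis by (simp add: cyc_sum_def pw)
    qed
    \<comment> \<open>For fixed \<open>i > 0\<close> the sum over \<open>j\<close> is the norm element of \<open>y ^ i\<close>, translated by \<open>x ^ i\<close>.\<close>
    have S2: "(\<Oplus>\<^bsub>V\<^esub>j\<in>{..<q}. ?t j i) \<in> J" if i: "0 < i" "i < q" for i :: nat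
    proof -
      have "(y [^]\<^bsub>G\<^esub> i) [^]\<^bsub>G\<^esub> q = (y [^]\<^bsub>G\<^esub> q) [^]\<^bsub>G\<^esub> i" using xyG by (simp add: Gg.nat_pow_pow mult.commute)
      then have "(y [^]\<^bsub>G\<^esub> i) [^]\<^bsub>G\<^esub> q \<in> C" using Gg.pow_in_subgroup[OF sC y(2)] by simp
      then have c: "cyc_sum q (y [^]\<^bsub>G\<^esub> i) v \<in> J" by (rule outside[OF Ap[OF y(1)] yi[OF i]])
      have "\<rho> (x [^]\<^bsub>G\<^esub> i) (cyc_sum q (y [^]\<^bsub>G\<^esub> i) v) = (\<Oplus>\<^bsub>V\<^esub>j\<in>{..<q}. ?t j i)"
        unfolding cyc_sum_def by (subst act_finsum) (use xyG v in \<open>auto simp: act_mult\<close>)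
      moreover have "\<rho> (x [^]\<^bsub>G\<^esub> i) (cyc_sum q (y [^]\<^bsub>G\<^esub> i) v) \<in> J"
        using JE(6)[OF _ c, of "x [^]\<^bsub>G\<^esub> i"] Ap[OF x(1)] by simp
      ultimately show ?thesis by simp
    qed
    have S0: "(\<Oplus>\<^bsub>V\<^esub>j\<in>{..<m}. ?t j (0::nat)) = add_pow K m \<one>\<^bsub>K\<^esub> \<odot>\<^bsub>V\<^esub> v" for m :: nat
    proof (induction m)
      case (Suc m)
      have "(\<Oplus>\<^bsub>V\<^esub>j\<in>{..<Suc m}. ?t j (0::nat)) = v \<oplus>\<^bsub>V\<^esub> (\<Oplus>\<^bsub>V\<^esub>j\<in>{..<m}. ?t j (0::nat))"
        unfolding lessThan_Suc by (subst M.finsum_insert) (use v in \<open>auto simp: act_one\<close>)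
      then show ?case using Suc v by (simp add: smult_l_distr M.a_comm)
    qed (use v in simp)
    have swap: "(\<Oplus>\<^bsub>V\<^esub>j\<in>{..<m}. \<Oplus>\<^bsub>V\<^esub>i\<in>{..<q}. ?t j i) = (\<Oplus>\<^bsub>V\<^esub>i\<in>{..<q}. \<Oplus>\<^bsub>V\<^esub>j\<in>{..<m}. ?t j i)" for m :: nat
    proof (induction m)
      case 0 show ?case by simp
    next
      case (Suc m)
      have "(\<Oplus>\<^bsub>V\<^esub>j\<in>{..<Suc m}. \<Oplus>\<^bsub>V\<^esub>i\<in>{..<q}. ?t j i) =
          (\<Oplus>\<^bsub>V\<^esub>i\<in>{..<q}. ?t m i) \<oplus>\<^bsub>V\<^esub> (\<Oplus>\<^bsub>V\<^esub>i\<in>{..<q}. \<Oplus>\<^bsub>V\<^esub>j\<in>{..<m}. ?t j i)"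
        unfolding lessThan_Suc using tV Suc by (subst M.finsum_insert) auto
      also have "\<dots> = (\<Oplus>\<^bsub>V\<^esub>i\<in>{..<q}. ?t m i \<oplus>\<^bsub>V\<^esub> (\<Oplus>\<^bsub>V\<^esub>j\<in>{..<m}. ?t j i))"
        using tV by (subst M.finsum_addf) auto
      also have "\<dots> = (\<Oplus>\<^bsub>V\<^esub>i\<in>{..<q}. \<Oplus>\<^bsub>V\<^esub>j\<in>{..<Suc m}. ?t j i)"
        unfolding lessThan_Suc using tV by (intro M.finsum_cong') auto
      finally show ?case .
    qed
    have q0: "{..<q} = insert 0 {0<..<q}" using prime_gt_0_nat[OF q] by auto
    have "(\<Oplus>\<^bsub>V\<^esub>j\<in>{..<q}. \<Oplus>\<^bsub>V\<^esub>i\<in>{..<q}. ?t j i) \<in> J"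
      by (rule A.subrep_finsum[OF J(1)]) (use S1 in auto)
    moreover define F where "F = (\<lambda>i::nat. \<Oplus>\<^bsub>V\<^esub>j\<in>{..<q}. ?t j i)"
    have FV: "F i \<in> carrier V" for i unfolding F_def using tV by (intro M.finsum_closed) auto
    have "(\<Oplus>\<^bsub>V\<^esub>i\<in>{..<q}. F i) = F 0 \<oplus>\<^bsub>V\<^esub> (\<Oplus>\<^bsub>V\<^esub>i\<in>{0<..<q}. F i)"
      unfolding q0 by (rule M.finsum_insert) (use FV in auto)
    then have "(\<Oplus>\<^bsub>V\<^esub>i\<in>{..<q}. \<Oplus>\<^bsub>V\<^esub>j\<in>{..<q}. ?t j i) =
      (\<Oplus>\<^bsub>V\<^esub>j\<in>{..<q}. ?t j (0::nat)) \<oplus>\<^bsub>V\<^esub> (\<Oplus>\<^bsub>V\<^esub>i\<in>{0<..<q}. \<Oplus>\<^bsub>V\<^esub>j\<in>{..<q}. ?t j i)"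
      unfolding F_def .
    moreover have "(\<Oplus>\<^bsub>V\<^esub>i\<in>{0<..<q}. \<Oplus>\<^bsub>V\<^esub>j\<in>{..<q}. ?t j i) \<in> J"
      by (rule A.subrep_finsum[OF J(1)]) (use S2 in auto)
    ultimately have *: "(add_pow K q \<one>\<^bsub>K\<^esub> \<odot>\<^bsub>V\<^esub> v) \<oplus>\<^bsub>V\<^esub> (\<Oplus>\<^bsub>V\<^esub>i\<in>{0<..<q}. \<Oplus>\<^bsub>V\<^esub>j\<in>{..<q}. ?t j i) \<in> J"
      and b: "(\<Oplus>\<^bsub>V\<^esub>i\<in>{0<..<q}. \<Oplus>\<^bsub>V\<^esub>j\<in>{..<q}. ?t j i) \<in> J" using swap[of q] S0 by simp_all
    have qv: "add_pow K q \<one>\<^bsub>K\<^esub> \<odot>\<^bsub>V\<^esub> v \<in> J"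
      using JE(8)[OF * b] JE(3)[OF b] v by (simp add: a_minus_def M.a_assoc M.r_neg)
    have "v \<in> J"
      by (rule A.smult_cancel_subrep[OF K J(1) _ qnz[OF q y] v(1) qv]) simp
    then show False using J(3) by simp
  qed
  have core1: "core G C = {\<one>\<^bsub>G\<^esub>}"
  proof -
    define D where "D = core G C"
    define L where "L = {(n::nat, d). d \<in> D \<and> d [^]\<^bsub>G\<^esub> n = \<one>\<^bsub>G\<^esub> \<and> nonzero_in K n}"
    note D = Gg.mem_core_iff[OF sC, folded D_def]
    have DG: "\<And>d. d \<in> D \<Longrightarrow> d \<in> carrier G" using D by blast
    have DC: "d \<in> C" if "d \<in> D" for d
      using bspec[OF conjunct2[OF D[THEN iffD1, OF that]] Gg.one_closed] DG[OF that] by simp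
    have DA: "\<And>d. d \<in> D \<Longrightarrow> d \<in> A" using DC CA by blast
    have Dconj: "g \<otimes>\<^bsub>G\<^esub> d \<otimes>\<^bsub>G\<^esub> inv\<^bsub>G\<^esub> g \<in> D" if g: "g \<in> carrier G" and d: "d \<in> D" for g d
    proof -
      have "h \<otimes>\<^bsub>G\<^esub> (g \<otimes>\<^bsub>G\<^esub> d \<otimes>\<^bsub>G\<^esub> inv\<^bsub>G\<^esub> g) \<otimes>\<^bsub>G\<^esub> inv\<^bsub>G\<^esub> h = (h \<otimes>\<^bsub>G\<^esub> g) \<otimes>\<^bsub>G\<^esub> d \<otimes>\<^bsub>G\<^esub> inv\<^bsub>G\<^esub> (h \<otimes>\<^bsub>G\<^esub> g)"
        if "h \<in> carrier G" for h using that g DG[OF d] by (simp add: Gg.inv_mult_group Gg.m_assoc)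
      then show ?thesis using d g by (simp add: D)
    qed
    have Dtriv: "D \<subseteq> {\<one>\<^bsub>G\<^esub>}"
    proof (rule ccontr)
      assume "\<not> D \<subseteq> {\<one>\<^bsub>G\<^esub>}"
      then obtain d where d: "d \<in> D" "d \<noteq> \<one>\<^bsub>G\<^esub>" by blast
      have LG: "\<And>n d. (n, d) \<in> L \<Longrightarrow> d \<in> carrier G" using DG by (auto simp: L_def)
      have Lc: "\<And>n d m e. (n, d) \<in> L \<Longrightarrow> (m, e) \<in> L \<Longrightarrow> d \<otimes>\<^bsub>G\<^esub> e = e \<otimes>\<^bsub>G\<^esub> d"
        using comm DA by (auto simp: L_def)
      have "subrepresentation {u. annihilated L u} G K V \<rho>"
      proof (rule annihilated_subrep[OF LG Lc])
        fix n e g assume "(n, e) \<in> L" "g \<in> carrier G"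
        then show "(n, g \<otimes>\<^bsub>G\<^esub> e \<otimes>\<^bsub>G\<^esub> inv\<^bsub>G\<^esub> g) \<in> L"
          using Dconj DG by (auto simp: L_def Gg.conj_pow)
      qed auto
      moreover obtain u where u: "u \<in> carrier V" "\<rho> d u \<noteq> u"
        using faith d DG unfolding faithful_rep_def by blast
      have "annihilated L (\<rho> d u \<ominus>\<^bsub>V\<^esub> u)"
      proof -
        obtain n :: nat where n: "d [^]\<^bsub>G\<^esub> n = \<one>\<^bsub>G\<^esub>" "nonzero_in K n" using expo DA d by blast
        then have nd: "(n, d) \<in> L" using d by (simp add: L_def)
        show ?thesis
        proof (rule annihilated.step[OF _ nd])
          show "\<rho> d u \<ominus>\<^bsub>V\<^esub> u \<in> carrier V" using u d DG by simp
          show "annihilated L (cyc_sum n d (\<rho> d u \<ominus>\<^bsub>V\<^esub> u))"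
            using cyc_sum_kills[OF DG[OF d(1)] u(1) n(1)] annihilated.zero by simp
        qed
      qed
      moreover have "\<rho> d u \<ominus>\<^bsub>V\<^esub> u \<noteq> \<zero>\<^bsub>V\<^esub>" using u d DG by (simp add: minus_eq_zero_iff)
      ultimately have "{u. annihilated L u} = carrier V" using irr unfolding irreducible_rep_def by blast
      then have av: "annihilated L v" using v by blast
      have "v \<in> J"
      proof (rule A.annihilated_in_subrep[OF K J(1), of L])
        have "A.annihilated L u" if "annihilated L u" for u
          using that
        proof (induction rule: annihilated.induct)
          case zero show ?case by (rule A.annihilated.zero)
        next
          case (step u n d)
          then show ?case using A.annihilated.step[of u n d L] cs DA by (auto simp: L_def)
        qed
        then show "A.annihilated L v" using av by blast
      qed (use DA Lc DC in \<open>auto simp: L_def C_def\<close>)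
      then show False using J(3) by simp
    qed
    moreover have "\<one>\<^bsub>G\<^esub> \<in> D" using subgroup.one_closed[OF sC] by (simp add: D)
    ultimately show ?thesis unfolding D_def by blast
  qed
  show thesis
    by (rule that[OF sC CA core1]) (use cocyclic in \<open>unfold prime_torsion_cyclic_def, blast\<close>)
qed

end

section \<open>Locally cyclic quotients\<close>

context group begin

lemma subgroup_of_finite_cyclic:
  assumes c: "c \<in> carrier G" "ord c > 0" and H: "subgroup H G" "H \<subseteq> generate G {c}"
  obtains d where "d \<in> H" "H = generate G {d}"
proof -
  obtain k :: nat where k: "k > 0" "c [^] k \<in> H" "\<forall>m. 0 < m \<longrightarrow> m < k \<longrightarrow> c [^] m \<notin> H"
    by (rule least_power_in_subgroup[OF c H(1)])
  have kG: "c [^] k \<in> carrier G" using c by simp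
  have "h \<in> generate G {c [^] k}" if h: "h \<in> H" for h
  proof -
    obtain i :: int where i: "h = c [^] i" using H(2) h generate_pow[OF c(1)] by auto
    define r where "r = i mod int k"
    have r: "0 \<le> r" "r < int k" using k by (simp_all add: r_def)
    have "c [^] i = c [^] (int k * (i div int k)) \<otimes> c [^] r"
      using c by (simp add: r_def flip: int_pow_mult)
    moreover have e: "c [^] (int k * (i div int k)) = (c [^] k) [^] (i div int k)"
      using c by (simp add: int_pow_pow flip: int_pow_int)
    ultimately have hr: "h = (c [^] k) [^] (i div int k) \<otimes> c [^] r" using i by simp
    have "(c [^] k) [^] (i div int k) \<in> H" using subgroup_int_pow_closed[OF H(1) k(2)] .
    then have "inv ((c [^] k) [^] (i div int k)) \<otimes> h \<in> H"
      using H(1) h by (simp add: subgroup.m_closed subgroup.m_inv_closed)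
    then have "c [^] r \<in> H" using hr c kG by (simp add: cancel_simps)
    then have "c [^] nat r \<in> H" using r by (simp flip: int_pow_int)
    then have "nat r = 0" using k(3) r by (metis gr0I int_nat_eq nat_less_iff)
    then have "h = (c [^] k) [^] (i div int k)" using hr r kG by simp
    then show ?thesis using generate_pow[OF kG] by blast
  qed
  moreover have "generate G {c [^] k} \<subseteq> H" using generate_subgroup_incl[OF _ H(1)] k by simp
  ultimately show thesis using that[OF k(2)] by blast
qed

end

context comm_group begin

text \<open>
  If \<open>q\<close> divides the order of \<open>c\<close>, then some power of \<open>c\<close> is nontrivial and killed by \<open>q\<close>, and \<open>y\<close> is a power of it
  by assumption; so \<open>d = c\<close> works. Otherwise the orders are coprime and \<open>d = c \<otimes> y\<close> works.
\<close>

lemma join_cyclic: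
  assumes uniq: "\<And>q x y. prime (q::nat) \<Longrightarrow> x \<in> carrier G \<Longrightarrow> y \<in> carrier G \<Longrightarrow>
      x [^] q = \<one> \<Longrightarrow> y [^] q = \<one> \<Longrightarrow> y \<noteq> \<one> \<Longrightarrow> \<exists>j::nat. x \<otimes> y [^] j = \<one>"
    and c: "c \<in> carrier G" "ord c > 0" and q: "prime (q::nat)" and y: "y \<in> carrier G" "y [^] q = \<one>"
  obtains d where "d \<in> carrier G" "ord d > 0" "c \<in> generate G {d}" "y \<in> generate G {d}"
proof (cases "q dvd ord c")
  case True
  then obtain k where k: "ord c = q * k" by auto
  define z where "z = c [^] k"
  have zG: "z \<in> carrier G" "z [^] q = \<one>" using c k pow_ord_eq_1[OF c(1)] by (simp_all add: z_def nat_pow_pow mult.commute)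
  have "z \<noteq> \<one>"
  proof
    assume "z = \<one>"
    then have "q * k dvd k" using pow_eq_id[OF c(1)] k by (simp add: z_def)
    moreover have "k > 0" using c(2) k by (cases k) auto
    ultimately show False using prime_gt_1_nat[OF q] dvd_imp_le[of "q * k" k] by simp
  qed
  then obtain j :: nat where j: "y \<otimes> z [^] j = \<one>" using uniq[OF q y(1) zG(1) y(2) zG(2)] by blast
  have sub: "subgroup (generate G {c}) G" using c by (intro generate_is_subgroup) auto
  have cc: "c \<in> generate G {c}" by (simp add: generate.incl)
  have "z [^] j \<in> generate G {c}" unfolding z_def using sub cc by (simp add: pow_in_subgroup)
  moreover have "y = inv (z [^] j)" using j y zG by (simp add: inv_equality)
  ultimately have "y \<in> generate G {c}" using sub by (simp add: subgroup.m_inv_closed)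
  then show thesis using that c cc by blast
next
  case False
  then have cop: "coprime (ord c) q" using q by (simp add: coprime_commute prime_imp_coprime)
  define d where "d = c \<otimes> y"
  have dG: "d \<in> carrier G" using c y by (simp add: d_def)
  have sub: "subgroup (generate G {d}) G" using dG by (intro generate_is_subgroup) auto
  have dd: "d \<in> generate G {d}" by (simp add: generate.incl)
  have "d [^] (ord c * q) = (c [^] ord c) [^] q \<otimes> (y [^] q) [^] ord c"
    unfolding d_def using c(1) y(1) by (simp only: nat_pow_distrib nat_pow_pow mult.commute[of q])
  then have "d [^] (ord c * q) = \<one>" using c(1) y by simp
  then have "ord d dvd ord c * q" using pow_eq_id[OF dG] by simp
  then have od: "ord d > 0" using c(2) prime_gt_0_nat[OF q] by (metis dvd_pos_nat nat_0_less_mult_iff)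
  have "d [^] ord c = y [^] ord c" using c y by (simp add: d_def nat_pow_distrib)
  then have "y [^] ord c \<in> generate G {d}" using pow_in_subgroup[OF sub dd] by metis
  moreover have "y [^] q \<in> generate G {d}" using y sub by (simp add: subgroup.one_closed)
  ultimately have yd: "y \<in> generate G {d}" by (rule subgroup_coprime_powers[OF sub y(1) _ _ cop])
  moreover have "c = d \<otimes> inv y" using c y by (simp add: d_def m_assoc)
  ultimately have "c \<in> generate G {d}" using sub dd by (simp add: subgroup.m_closed subgroup.m_inv_closed)
  then show thesis using that dG od yd by blast
qed

lemma locally_cyclicI:
  assumes P: "P \<subseteq> carrier G" "generate G P = carrier G"
      "\<And>y. y \<in> P \<Longrightarrow> \<exists>q::nat. prime q \<and> y [^] q = \<one>"
    and uniq: "\<And>q x y. prime (q::nat) \<Longrightarrow> x \<in> carrier G \<Longrightarrow> y \<in> carrier G \<Longrightarrow>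
      x [^] q = \<one> \<Longrightarrow> y [^] q = \<one> \<Longrightarrow> y \<noteq> \<one> \<Longrightarrow> \<exists>j::nat. x \<otimes> y [^] j = \<one>"
  shows "locally_cyclic G"
proof -
  have P_cyc: "\<exists>c\<in>carrier G. ord c > 0 \<and> F \<subseteq> generate G {c}" if "finite F" "F \<subseteq> P" for F
    using that
  proof (induction F)
    case empty show ?case by (intro bexI[of _ \<one>]) auto
  next
    case (insert y F)
    then obtain c where c: "c \<in> carrier G" "ord c > 0" "F \<subseteq> generate G {c}" by auto
    obtain q :: nat where q: "prime q" "y [^] q = \<one>" using P(3)[of y] insert by auto
    have yG: "y \<in> carrier G" using P(1) insert by auto
    obtain d where d: "d \<in> carrier G" "ord d > 0" "c \<in> generate G {d}" "y \<in> generate G {d}"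
      by (rule join_cyclic[OF uniq c(1,2) q(1) yG q(2)])
    have "generate G {c} \<subseteq> generate G {d}"
      using d by (intro generate_subgroup_incl generate_is_subgroup) auto
    then show ?case using c d by (intro bexI[of _ d]) auto
  qed
  show ?thesis unfolding locally_cyclic_def
  proof (intro allI impI)
    fix S assume S: "finite S \<and> S \<subseteq> carrier G"
    have "\<forall>s\<in>S. \<exists>F. finite F \<and> F \<subseteq> P \<and> s \<in> generate G F"
      using S P(2) generate_finite_subset[of _ P] by auto
    then obtain Fs where Fs: "\<And>s. s \<in> S \<Longrightarrow> finite (Fs s) \<and> Fs s \<subseteq> P \<and> s \<in> generate G (Fs s)" by metis
    have "finite (\<Union>s\<in>S. Fs s)" "(\<Union>s\<in>S. Fs s) \<subseteq> P" using S Fs by auto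
    then obtain c where c: "c \<in> carrier G" "ord c > 0" "(\<Union>s\<in>S. Fs s) \<subseteq> generate G {c}" using P_cyc by blast
    have subc: "subgroup (generate G {c}) G" using c by (intro generate_is_subgroup) auto
    have "S \<subseteq> generate G {c}"
    proof
      fix s assume s: "s \<in> S"
      then have "generate G (Fs s) \<subseteq> generate G {c}" using c(3) by (intro generate_subgroup_incl[OF _ subc]) auto
      then show "s \<in> generate G {c}" using Fs[OF s] by auto
    qed
    then have "generate G S \<subseteq> generate G {c}" by (rule generate_subgroup_incl[OF _ subc])
    then obtain d where d: "d \<in> generate G S" "generate G S = generate G {d}"
      using subgroup_of_finite_cyclic[OF c(1,2) generate_is_subgroup] S by metis
    have "carrier G \<inter> S = S" using S by auto
    then have cS: "carrier (subgroup_generated G S) = generate G S" by (simp add: carrier_subgroup_generated)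
    have dG: "d \<in> carrier G" using d(1) generate_incl S by blast
    interpret S: group "subgroup_generated G S" by simp
    show "cyclic_group (subgroup_generated G S)"
      unfolding S.cyclic_group
    proof (rule bexI)
      show "d \<in> carrier (subgroup_generated G S)" using d cS by simp
      then show "carrier (subgroup_generated G S) = range (\<lambda>n::int. d [^]\<^bsub>subgroup_generated G S\<^esub> n)"
        using cS d generate_pow[OF dG] by (auto simp: int_pow_subgroup_generated)
    qed
  qed
qed

text \<open>
  Both elements lie in one cyclic group, say \<open>x = c ^ a\<close> and \<open>y = c ^ b\<close>. If \<open>c\<close> has order \<open>m\<close>, then \<open>q\<close> divides
  \<open>m\<close> and both \<open>a\<close> and \<open>b\<close> are multiples of \<open>m / q\<close>, the second quotient being prime to \<open>q\<close>. So a
  multiple of \<open>b\<close> cancels \<open>a\<close> modulo \<open>m\<close>. An element \<open>c\<close> of infinite order, for which \<open>m = 0\<close>,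
  is excluded by \<open>y\<close> being nontrivial of finite order.
\<close>

lemma locally_cyclic_prime_roots:
  assumes lc: "locally_cyclic G" and q: "prime (q::nat)"
    and x: "x \<in> carrier G" "x [^] q = \<one>" and y: "y \<in> carrier G" "y [^] q = \<one>" "y \<noteq> \<one>"
  shows "\<exists>j::nat. x \<otimes> y [^] j = \<one>"
proof -
  interpret S: group "subgroup_generated G {x, y}" by simp
  have "cyclic_group (subgroup_generated G {x, y})" using lc x y by (simp add: locally_cyclic_def)
  then obtain c where c: "c \<in> carrier (subgroup_generated G {x, y})"
    "carrier (subgroup_generated G {x, y}) = range (\<lambda>n::int. c [^]\<^bsub>subgroup_generated G {x, y}\<^esub> n)"
    unfolding S.cyclic_group by blast
  have cG: "c \<in> carrier G" using c(1) carrier_subgroup_generated_subset by blast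
  have mem: "x \<in> carrier (subgroup_generated G {x, y})" "y \<in> carrier (subgroup_generated G {x, y})"
    using x y by (simp_all add: carrier_subgroup_generated generate.incl)
  have "carrier (subgroup_generated G {x, y}) = range (\<lambda>n::int. c [^] n)"
    unfolding c(2) int_pow_subgroup_generated[OF c(1)] ..
  then obtain a b :: int where ab: "x = c [^] a" "y = c [^] b"
    using mem by blast
  define m where "m = int (ord c)"
  have m: "c [^] i = \<one> \<longleftrightarrow> m dvd i" for i :: int using int_pow_eq_id[OF cG] by (simp add: m_def)
  have aq: "m dvd a * int q" and bq: "m dvd b * int q"
    using x y cG ab m by (simp_all add: int_pow_pow flip: int_pow_int)
  have nb: "\<not> m dvd b" using y(3) ab m by simp
  have qp: "prime (int q)" using q by simp
  have "int q dvd m"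
  proof (rule ccontr)
    assume "\<not> int q dvd m"
    then have "coprime m (int q)" using prime_imp_coprime[OF qp] coprime_commute by blast
    then show False using bq nb by (simp add: coprime_dvd_mult_left_iff)
  qed
  then obtain m' where m': "m = int q * m'" by auto
  have q0: "int q \<noteq> 0" using prime_gt_0_nat[OF q] by simp
  obtain a' where a': "a = m' * a'" using aq q0 unfolding m' by (auto simp: mult.commute[of a])
  obtain b' where b': "b = m' * b'" using bq q0 unfolding m' by (auto simp: mult.commute[of b])
  have "\<not> int q dvd b'" using nb unfolding m' b' by (auto simp: mult.commute)
  then have "coprime (int q) b'" by (rule prime_imp_coprime[OF qp])
  then obtain s t where st: "s * int q + t * b' = 1" by (metis bezout_int coprime_iff_gcd_eq_1 mult.commute)
  define j where "j = nat ((- t * a') mod int q)"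
  have j: "int j = (- t * a') mod int q" using q0 by (simp add: j_def)
  have "int q dvd a' + b' * int j"
  proof -
    have "(a' + b' * int j) mod int q = (a' + b' * (- t * a')) mod int q"
      unfolding j by (metis mod_add_right_eq mod_mult_right_eq)
    also have "a' + b' * (- t * a') = a' * (1 - t * b')" by (simp add: algebra_simps)
    also have "1 - t * b' = s * int q" using st by simp
    finally show ?thesis by (simp add: mod_eq_0_iff_dvd)
  qed
  then have "m' * int q dvd m' * (a' + b' * int j)" by (rule mult_dvd_mono[OF dvd_refl])
  then have "m dvd a + b * int j" unfolding m' a' b' by (simp add: algebra_simps)
  then have "c [^] (a + b * int j) = \<one>" using m by blast
  moreover have "c [^] (a + b * int j) = x \<otimes> y [^] j"
    using cG by (simp add: ab int_pow_mult int_pow_pow flip: int_pow_int)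
  ultimately show ?thesis by auto
qed

end

lemma (in comm_group) Mod_simps:
  assumes C: "subgroup C G"
  shows "comm_group (G Mod C)" "carrier (G Mod C) = (\<lambda>x. C #> x) ` carrier G"
    "\<And>x (n::nat). x \<in> carrier G \<Longrightarrow> (C #> x) [^]\<^bsub>G Mod C\<^esub> n = C #> x [^] n"
    "\<And>x y. x \<in> carrier G \<Longrightarrow> y \<in> carrier G \<Longrightarrow> (C #> x) \<otimes>\<^bsub>G Mod C\<^esub> (C #> y) = C #> (x \<otimes> y)"
    "\<And>x. x \<in> carrier G \<Longrightarrow> C #> x = \<one>\<^bsub>G Mod C\<^esub> \<longleftrightarrow> x \<in> C"
proof -
  have N: "C \<lhd> G" using C by (simp add: normal_iff_subgroup)
  show "comm_group (G Mod C)" by (rule abelian_FactGroup[OF C])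
  show "carrier (G Mod C) = (\<lambda>x. C #> x) ` carrier G" by (rule carrier_FactGroup)
  show "(C #> x) [^]\<^bsub>G Mod C\<^esub> n = C #> x [^] n" if "x \<in> carrier G" for x and n :: nat
    by (rule normal.FactGroup_pow[OF N that])
  show "(C #> x) \<otimes>\<^bsub>G Mod C\<^esub> (C #> y) = C #> (x \<otimes> y)" if "x \<in> carrier G" "y \<in> carrier G" for x y
    using normal.rcos_sum[OF N that] by simp
  show "C #> x = \<one>\<^bsub>G Mod C\<^esub> \<longleftrightarrow> x \<in> C" if "x \<in> carrier G" for x
    using coset_join1[OF _ that C] coset_join2[OF that C] C subgroup.subset by auto
qed

lemma (in comm_group) locally_cyclic_Mod_iff:
  assumes C: "subgroup C G" and P: "P \<subseteq> carrier G" "generate G P = carrier G"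
      "\<And>y. y \<in> P \<Longrightarrow> \<exists>q::nat. prime q \<and> y [^] q = \<one>"
  shows "locally_cyclic (G Mod C) \<longleftrightarrow> prime_torsion_cyclic G (carrier G) C"
    (is "?L \<longleftrightarrow> ?R")
proof -
  note Q = Mod_simps[OF C]
  interpret Q: comm_group "G Mod C" by (rule Q(1))
  show ?thesis
  proof
    assume L: ?L
    show ?R unfolding prime_torsion_cyclic_def
    proof (intro allI impI)
      fix q :: nat and x y
      assume *: "prime q" "x \<in> carrier G" "y \<in> carrier G" "x [^] q \<in> C" "y [^] q \<in> C" "y \<notin> C"
      have "\<exists>j::nat. (C #> x) \<otimes>\<^bsub>G Mod C\<^esub> (C #> y) [^]\<^bsub>G Mod C\<^esub> j = \<one>\<^bsub>G Mod C\<^esub>"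
        by (rule Q.locally_cyclic_prime_roots[OF L *(1)])
          (simp_all only: Q * nat_pow_closed image_eqI not_False_eq_True; use * in blast)+
      then obtain j :: nat where "(C #> x) \<otimes>\<^bsub>G Mod C\<^esub> (C #> y) [^]\<^bsub>G Mod C\<^esub> j = \<one>\<^bsub>G Mod C\<^esub>" by blast
      then have "C #> (x \<otimes> y [^] j) = \<one>\<^bsub>G Mod C\<^esub>" using * by (simp only: Q nat_pow_closed)
      then show "\<exists>j::nat. x \<otimes> y [^] j \<in> C" using * Q(5)[of "x \<otimes> y [^] j"] by auto
    qed
  next
    assume R: ?R
    interpret h: group_hom G "G Mod C" "\<lambda>x. C #> x"
      using C normal.r_coset_hom_Mod[of C G]
      by (simp add: group_hom_def group_hom_axioms_def normal_iff_subgroup)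
    show ?L
    proof (rule Q.locally_cyclicI)
      show "(\<lambda>x. C #> x) ` P \<subseteq> carrier (G Mod C)" using P(1) Q(2) by auto
      show "generate (G Mod C) ((\<lambda>x. C #> x) ` P) = carrier (G Mod C)"
        using h.generate_img[OF P(1)] P(2) Q(2) by simp
      show "\<exists>q::nat. prime q \<and> y [^]\<^bsub>G Mod C\<^esub> q = \<one>\<^bsub>G Mod C\<^esub>"
        if y: "y \<in> (\<lambda>x. C #> x) ` P" for y
      proof -
        obtain z where z: "z \<in> P" "y = C #> z" using y by auto
        obtain q :: nat where q: "prime q" "z [^] q = \<one>" using P(3)[OF z(1)] by blast
        have zG: "z \<in> carrier G" using z P by auto
        have "\<one> \<in> C" using C subgroup.one_closed by blast
        then have "y [^]\<^bsub>G Mod C\<^esub> q = \<one>\<^bsub>G Mod C\<^esub>"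
          using Q(5)[of \<one>] q z zG by (simp only: Q(3) one_closed)
        then show ?thesis using q by blast
      qed
      fix q :: nat and U V
      assume *: "prime q" "U \<in> carrier (G Mod C)" "V \<in> carrier (G Mod C)"
        "U [^]\<^bsub>G Mod C\<^esub> q = \<one>\<^bsub>G Mod C\<^esub>" "V [^]\<^bsub>G Mod C\<^esub> q = \<one>\<^bsub>G Mod C\<^esub>" "V \<noteq> \<one>\<^bsub>G Mod C\<^esub>"
      obtain x y where xy: "x \<in> carrier G" "y \<in> carrier G" "U = C #> x" "V = C #> y"
        using *(2,3) unfolding Q(2) by auto
      have "x [^] q \<in> C" "y [^] q \<in> C" "y \<notin> C"
        using *(4-6) Q(5)[of "x [^] q"] Q(5)[of "y [^] q"] Q(5)[of y] xy by (simp_all only: Q(3) nat_pow_closed) auto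
      then obtain j :: nat where "x \<otimes> y [^] j \<in> C" using R *(1) xy unfolding prime_torsion_cyclic_def by blast
      then have "U \<otimes>\<^bsub>G Mod C\<^esub> V [^]\<^bsub>G Mod C\<^esub> j = \<one>\<^bsub>G Mod C\<^esub>"
        using xy Q(5)[of "x \<otimes> y [^] j"] by (simp only: Q(3,4) nat_pow_closed m_closed)
      then show "\<exists>j::nat. U \<otimes>\<^bsub>G Mod C\<^esub> V [^]\<^bsub>G Mod C\<^esub> j = \<one>\<^bsub>G Mod C\<^esub>" by blast
    qed
  qed
qed

lemma (in group) locally_cyclic_abelian_soc_Mod_iff:
  assumes C: "subgroup C (G\<lparr>carrier := abelian_soc G\<rparr>)"
  shows "locally_cyclic ((G\<lparr>carrier := abelian_soc G\<rparr>) Mod C) \<longleftrightarrow> prime_torsion_cyclic G (abelian_soc G) C"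
proof -
  interpret A: comm_group "G\<lparr>carrier := abelian_soc G\<rparr>" by (rule abelian_soc_comm_group)
  let ?P = "\<Union>{N. abelian_minimal N}"
  have PA: "?P \<subseteq> abelian_soc G" unfolding abelian_soc_eq by (auto intro: generate.incl)
  have "generate (G\<lparr>carrier := abelian_soc G\<rparr>) ?P = generate G ?P"
    using generate_consistent[OF PA abelian_soc_subgroup] by simp
  then have "generate (G\<lparr>carrier := abelian_soc G\<rparr>) ?P = carrier (G\<lparr>carrier := abelian_soc G\<rparr>)"
    by (simp add: abelian_soc_eq)
  moreover have "\<exists>q::nat. prime q \<and> y [^]\<^bsub>G\<lparr>carrier := abelian_soc G\<rparr>\<^esub> q = \<one>\<^bsub>G\<lparr>carrier := abelian_soc G\<rparr>\<^esub>"
    if y: "y \<in> ?P" for y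
  proof -
    obtain N where N: "abelian_minimal N" "y \<in> N" using y by auto
    obtain q :: nat where "prime q" "\<And>x. x \<in> N \<Longrightarrow> x [^] q = \<one>"
      using abelian_minimal_exponent[OF N(1)] by blast
    then show ?thesis using N(2) by (intro exI[of _ q]) (simp flip: nat_pow_consistent)
  qed
  ultimately show ?thesis
    using A.locally_cyclic_Mod_iff[OF C, of ?P] PA
    by (simp add: prime_torsion_cyclic_def flip: nat_pow_consistent)
qed

section \<open>Translations of functions on the group\<close>

definition function_module :: "('k, 'n) ring_scheme \<Rightarrow> ('k, 'a \<Rightarrow> 'k) module" where
  "function_module K = \<lparr>carrier = {f. \<forall>a. f a \<in> carrier K}, monoid.mult = undefined, one = undefined,
     ring.zero = (\<lambda>_. \<zero>\<^bsub>K\<^esub>), add = (\<lambda>f h a. f a \<oplus>\<^bsub>K\<^esub> h a), smult = (\<lambda>c f a. c \<otimes>\<^bsub>K\<^esub> f a)\<rparr>"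

lemma function_module_simps [simp]:
  "carrier (function_module K) = {f. \<forall>a. f a \<in> carrier K}"
  "\<zero>\<^bsub>function_module K\<^esub> = (\<lambda>_. \<zero>\<^bsub>K\<^esub>)"
  "f \<oplus>\<^bsub>function_module K\<^esub> h = (\<lambda>a. f a \<oplus>\<^bsub>K\<^esub> h a)"
  "c \<odot>\<^bsub>function_module K\<^esub> f = (\<lambda>a. c \<otimes>\<^bsub>K\<^esub> f a)"
  by (simp_all add: function_module_def)

lemma function_module_module:
  assumes "cring K"
  shows "module K (function_module K)"
proof -
  interpret cring K by (rule assms)
  have "abelian_group (function_module K)"
  proof (rule abelian_groupI)
    fix f assume f: "f \<in> carrier (function_module K)"
    show "\<exists>h\<in>carrier (function_module K). h \<oplus>\<^bsub>function_module K\<^esub> f = \<zero>\<^bsub>function_module K\<^esub>"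
      by (rule bexI[of _ "\<lambda>a. \<ominus>\<^bsub>K\<^esub> f a"]) (use f in \<open>auto simp: l_neg\<close>)
  qed (auto simp: a_ac)
  then show ?thesis
    by (rule moduleI[OF assms]) (auto simp: l_distr r_distr m_assoc)
qed

text \<open>
  The regular representation on functions, one copy for each index \<open>i\<close>. The indices serve to
  collect infinitely many functions on \<open>G\<close> in one vector. Arguments outside the
  carrier are left alone.
\<close>

definition translate :: "('g, 'm) monoid_scheme \<Rightarrow> 'g \<Rightarrow> ('i \<times> 'g \<Rightarrow> 'k) \<Rightarrow> ('i \<times> 'g \<Rightarrow> 'k)" where
  "translate G g f = (\<lambda>(i, h). if h \<in> carrier G then f (i, inv\<^bsub>G\<^esub> g \<otimes>\<^bsub>G\<^esub> h) else f (i, h))"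

definition translation_rep ::
    "('g, 'm) monoid_scheme \<Rightarrow> ('k, 'n) ring_scheme \<Rightarrow> 'g \<Rightarrow> ('i \<times> 'g \<Rightarrow> 'k) \<Rightarrow> ('i \<times> 'g \<Rightarrow> 'k)" where
  "translation_rep G K g = restrict (translate G g) (carrier (function_module K))"

lemma translation_representation:
  assumes "group G" "cring K"
  shows "representation G K (function_module K) (translation_rep G K)"
proof -
  interpret group G by (rule assms(1))
  show ?thesis unfolding translation_rep_def
    by (rule representationI[OF assms(1) function_module_module[OF assms(2)]])
      (auto simp: translate_def fun_eq_iff inv_mult_group m_assoc)
qed

lemma function_module_minus:
  assumes "cring K" and f: "\<And>p. f p \<in> carrier K" and h: "\<And>p. h p \<in> carrier K"
  shows "(f \<ominus>\<^bsub>function_module K\<^esub> h) p = f p \<ominus>\<^bsub>K\<^esub> h p"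
proof -
  interpret cring K by (rule assms(1))
  interpret M: module K "function_module K" by (rule function_module_module[OF assms(1)])
  have "\<ominus>\<^bsub>function_module K\<^esub> h = (\<lambda>p. \<ominus>\<^bsub>K\<^esub> h p)"
    by (rule M.minus_equality) (use h in \<open>auto simp: l_neg\<close>)
  then show ?thesis by (simp add: a_minus_def)
qed

locale group_over_field = G: group G + K: field K
  for G :: "('g, 'm) monoid_scheme" (structure) and K :: "('k, 'n) ring_scheme"
begin

abbreviation V :: "('k, 'i \<times> 'g \<Rightarrow> 'k) module" where "V \<equiv> function_module K"
abbreviation tr :: "'g \<Rightarrow> ('i \<times> 'g \<Rightarrow> 'k) \<Rightarrow> ('i \<times> 'g \<Rightarrow> 'k)" where "tr \<equiv> translation_rep G K"

sublocale T: representation G K V tr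
  by (rule translation_representation) (rule G.is_group K.is_cring)+

lemma tr_apply:
  assumes "f \<in> carrier V" "h \<in> carrier G"
  shows "tr g f (i, h) = f (i, inv g \<otimes> h)"
  using assms by (simp add: translation_rep_def translate_def)

lemma tr_apply_outside:
  assumes "f \<in> carrier V" "h \<notin> carrier G"
  shows "tr g f (i, h) = f (i, h)"
  using assms by (simp add: translation_rep_def translate_def)

lemma tr_slice:
  assumes "f \<in> carrier V" "f' \<in> carrier V" "\<And>h. f (i, h) = f' (i, h)"
  shows "tr g f (i, h) = tr g f' (i, h)"
  using assms by (simp add: translation_rep_def translate_def)

lemma cyc_sum_slice:
  assumes f: "f \<in> carrier V" "f' \<in> carrier V" "\<And>h. f (i, h) = f' (i, h)" and d: "d \<in> carrier G"
  shows "T.cyc_sum n d f (i, h) = T.cyc_sum n d f' (i, h)"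
proof (induction n)
  case (Suc n)
  show ?case
    unfolding T.cyc_sum_Suc[OF d f(1)] T.cyc_sum_Suc[OF d f(2)]
    using Suc tr_slice[OF f] by simp
qed simp

section \<open>Functions killed by prescribed norm elements\<close>

text \<open>
  Every slice is required to be nonzero so that the functions constructed here can be used
  at an index that is only chosen afterwards.
\<close>

definition slicewise_nonzero :: "'g set \<Rightarrow> ('i \<times> 'g \<Rightarrow> 'k) \<Rightarrow> bool" where
  "slicewise_nonzero S z \<longleftrightarrow> z \<in> carrier V \<and> (\<forall>i h. z (i, h) \<noteq> \<zero>\<^bsub>K\<^esub> \<longrightarrow> h \<in> S) \<and> (\<forall>i. \<exists>h. z (i, h) \<noteq> \<zero>\<^bsub>K\<^esub>)"

text \<open>
  Multiplication by \<open>1 - y\<close> does not kill a function supported on \<open>S\<close>, because the translate by \<open>y\<close> has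
  support in the coset of \<open>y\<close>, which is disjoint from \<open>S\<close>.
\<close>

lemma slicewise_nonzero_step:
  assumes z: "slicewise_nonzero S z" and S: "subgroup S G" and S': "subgroup S' G" "S \<subseteq> S'"
    and y: "y \<in> S'" "y \<notin> S"
  shows "slicewise_nonzero S' (z \<ominus>\<^bsub>V\<^esub> tr y z)"
proof -
  have zV: "z \<in> carrier V" and zS: "\<And>i h. z (i, h) \<noteq> \<zero>\<^bsub>K\<^esub> \<Longrightarrow> h \<in> S" and zn: "\<And>i. \<exists>h. z (i, h) \<noteq> \<zero>\<^bsub>K\<^esub>"
    using z by (auto simp: slicewise_nonzero_def)
  have yG: "y \<in> carrier G" using y S' subgroup.mem_carrier by metis
  have SG: "\<And>h. h \<in> S \<Longrightarrow> h \<in> carrier G" using S subgroup.mem_carrier by metis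
  have tV: "tr y z \<in> carrier V" by (rule T.act_closed[OF yG zV])
  have ap: "(z \<ominus>\<^bsub>V\<^esub> tr y z) p = z p \<ominus>\<^bsub>K\<^esub> tr y z p" for p
    by (rule function_module_minus[OF K.is_cring]) (use zV tV in auto)
  have tS: "inv y \<otimes> h \<in> S \<and> h \<in> carrier G" if "tr y z (i, h) \<noteq> \<zero>\<^bsub>K\<^esub>" for i h
  proof (cases "h \<in> carrier G")
    case True then show ?thesis using that zS tr_apply[OF zV True] by metis
  next
    case False then show ?thesis using that zS SG tr_apply_outside[OF zV False] by metis
  qed
  have "h \<in> S'" if nz: "(z \<ominus>\<^bsub>V\<^esub> tr y z) (i, h) \<noteq> \<zero>\<^bsub>K\<^esub>" for i h
  proof (cases "z (i, h) = \<zero>\<^bsub>K\<^esub>")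
    case True
    then have "tr y z (i, h) \<noteq> \<zero>\<^bsub>K\<^esub>" using nz unfolding ap by (auto simp: a_minus_def)
    then have h: "inv y \<otimes> h \<in> S'" "h \<in> carrier G" using tS S' by blast+
    then have "y \<otimes> (inv y \<otimes> h) \<in> S'" using y S' subgroup.m_closed by metis
    then show ?thesis using yG h by (simp add: G.cancel_simps)
  next
    case False then show ?thesis using zS S' by blast
  qed
  moreover have "\<exists>h. (z \<ominus>\<^bsub>V\<^esub> tr y z) (i, h) \<noteq> \<zero>\<^bsub>K\<^esub>" for i
  proof -
    obtain h where h: "z (i, h) \<noteq> \<zero>\<^bsub>K\<^esub>" using zn by blast
    have hS: "h \<in> S" using zS h by blast
    have "tr y z (i, h) = \<zero>\<^bsub>K\<^esub>"
    proof (rule ccontr)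
      assume "tr y z (i, h) \<noteq> \<zero>\<^bsub>K\<^esub>"
      then have "inv y \<otimes> h \<in> S" using tS by blast
      then have "h \<otimes> inv (inv y \<otimes> h) \<in> S" using hS S by (simp add: subgroup.m_closed subgroup.m_inv_closed)
      then show False using y yG SG[OF hS] by (simp add: G.inv_mult_group G.cancel_simps)
    qed
    then have "(z \<ominus>\<^bsub>V\<^esub> tr y z) (i, h) = z (i, h)" unfolding ap using zV by (simp add: a_minus_def)
    then show ?thesis using h by metis
  qed
  moreover have "z \<ominus>\<^bsub>V\<^esub> tr y z \<in> carrier V" using zV tV by (rule T.M.minus_closed)
  ultimately show ?thesis by (auto simp: slicewise_nonzero_def)
qed

lemma cyc_sum_fixed:
  assumes d: "d \<in> carrier G" and f: "f \<in> carrier V" and n: "d [^] (n::nat) = \<one>"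
  shows "tr (d [^] (j::nat)) (T.cyc_sum n d f) = T.cyc_sum n d f"
proof (induction j)
  case 0 then show ?case using T.act_one[OF T.cyc_sum_closed[OF d f]] by simp
next
  case (Suc j)
  have "tr d (T.cyc_sum n d f) \<ominus>\<^bsub>V\<^esub> T.cyc_sum n d f = \<zero>\<^bsub>V\<^esub>"
    using T.cyc_sum_diff[OF d f, of n] n T.act_one[OF f] T.minus_zero_eq[OF f] by simp
  then have "tr d (T.cyc_sum n d f) = T.cyc_sum n d f"
    using T.minus_eq_zero_iff[OF T.act_closed[OF d T.cyc_sum_closed[OF d f]] T.cyc_sum_closed[OF d f]] by blast
  then show ?case
    using Suc T.act_mult[OF T.pow_carrier[OF d] d T.cyc_sum_closed[OF d f]] by simp
qed

lemma cyc_sum_difference_zero: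
  assumes d: "d \<in> carrier G" and y: "y \<in> carrier G" and f: "f \<in> carrier V"
    and c: "y \<otimes> d = d \<otimes> y" and k: "T.cyc_sum n d f = \<zero>\<^bsub>V\<^esub>"
  shows "T.cyc_sum n d (f \<ominus>\<^bsub>V\<^esub> tr y f) = \<zero>\<^bsub>V\<^esub>"
proof -
  have "T.cyc_sum n d (tr y f) = tr y (T.cyc_sum n d f)"
    by (rule T.act_cyc_sum_commute[OF y d f c, symmetric])
  also have "\<dots> = \<zero>\<^bsub>V\<^esub>" unfolding k by (rule T.act_zero[OF y])
  finally show ?thesis
    using T.cyc_sum_minus[OF d f T.act_closed[OF y f], of n] k T.minus_zero_eq[OF T.M.zero_closed] by metis
qed

text \<open>
  The norm element of \<open>d\<close> absorbs powers of \<open>d\<close>, and \<open>y\<close> acts on \<open>f\<close> as the inverse of \<open>d ^ j\<close>. So applying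
  it to \<open>f\<close> and to the translate of \<open>f\<close> by \<open>y\<close> gives the same result.
\<close>

lemma cyc_sum_difference_new:
  assumes d: "d \<in> carrier G" and y: "y \<in> carrier G" and f: "f \<in> carrier V"
    and n: "d [^] (n::nat) = \<one>" and c: "y \<otimes> d = d \<otimes> y"
    and fixed: "tr (y \<otimes> d [^] (j::nat)) f = f"
  shows "T.cyc_sum n d (f \<ominus>\<^bsub>V\<^esub> tr y f) = \<zero>\<^bsub>V\<^esub>"
proof -
  let ?e = "d [^] j"
  have e: "?e \<in> carrier G" by (rule T.pow_carrier[OF d])
  have ye: "y \<otimes> ?e = ?e \<otimes> y" using G.group_commutes_pow[OF c[symmetric] d y] by simp
  have ed: "?e \<otimes> d = d \<otimes> ?e" using G.group_commutes_pow[OF refl d d] by simp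
  have yf: "tr y f \<in> carrier V" by (rule T.act_closed[OF y f])
  have "T.cyc_sum n d (tr y f) = tr ?e (T.cyc_sum n d (tr y f))"
    by (rule cyc_sum_fixed[OF d yf n, symmetric])
  also have "\<dots> = T.cyc_sum n d (tr ?e (tr y f))" by (rule T.act_cyc_sum_commute[OF e d yf ed])
  also have "tr ?e (tr y f) = f" using fixed T.act_mult[OF e y f] ye by simp
  finally have "T.cyc_sum n d (tr y f) = T.cyc_sum n d f" .
  then show ?thesis
    using T.cyc_sum_minus[OF d f yf, of n] T.minus_zero_eq[OF T.cyc_sum_closed[OF d f]] by metis
qed

abbreviation prime_norms_kill :: "'g set \<Rightarrow> 'g set \<Rightarrow> nat set \<Rightarrow> ('i \<times> 'g \<Rightarrow> 'k) \<Rightarrow> bool" where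
  "prime_norms_kill A C Q z \<equiv> \<forall>q\<in>Q. \<forall>n d. d \<in> A \<longrightarrow> d \<notin> C \<longrightarrow> d [^] q \<in> C \<longrightarrow>
     d [^] (n::nat) = \<one> \<longrightarrow> T.cyc_sum n d z = \<zero>\<^bsub>V\<^esub>"

text \<open>
  Start with the indicator function of \<open>C\<close>. For each \<open>q \<in> Q\<close> multiply by \<open>1 - y\<close>, where \<open>y \<in> A\<close> is
  any element of order \<open>q\<close> modulo \<open>C\<close> (if there is one). Such a \<open>y\<close> lies outside the elements whose order modulo \<open>C\<close>
  divides the product of the earlier primes, so the function stays nonzero. As the \<open>q\<close>-torsion of
  \<open>A / C\<close> is cyclic, \<open>y\<close> is modulo \<open>C\<close> a power of every \<open>d\<close> of order \<open>q\<close> modulo \<open>C\<close>, and the function is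
  \<open>C\<close>-invariant; hence the one factor takes care of all these \<open>d\<close> simultaneously.
\<close>

lemma abelian_part_witness:
  assumes A: "subgroup A G" "\<forall>x\<in>A. \<forall>y\<in>A. x \<otimes> y = y \<otimes> x"
    and C: "subgroup C G" "C \<subseteq> A"
    and cocyc: "prime_torsion_cyclic G A C"
    and Q: "finite Q" "\<And>q. q \<in> Q \<Longrightarrow> prime (q::nat)"
  shows "\<exists>z :: 'i \<times> 'g \<Rightarrow> 'k. slicewise_nonzero {h \<in> A. h [^] (\<Prod>Q) \<in> C} z \<and> (\<forall>c\<in>C. tr c z = z) \<and>
    prime_norms_kill A C Q z"
  using Q
proof (induction Q)
  case empty
  have CG: "\<And>c. c \<in> C \<Longrightarrow> c \<in> carrier G" using C subgroup.mem_carrier by metis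
  define z where "z = (\<lambda>(i::'i, h). if h \<in> C then \<one>\<^bsub>K\<^esub> else \<zero>\<^bsub>K\<^esub>)"
  have zV: "z \<in> carrier V" by (auto simp: z_def)
  have "slicewise_nonzero {h \<in> A. h [^] (\<Prod>{} :: nat) \<in> C} z"
    using zV C CG subgroup.one_closed[OF C(1)] by (auto simp: slicewise_nonzero_def z_def intro!: exI[of _ "\<one>"] split: if_splits)
  moreover have "tr c z = z" if c: "c \<in> C" for c
  proof
    fix p show "tr c z p = z p"
    proof (cases p)
      case (Pair i h)
      have cG: "c \<in> carrier G" using c CG by blast
      show ?thesis
      proof (cases "h \<in> carrier G")
        case True
        have "inv c \<otimes> h \<in> C \<longleftrightarrow> h \<in> C"
        proof
          assume "inv c \<otimes> h \<in> C"
          then have "c \<otimes> (inv c \<otimes> h) \<in> C" using c C subgroup.m_closed by metis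
          then show "h \<in> C" using cG True by (simp add: G.cancel_simps)
        qed (use c C in \<open>simp add: subgroup.m_closed subgroup.m_inv_closed\<close>)
        then show ?thesis using Pair tr_apply[OF zV True] by (simp add: z_def)
      next
        case False then show ?thesis using Pair tr_apply_outside[OF zV False] by simp
      qed
    qed
  qed
  ultimately show ?case by blast
next
  case (insert q Q)
  let ?N = "\<Prod>Q" and ?S = "{h \<in> A. h [^] (\<Prod>Q) \<in> C}" and ?S' = "{h \<in> A. h [^] (\<Prod>(insert q Q)) \<in> C}"
  have q: "prime q" and Qp: "\<And>p. p \<in> Q \<Longrightarrow> prime p" using insert.prems by auto
  have AG: "\<And>x. x \<in> A \<Longrightarrow> x \<in> carrier G" using A subgroup.mem_carrier by metis
  have sub: "subgroup {h \<in> A. h [^] (m::nat) \<in> C} G" for m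
    by (rule G.power_preimage_subgroup[OF A(1) _ C(1)]) (use A(2) in blast)
  have prodq: "\<Prod>(insert q Q) = q * ?N" using insert.hyps by simp
  have SS': "?S \<subseteq> ?S'"
  proof
    fix h assume h: "h \<in> ?S"
    then have "h [^] (q * ?N) = (h [^] ?N) [^] q" using AG by (simp add: G.nat_pow_pow mult.commute)
    then show "h \<in> ?S'" unfolding prodq using h G.pow_in_subgroup[OF C(1)] by simp
  qed
  obtain z :: "'i \<times> 'g \<Rightarrow> 'k" where z: "slicewise_nonzero ?S z" "\<forall>c\<in>C. tr c z = z"
    "prime_norms_kill A C Q z"
    using insert.IH Qp by blast
  have zV: "z \<in> carrier V" using z(1) unfolding slicewise_nonzero_def by (elim conjE)
  show ?case
  proof (cases "\<exists>y. y \<in> A \<and> y \<notin> C \<and> y [^] q \<in> C")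
    case False
    have "slicewise_nonzero ?S' z" using z(1) SS' unfolding slicewise_nonzero_def by blast
    then show ?thesis using z False by blast
  next
    case True
    then obtain y where y: "y \<in> A" "y \<notin> C" "y [^] q \<in> C" by blast
    have yG: "y \<in> carrier G" using y AG by blast
    have yS: "y \<notin> ?S"
    proof
      assume "y \<in> ?S"
      then have "y [^] ?N \<in> C" by simp
      moreover have "coprime q ?N"
        by (rule prod_coprime_right) (use q Qp insert.hyps in \<open>auto intro: primes_coprime\<close>)
      ultimately show False using G.subgroup_coprime_powers[OF C(1) yG y(3)] y(2) by blast
    qed
    have "y [^] (q * ?N) = (y [^] q) [^] ?N" using yG by (simp add: G.nat_pow_pow)
    then have yS': "y \<in> ?S'" unfolding prodq using y G.pow_in_subgroup[OF C(1)] by simp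
    let ?z = "z \<ominus>\<^bsub>V\<^esub> tr y z"
    have "slicewise_nonzero ?S' ?z" by (rule slicewise_nonzero_step[OF z(1) sub sub SS' yS' yS])
    moreover have "tr c ?z = ?z" if c: "c \<in> C" for c
    proof -
      have cA: "c \<in> A" and cG: "c \<in> carrier G" using c C AG by auto
      have "tr c (tr y z) = tr y (tr c z)"
        using T.act_mult[OF cG yG zV] T.act_mult[OF yG cG zV] bspec[OF bspec[OF A(2) cA] y(1)] by simp
      then show ?thesis using T.act_minus[OF cG zV T.act_closed[OF yG zV]] z(2) c by simp
    qed
    moreover have "T.cyc_sum n d ?z = \<zero>\<^bsub>V\<^esub>"
      if p: "p \<in> insert q Q" and d: "d \<in> A" "d \<notin> C" "d [^] p \<in> C" "d [^] n = \<one>" for p n :: nat and d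
    proof (cases "p \<in> Q")
      case True
      then have "T.cyc_sum n d z = \<zero>\<^bsub>V\<^esub>" using z(3) d by blast
      then show ?thesis by (rule cyc_sum_difference_zero[OF AG[OF d(1)] yG zV bspec[OF bspec[OF A(2) y(1)] d(1)]])
    next
      case False
      then have "p = q" using p by simp
      then obtain j :: nat where "y \<otimes> d [^] j \<in> C" using cocyc q y(1,3) d(1-3) unfolding prime_torsion_cyclic_def by blast
      then have "tr (y \<otimes> d [^] j) z = z" using z(2) by blast
      then show ?thesis by (rule cyc_sum_difference_new[OF AG[OF d(1)] yG zV d(4) bspec[OF bspec[OF A(2) y(1)] d(1)]])
    qed
    ultimately show ?thesis by blast
  qed
qed

text \<open>
  Multiply the function from \<open>abelian_part_witness\<close> by \<open>1 - w M\<close> for each \<open>M \<in> \<M>\<close>. By \<open>nonabelian_family_disjoint\<close>, \<open>w M\<close> lies outside the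
  subgroup generated by the abelian socle and the other members of \<open>\<M>\<close>, and it commutes with that subgroup.
\<close>

lemma socle_witness:
  assumes C: "subgroup C G" "C \<subseteq> abelian_soc G"
    and cocyc: "prime_torsion_cyclic G (abelian_soc G) C"
    and Q: "finite Q" "\<And>q. q \<in> Q \<Longrightarrow> prime (q::nat)"
    and M: "finite \<M>" "\<And>M. M \<in> \<M> \<Longrightarrow> G.nonabelian_minimal M"
    and w: "\<And>M. G.nonabelian_minimal M \<Longrightarrow> w M \<in> M \<and> w M \<noteq> \<one>"
  shows "\<exists>z :: 'i \<times> 'g \<Rightarrow> 'k. slicewise_nonzero (generate G (abelian_soc G \<union> \<Union>\<M>)) z \<and>
    prime_norms_kill (abelian_soc G) C Q z \<and>
    (\<forall>M\<in>\<M>. \<forall>n::nat. w M [^] n = \<one> \<longrightarrow> T.cyc_sum n (w M) z = \<zero>\<^bsub>V\<^esub>)"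
  using M
proof (induction \<M>)
  case empty
  obtain z :: "'i \<times> 'g \<Rightarrow> 'k" where z: "slicewise_nonzero {h \<in> abelian_soc G. h [^] (\<Prod>Q) \<in> C} z"
    "prime_norms_kill (abelian_soc G) C Q z"
    using abelian_part_witness[OF G.abelian_soc_subgroup _ C cocyc Q] G.abelian_soc_commute by blast
  have "slicewise_nonzero (generate G (abelian_soc G \<union> \<Union>{})) z"
    using z(1) unfolding slicewise_nonzero_def by (auto intro: generate.incl)
  then show ?case using z(2) by blast
next
  case (insert M \<M>)
  have MM: "\<And>N. N \<in> \<M> \<Longrightarrow> G.nonabelian_minimal N" and M: "G.nonabelian_minimal M" using insert.prems by auto
  let ?S = "generate G (abelian_soc G \<union> \<Union>\<M>)" and ?S' = "generate G (abelian_soc G \<union> \<Union>(insert M \<M>))"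
  obtain z :: "'i \<times> 'g \<Rightarrow> 'k" where z: "slicewise_nonzero ?S z"
    "prime_norms_kill (abelian_soc G) C Q z"
    "\<forall>M\<in>\<M>. \<forall>n::nat. w M [^] n = \<one> \<longrightarrow> T.cyc_sum n (w M) z = \<zero>\<^bsub>V\<^esub>"
    using insert.IH MM by blast
  have zV: "z \<in> carrier V" using z(1) unfolding slicewise_nonzero_def by (elim conjE)
  let ?y = "w M"
  have y: "?y \<in> M" "?y \<noteq> \<one>" using w[OF M] by auto
  have yG: "?y \<in> carrier G" using G.nonabelian_minimal_carrier[OF M y(1)] .
  have yS: "?y \<notin> ?S" using G.nonabelian_family_disjoint[OF MM M insert.hyps(2) _ y(1)] y(2) by blast
  have yS': "?y \<in> ?S'" using y(1) by (auto intro: generate.incl)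
  have SS': "?S \<subseteq> ?S'" by (rule G.mono_generate) auto
  have comm: "?y \<otimes> d = d \<otimes> ?y" if "d \<in> ?S" for d
    using G.commute_nonabelian_family[OF MM M insert.hyps(2) that y(1)] by simp
  let ?z = "z \<ominus>\<^bsub>V\<^esub> tr ?y z"
  have "slicewise_nonzero ?S' ?z"
  proof (rule slicewise_nonzero_step[OF z(1) _ _ SS' yS' yS])
    show "subgroup ?S G" by (rule G.generate_nonabelian_family_subgroup) (rule MM)
    show "subgroup ?S' G" by (rule G.generate_nonabelian_family_subgroup) (rule insert.prems)
  qed
  moreover have "T.cyc_sum n d ?z = \<zero>\<^bsub>V\<^esub>" if d: "d \<in> ?S" "T.cyc_sum n d z = \<zero>\<^bsub>V\<^esub>" for n d
  proof -
    have "d \<in> carrier G"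
      using d(1) subgroup.mem_carrier[OF G.generate_nonabelian_family_subgroup[OF MM]] by blast
    then show ?thesis using cyc_sum_difference_zero[OF _ yG zV comm[OF d(1)] d(2)] by blast
  qed
  moreover have "d \<in> ?S" if "d \<in> abelian_soc G" for d using that by (auto intro: generate.incl)
  moreover have "w N \<in> ?S" if "N \<in> \<M>" for N using that w[OF MM[OF that]] by (auto intro: generate.incl)
  moreover have "T.cyc_sum n ?y ?z = \<zero>\<^bsub>V\<^esub>" if n: "?y [^] n = \<one>" for n :: nat
  proof (cases "n = 0")
    case False
    then have "?y \<otimes> ?y [^] (n - 1) = \<one>"
      using n yG G.group_commutes_pow[OF refl yG yG, of "n - 1"] by (metis G.nat_pow_Suc Suc_diff_1 bot_nat_0.not_eq_extremum)
    then have "tr (?y \<otimes> ?y [^] (n - 1)) z = z" using T.act_one[OF zV] by simp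
    then show ?thesis by (rule cyc_sum_difference_new[OF yG yG zV n refl])
  qed simp
  ultimately show ?case using z(2,3) by (intro exI[of _ ?z]) blast
qed

end

section \<open>Construction of a faithful irreducible representation\<close>

text \<open>
  Otherwise the characteristic \<open>p\<close> divides the order of every nontrivial element of \<open>M\<close>. Then \<open>p\<close> is a
  prime and \<open>M\<close> is a \<open>p\<close>-group, since the \<open>p\<close>-part of the order annihilates each element.
\<close>

lemma (in group) nonabelian_minimal_witness:
  assumes lf: "locally_finite G" and K: "field K" and p: "ring_char K \<notin> normal_primes G"
    and M: "nonabelian_minimal M"
  shows "\<exists>x. x \<in> M \<and> x \<noteq> \<one> \<and> (\<exists>n::nat. x [^] n = \<one> \<and> nonzero_in K n)"
proof (rule ccontr)
  assume no: "\<not> ?thesis"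
  have mM: "minimal_normal M G" using M by (simp add: nonabelian_minimal_def)
  have MG: "M \<lhd> G" "M \<noteq> {\<one>}" and sM: "subgroup M G" using mM by (auto simp: minimal_normal_def normal_imp_subgroup)
  let ?p = "ring_char K"
  have Mp: "?p dvd ord x" if x: "x \<in> M" "x \<noteq> \<one>" for x
    using no x minimal_normal_carrier[OF mM x(1)] ring_char_eq_0_iff[OF K] by (metis pow_ord_eq_1)
  obtain x where x: "x \<in> M" "x \<in> carrier G" "x \<noteq> \<one>" using minimal_normal_nontrivial[OF mM] .
  have "?p \<noteq> 0" using Mp[OF x(1,3)] locally_finite_torsion[OF lf x(2)] by (metis dvd_0_left less_not_refl)
  then have pp: "prime ?p" by (rule ring_char_prime[OF K])
  have "\<exists>n. ord y = ?p ^ n" if y: "y \<in> M" for y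
  proof -
    have yG: "y \<in> carrier G" using minimal_normal_carrier[OF mM y] .
    have o: "ord y \<noteq> 0" using locally_finite_torsion[OF lf yG] by simp
    obtain m where m: "ord y = ?p ^ multiplicity ?p (ord y) * m" "\<not> ?p dvd m"
      using multiplicity_decompose'[OF o, of ?p] pp not_prime_unit by metis
    let ?z = "y [^] (?p ^ multiplicity ?p (ord y))"
    have zM: "?z \<in> M" using pow_in_subgroup[OF sM y] .
    have zm: "?z [^] m = \<one>" using yG m pow_ord_eq_1[OF yG] by (simp add: nat_pow_pow)
    have "?z = \<one>"
    proof (rule ccontr)
      assume "?z \<noteq> \<one>"
      then have "?p dvd ord ?z" using Mp zM by blast
      moreover have "ord ?z dvd m" using zm yG pow_eq_id by simp
      ultimately show False using m(2) dvd_trans by blast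
    qed
    then have "ord y dvd ?p ^ multiplicity ?p (ord y)" using pow_eq_id[OF yG] by simp
    then show ?thesis using divides_primepow_nat[OF pp] by blast
  qed
  then have "p_group ?p (G\<lparr>carrier := M\<rparr>)"
    using ord_subgroup[OF sM] subgroup_imp_group[OF sM] by (simp add: p_group_def)
  then show False using p pp MG by (auto simp: normal_primes_def)
qed

text \<open>
  \<open>L\<close> collects the pairs \<open>(n, d)\<close> whose norm element is to kill the vector. Every finite \<open>F \<subseteq> L\<close> has a
  nonzero function \<open>zs F\<close> killed by its norm elements. These functions form a single vector \<open>z\<close>
  with the \<open>F\<close>-th slice given by \<open>zs F\<close>. Modulo the subrepresentation \<open>J0\<close> of functions whose
  slices vanish for all large \<open>F\<close>, the vector \<open>z\<close> is nonzero and is killed by the norm elements of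
  all of \<open>L\<close>. In an irreducible section above \<open>J0\<close> with \<open>z\<close> nonzero, no \<open>d\<close> occurring in \<open>L\<close> is in the kernel:
  its norm element would act on the class of \<open>z\<close> both as \<open>0\<close> and as the nonzero scalar \<open>n\<close>.
\<close>

theorem (in group) cocyclic_imp_faithful_irreducible:
  fixes K :: "('k, 'n) ring_scheme"
  assumes K: "field K" and lf: "locally_finite G" and ess: "essential_normal (soc G) G"
    and p: "ring_char K \<notin> normal_primes G"
    and C: "subgroup C G" "C \<subseteq> abelian_soc G" "core G C = {\<one>}"
    and cocyc: "prime_torsion_cyclic G (abelian_soc G) C"
  shows "has_faithful_irreducible_rep G K"
proof -
  interpret group_over_field G K by (intro group_over_field.intro is_group K)
  let ?A = "abelian_soc G"
  have "\<forall>M. \<exists>x. nonabelian_minimal M \<longrightarrow> x \<in> M \<and> x \<noteq> \<one> \<and> (\<exists>n::nat. x [^] n = \<one> \<and> nonzero_in K n)"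
    using nonabelian_minimal_witness[OF lf K p] by blast
  then obtain w where w: "\<And>M. nonabelian_minimal M \<Longrightarrow> w M \<in> M \<and> w M \<noteq> \<one> \<and>
      (\<exists>n::nat. w M [^] n = \<one> \<and> nonzero_in K n)" by metis
  have wM: "\<And>M. nonabelian_minimal M \<Longrightarrow> w M \<in> M \<and> w M \<noteq> \<one>" using w by blast
  define L :: "(nat \<times> 'a) set" where "L = {(n, d). d \<in> carrier G \<and> d [^] n = \<one> \<and> nonzero_in K n \<and>
    (d \<in> ?A \<and> d \<notin> C \<and> (\<exists>q::nat. prime q \<and> d [^] q \<in> C) \<or>
     (\<exists>M. nonabelian_minimal M \<and> d = w M))}"
  have "\<exists>z :: (nat \<times> 'a) set \<times> 'a \<Rightarrow> 'k. z \<in> carrier V \<and> (\<forall>i. \<exists>h. z (i, h) \<noteq> \<zero>\<^bsub>K\<^esub>) \<and>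
      (\<forall>(n, d)\<in>F. T.cyc_sum n d z = \<zero>\<^bsub>V\<^esub>)"
    if F: "finite F" "F \<subseteq> L" for F
  proof -
    define qf where "qf d = (SOME q::nat. prime q \<and> d [^] q \<in> C)" for d
    have qf: "prime (qf d) \<and> d [^] qf d \<in> C" if "\<exists>q::nat. prime q \<and> d [^] q \<in> C" for d
      unfolding qf_def by (rule someI_ex[OF that])
    define mf where "mf d = (SOME M. nonabelian_minimal M \<and> d = w M)" for d
    have mf: "nonabelian_minimal (mf d) \<and> d = w (mf d)" if "\<exists>M. nonabelian_minimal M \<and> d = w M" for d
      unfolding mf_def by (rule someI_ex[OF that])
    define Q where "Q = qf ` {d \<in> snd ` F. \<exists>q::nat. prime q \<and> d [^] q \<in> C}"
    define \<M> where "\<M> = mf ` {d \<in> snd ` F. \<exists>M. nonabelian_minimal M \<and> d = w M}"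
    have Q: "finite Q" "\<And>q. q \<in> Q \<Longrightarrow> prime q" using F qf by (auto simp: Q_def)
    have M: "finite \<M>" "\<And>M. M \<in> \<M> \<Longrightarrow> nonabelian_minimal M" using F mf by (auto simp: \<M>_def)
    obtain z :: "(nat \<times> 'a) set \<times> 'a \<Rightarrow> 'k" where z: "slicewise_nonzero (generate G (?A \<union> \<Union>\<M>)) z"
      "prime_norms_kill ?A C Q z"
      "\<forall>M\<in>\<M>. \<forall>n::nat. w M [^] n = \<one> \<longrightarrow> T.cyc_sum n (w M) z = \<zero>\<^bsub>V\<^esub>"
      using socle_witness[OF C(1,2) cocyc Q M wM] by blast
    have "T.cyc_sum n d z = \<zero>\<^bsub>V\<^esub>" if nd: "(n, d) \<in> F" for n d
    proof -
      have dF: "d \<in> snd ` F" using nd by force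
      have X: "d [^] n = \<one>" "d \<in> ?A \<and> d \<notin> C \<and> (\<exists>q::nat. prime q \<and> d [^] q \<in> C) \<or>
        (\<exists>M. nonabelian_minimal M \<and> d = w M)" using nd F by (auto simp: L_def)
      from X(2) show ?thesis
      proof
        assume d: "d \<in> ?A \<and> d \<notin> C \<and> (\<exists>q::nat. prime q \<and> d [^] q \<in> C)"
        then have "qf d \<in> Q" "d [^] qf d \<in> C" using dF qf by (auto simp: Q_def)
        then show ?thesis using z(2) d X(1) by blast
      next
        assume d: "\<exists>M. nonabelian_minimal M \<and> d = w M"
        then have "mf d \<in> \<M>" "d = w (mf d)" using dF mf by (auto simp: \<M>_def)
        then show ?thesis using z(3) X(1) by metis
      qed
    qed
    then show ?thesis using z(1) unfolding slicewise_nonzero_def by blast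
  qed
  note witness = this
  define zs where "zs F = (SOME z :: (nat \<times> 'a) set \<times> 'a \<Rightarrow> 'k. z \<in> carrier V \<and>
      (\<forall>i. \<exists>h. z (i, h) \<noteq> \<zero>\<^bsub>K\<^esub>) \<and> (\<forall>(n, d)\<in>F. T.cyc_sum n d z = \<zero>\<^bsub>V\<^esub>))" for F
  have zs: "zs F \<in> carrier V \<and> (\<forall>i. \<exists>h. zs F (i, h) \<noteq> \<zero>\<^bsub>K\<^esub>) \<and>
      (\<forall>(n, d)\<in>F. T.cyc_sum n d (zs F) = \<zero>\<^bsub>V\<^esub>)" if "finite F \<and> F \<subseteq> L" for F
    unfolding zs_def by (rule someI_ex[OF witness]) (use that in auto)
  define z where "z = (\<lambda>(F, h). if finite F \<and> F \<subseteq> L then zs F (F, h) else \<zero>\<^bsub>K\<^esub>)"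
  have zV: "z \<in> carrier V" using zs by (auto simp: z_def)
  let ?ev = "\<lambda>P. eventually P (finite_subsets_at_top L)"
  define J0 where "J0 = {f \<in> carrier V. ?ev (\<lambda>F. \<forall>h. f (F, h) = \<zero>\<^bsub>K\<^esub>)}"
  have J0: "subrepresentation J0 G K V tr"
  proof (rule T.subrepI)
    show "J0 \<subseteq> carrier V" by (auto simp: J0_def)
    show "\<zero>\<^bsub>V\<^esub> \<in> J0" by (simp add: J0_def)
    show "f \<oplus>\<^bsub>V\<^esub> f' \<in> J0" if "f \<in> J0" "f' \<in> J0" for f f'
      using that by (auto simp: J0_def elim: eventually_elim2)
    show "a \<odot>\<^bsub>V\<^esub> f \<in> J0" if "a \<in> carrier K" "f \<in> J0" for a f
      using that by (auto simp: J0_def elim: eventually_mono)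
    show "tr g f \<in> J0" if g: "g \<in> carrier G" and f: "f \<in> J0" for g f
    proof -
      have fV: "f \<in> carrier V" and ev: "?ev (\<lambda>F. \<forall>h. f (F, h) = \<zero>\<^bsub>K\<^esub>)" using f unfolding J0_def by blast+
      have "?ev (\<lambda>F. \<forall>h. tr g f (F, h) = \<zero>\<^bsub>K\<^esub>)" using ev
      proof (rule eventually_mono)
        fix F assume "\<forall>h. f (F, h) = \<zero>\<^bsub>K\<^esub>"
        then show "\<forall>h. tr g f (F, h) = \<zero>\<^bsub>K\<^esub>" using tr_apply[OF fV] tr_apply_outside[OF fV] by metis
      qed
      then show ?thesis using T.act_closed[OF g fV] unfolding J0_def by blast
    qed
  qed
  have zJ0: "z \<notin> J0"
  proof
    assume "z \<in> J0"
    then have "?ev (\<lambda>F. \<forall>h. z (F, h) = \<zero>\<^bsub>K\<^esub>)" unfolding J0_def by (elim CollectE conjE)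
    then obtain F where F: "finite F" "F \<subseteq> L"
        "\<forall>Y. finite Y \<and> F \<subseteq> Y \<and> Y \<subseteq> L \<longrightarrow> (\<forall>h. z (Y, h) = \<zero>\<^bsub>K\<^esub>)"
      unfolding eventually_finite_subsets_at_top by (elim exE conjE)
    then have "\<forall>h. z (F, h) = \<zero>\<^bsub>K\<^esub>" by (elim allE[of _ F]) simp
    then have "\<forall>h. zs F (F, h) = \<zero>\<^bsub>K\<^esub>" using F(1,2) by (simp add: z_def)
    then show False using zs[of F] F(1,2) by blast
  qed
  have killed: "T.cyc_sum n d z \<in> J0" if nd: "(n, d) \<in> L" for n d
  proof -
    have dG: "d \<in> carrier G" using nd by (auto simp: L_def)
    have "T.cyc_sum n d z (F, h) = \<zero>\<^bsub>K\<^esub>" if F: "finite F" "F \<subseteq> L" "{(n, d)} \<subseteq> F" for F h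
    proof -
      have "T.cyc_sum n d z (F, h) = T.cyc_sum n d (zs F) (F, h)"
        by (rule cyc_sum_slice[OF zV _ _ dG]) (use zs F in \<open>auto simp: z_def\<close>)
      also have "T.cyc_sum n d (zs F) = \<zero>\<^bsub>V\<^esub>" using zs[of F] F by blast
      finally show ?thesis by simp
    qed
    moreover have "T.cyc_sum n d z \<in> carrier V" by (rule T.cyc_sum_closed[OF dG zV])
    ultimately show ?thesis
      unfolding J0_def eventually_finite_subsets_at_top using nd by (intro CollectI conjI exI[of _ "{(n, d)}"]) auto
  qed
  obtain U :: "('k, ((nat \<times> 'a) set \<times> 'a \<Rightarrow> 'k) set) module" and \<sigma> and J where
    U: "irreducible_rep G K U \<sigma>" "subrepresentation J G K V tr" "J0 \<subseteq> J" "z \<notin> J"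
    "\<forall>g\<in>carrier G. (\<forall>u\<in>carrier U. \<sigma> g u = u) \<longrightarrow> tr g z \<ominus>\<^bsub>V\<^esub> z \<in> J"
    by (rule T.irreducible_section[OF J0 zV zJ0])
  interpret U: representation G K U \<sigma> using U(1) by (simp add: irreducible_rep_def)
  define D where "D = {g \<in> carrier G. \<forall>u\<in>carrier U. \<sigma> g u = u}"
  have D_L: "d \<notin> D" if nd: "(n, d) \<in> L" for n d
  proof
    assume dD: "d \<in> D"
    have dG: "d \<in> carrier G" and n: "nonzero_in K n" using nd by (auto simp: L_def)
    have dz: "tr d z \<ominus>\<^bsub>V\<^esub> z \<in> J" using dD U(5) unfolding D_def by blast
    have "T.cyc_sum n d z \<in> J" using killed[OF nd] U(3) by blast
    then have "z \<in> J" by (rule T.fixed_and_cyc_sum_in_subrep[OF K U(2) dG zV dz _ n])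
    then show False using U(4) by blast
  qed
  have nD: "D \<lhd> G" unfolding D_def by (rule U.kernel_normal)
  have sD: "subgroup D G" using nD normal_imp_subgroup by blast
  have "D = {\<one>}"
  proof (rule ccontr)
    assume "D \<noteq> {\<one>}"
    then have Dsoc: "D \<inter> soc G \<noteq> {\<one>}" using ess nD by (simp add: essential_normal_def)
    have "\<not> M \<subseteq> D" if M: "nonabelian_minimal M" for M
    proof
      assume "M \<subseteq> D"
      then have "w M \<in> D" using wM[OF M] by blast
      moreover obtain n :: nat where "w M [^] n = \<one>" "nonzero_in K n" using w[OF M] by blast
      then have "(n, w M) \<in> L" using M wM[OF M] nonabelian_minimal_carrier[OF M] by (auto simp: L_def)
      ultimately show False using D_L by blast
    qed
    then obtain x where x: "x \<in> D" "x \<in> ?A" "x \<noteq> \<one>" using normal_meets_socle[OF lf nD Dsoc] by blast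
    have "\<exists>d. d \<in> D \<and> d \<in> ?A \<and> d \<notin> C"
    proof (rule ccontr)
      assume "\<nexists>d. d \<in> D \<and> d \<in> ?A \<and> d \<notin> C"
      then have sub: "D \<inter> ?A \<subseteq> C" by blast
      have nDA: "D \<inter> ?A \<lhd> G" by (rule normal_subgroup_intersect[OF nD abelian_soc_normal])
      have xG: "x \<in> carrier G" using x by (simp add: D_def)
      have "g \<otimes> x \<otimes> inv g \<in> C" if "g \<in> carrier G" for g
        using normal.inv_op_closed2[OF nDA that] x sub by blast
      then have "x \<in> core G C" using mem_core_iff[OF C(1)] xG by blast
      then show False using C(3) x by simp
    qed
    then obtain d0 where d0: "d0 \<in> D" "d0 \<in> ?A" "d0 \<notin> C" by blast
    have d0G: "d0 \<in> carrier G" using d0 by (simp add: D_def)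
    \<comment> \<open>Some power of \<open>d0\<close> has prime order modulo \<open>C\<close>: divide the order \<open>k\<close> of \<open>d0\<close> modulo \<open>C\<close> by a prime factor.\<close>
    obtain k :: nat where k: "k > 0" "d0 [^] k \<in> C" "\<forall>m. 0 < m \<longrightarrow> m < k \<longrightarrow> d0 [^] m \<notin> C"
      by (rule least_power_in_subgroup[OF d0G locally_finite_torsion[OF lf d0G] C(1)])
    have "k \<noteq> 1" using k(2) d0(3) d0G by auto
    then obtain q where q: "prime q" "q dvd k" using prime_factor_nat by blast
    then obtain t where t: "k = q * t" by auto
    have t0: "0 < t" "t < k" using k(1) t prime_gt_1_nat[OF q(1)] by auto
    have dC: "d0 [^] t \<notin> C" using k(3) t0 by blast
    define d where "d = d0 [^] t"
    have "d [^] q = d0 [^] k" using d0G t by (simp add: d_def nat_pow_pow mult.commute)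
    then have d: "d \<in> D" "d \<in> ?A" "d \<notin> C" "d [^] q \<in> C" "d \<in> carrier G"
      using d0 d0G sD abelian_soc_subgroup dC k(2) by (auto simp: d_def pow_in_subgroup)
    obtain n :: nat where n: "n > 0" "d [^] n = \<one>" "\<forall>p. prime p \<and> p dvd n \<longrightarrow> p \<in> normal_primes G"
      using abelian_soc_exponent[OF d(2)] by blast
    have "nonzero_in K n"
      by (rule ring_char_not_normal_prime_nonzero[OF K p n(1)]) (use n(3) in blast)
    then have "(n, d) \<in> L" using d n(2) q(1) by (auto simp: L_def)
    then show False using D_L d(1) by blast
  qed
  then have "faithful_rep G K U \<sigma>"
    using U.representation_axioms unfolding faithful_rep_def D_def by blast
  then show ?thesis by (rule has_faithful_irreducible_repI[OF U(1)])
qed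

section \<open>Groups with a faithful irreducible representation\<close>

theorem theorem1p2:
  fixes G :: "('g, 'm) monoid_scheme" and K :: "('k, 'n) ring_scheme"
  assumes "field K"
    and "group G"
    and "locally_finite G"
    and "essential_normal (soc G) G"
  shows "has_faithful_irreducible_rep G K \<longleftrightarrow>
    ring_char K \<notin> normal_primes G \<and>
    (\<exists>C. subgroup C (G\<lparr>carrier := abelian_soc G\<rparr>) \<and>
         locally_cyclic ((G\<lparr>carrier := abelian_soc G\<rparr>) Mod C) \<and>
         core G C = {\<one>\<^bsub>G\<^esub>})"
proof
  interpret group G by (rule assms(2))
  assume "has_faithful_irreducible_rep G K"
  then obtain V :: "('k, 'g \<Rightarrow> 'k) module" and \<rho> where
    irr: "irreducible_rep G K V \<rho>" and faith: "faithful_rep G K V \<rho>"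
    unfolding has_faithful_irreducible_rep_def by blast
  interpret representation G K V \<rho> using irr by (simp add: irreducible_rep_def)
  have p: "ring_char K \<notin> normal_primes G"
  proof
    assume "ring_char K \<in> normal_primes G"
    then obtain N where N: "prime (ring_char K)" "N \<lhd> G" "N \<noteq> {\<one>\<^bsub>G\<^esub>}"
      "p_group (ring_char K) (G\<lparr>carrier := N\<rparr>)" by (auto simp: normal_primes_def)
    have "add_pow K (ring_char K) \<one>\<^bsub>K\<^esub> = \<zero>\<^bsub>K\<^esub>"
      by (simp add: ring_char_eq_0_iff[OF assms(1)])
    then have "\<forall>v\<in>carrier V. \<rho> n v = v" if "n \<in> N" for n
      using normal_p_subgroup_acts_trivially[OF assms(3) irr N(2,4,1)] that by blast
    moreover have "N \<subseteq> carrier G" "\<one>\<^bsub>G\<^esub> \<in> N"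
      using N(2) normal_imp_subgroup subgroup.subset subgroup.one_closed by blast+
    ultimately have "N = {\<one>\<^bsub>G\<^esub>}" using faith unfolding faithful_rep_def by blast
    then show False using N(3) by blast
  qed
  have expo: "\<exists>n::nat. x [^]\<^bsub>G\<^esub> n = \<one>\<^bsub>G\<^esub> \<and> nonzero_in K n" if "x \<in> abelian_soc G" for x
    using abelian_soc_exponent[OF that] ring_char_not_normal_prime_nonzero[OF assms(1) p] by metis
  obtain C where C: "subgroup C G" "C \<subseteq> abelian_soc G" "core G C = {\<one>\<^bsub>G\<^esub>}"
    "prime_torsion_cyclic G (abelian_soc G) C"
    by (rule faithful_irreducible_cocyclic[OF assms(1) irr faith abelian_soc_normal abelian_soc_commute expo])
  have CA: "subgroup C (G\<lparr>carrier := abelian_soc G\<rparr>)"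
    by (rule subgroup_incl[OF C(1) abelian_soc_subgroup C(2)])
  then have "locally_cyclic ((G\<lparr>carrier := abelian_soc G\<rparr>) Mod C)"
    using locally_cyclic_abelian_soc_Mod_iff C(4) by blast
  then show "ring_char K \<notin> normal_primes G \<and>
    (\<exists>C. subgroup C (G\<lparr>carrier := abelian_soc G\<rparr>) \<and>
         locally_cyclic ((G\<lparr>carrier := abelian_soc G\<rparr>) Mod C) \<and> core G C = {\<one>\<^bsub>G\<^esub>})"
    using p CA C(3) by blast
next
  interpret group G by (rule assms(2))
  assume R: "ring_char K \<notin> normal_primes G \<and>
    (\<exists>C. subgroup C (G\<lparr>carrier := abelian_soc G\<rparr>) \<and>
         locally_cyclic ((G\<lparr>carrier := abelian_soc G\<rparr>) Mod C) \<and> core G C = {\<one>\<^bsub>G\<^esub>})"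
  then obtain C where C: "subgroup C (G\<lparr>carrier := abelian_soc G\<rparr>)"
    "locally_cyclic ((G\<lparr>carrier := abelian_soc G\<rparr>) Mod C)" "core G C = {\<one>\<^bsub>G\<^esub>}" by blast
  have CG: "subgroup C G" by (rule incl_subgroup[OF abelian_soc_subgroup C(1)])
  have CA: "C \<subseteq> abelian_soc G" using subgroup.subset[OF C(1)] by simp
  have "prime_torsion_cyclic G (abelian_soc G) C"
    using locally_cyclic_abelian_soc_Mod_iff[OF C(1)] C(2) by blast
  then show "has_faithful_irreducible_rep G K"
    using cocyclic_imp_faithful_irreducible[OF assms(1,3,4) _ CG CA C(3)] R by blast
qed

end
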